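(* Let $\mathcal{M}$ be a cofinal exact subcategory of an exact category $\mathcal{N}$. Then the inclusion functor $\mathcal{M} \hookrightarrow \mathcal{N}$ induces an injection $K_{0}\mathcal{M} \hookrightarrow K_{0}\mathcal{N}$ and isomorphisms $K_{n}\mathcal{M} \cong K_{n}\mathcal{N}$ for all $n > 0$.
   Context: Exact categories are in the sense of Quillen: additive categories with a distinguished class of short exact sequences $N' \rightarrowtail N \twoheadrightarrow N''$ satisfying Quillen's axioms. An exact subcategory of an exact category $\mathcal{N}$ is a full (additive) subcategory closed under extensions in $\mathcal{N}$; its short exact sequences are those of $\mathcal{N}$ with all terms in the subcategory. An exact subcategory $\mathcal{M}$ of $\mathcal{N}$ is cofinal in $\mathcal{N}$ if for every object $N_1$ of $\mathcal{N}$ there exists an object $N_2$ of $\mathcal{N}$ such that $N_1\oplus N_2$ is isomorphic to an object of $\mathcal{M}$. Acyclic complexes: a bounded chain complex $(N,d)$ in an exact category $\mathcal{N}$ is acyclic if each differential $d_k : N_k \to N_{k-1}$ factors as $N_k \twoheadrightarrow Z_{k-1} \rightarrowtail N_{k-1}$ such that each $Z_k \rightarrowtail N_k \twoheadrightarrow Z_{k-1}$ is a short exact sequence of $\mathcal{N}$. Acyclic binary complexes: a bounded acyclic binary complex in $\mathcal{N}$ is a triple $(N,d,\tilde d)$ such that $(N,d)$ and $(N,\tilde d)$ are both bounded acyclic complexes in $\mathcal{N}$ on the same graded object. Morphisms are morphisms of graded objects commuting with both differentials, and a composable pair of morphisms is short exact if it is short exact term-wise in $\mathcal{N}$. This gives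 an exact category $B^{\mathrm{q}}\mathcal{N}$. Put $(B^{\mathrm{q}})^{0}\mathcal{N}=\mathcal{N}$ and $(B^{\mathrm{q}})^{n}\mathcal{N} = B^{\mathrm{q}}\cdots B^{\mathrm{q}}\mathcal{N}$ ($n$ times). Equivalently, an object of $(B^{\mathrm{q}})^{n}\mathcal{N}$ (a bounded acyclic binary multicomplex of dimension $n$) is a bounded $\mathbb{Z}^n$-graded collection of objects of $\mathcal{N}$ with a pair of acyclic differentials $d^i,\tilde d^i$ in each direction $1\le i\le n$, such that any two differentials in different directions commute. An object of $(B^{\mathrm{q}})^{n}\mathcal{N}$ is diagonal in direction $i$ if $d^i=\tilde d^i$, and diagonal if it is diagonal in at least one direction $i$. $K$-groups: for $n\ge 0$, $K_n\mathcal{N}$ is defined as the abelian group with one generator $[N]$ for each object $N$ of $(B^{\mathrm{q}})^{n}\mathcal{N}$, and relations $[N']+[N'']=[N]$ for each short exact sequence $N'\rightarrowtail N\twoheadrightarrow N''$ in $(B^{\mathrm{q}})^{n}\mathcal{N}$, and $[T]=0$ for each diagonal object $T$. For $n=0$ there are no diagonal objects and $K_0\mathcal{N}$ is the Grothendieck group. An exact functor induces homomorphisms on all $K_n$ by being applied term-wise to multicomplexes. *)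

theory Defs
  imports "HOL-Algebra.Free_Abelian_Groups" "HOL-Algebra.Generated_Groups"
begin

section \<open>Exact categories\<close>

text \<open>
  A small category is given by a set of objects and a set of arrows; every arrow carries its domain
  and codomain, and all operations are only meaningful on these sets. The composite
  \<open>g \<cdot>\<^bsub>C\<^esub> f\<close> means first \<open>f\<close>, then \<open>g\<close>.
  \<open>Ses C\<close> is the distinguished class of short exact sequences, a sequence
  \<open>N' \<rightarrow> N \<rightarrow> N''\<close> being recorded as the pair of its two arrows.
\<close>

record ('o, 'm) excat =
  Obj :: "'o set"
  Arr :: "'m set"
  Dom :: "'m \<Rightarrow> 'o"
  Cod :: "'m \<Rightarrow> 'o"
  Idn :: "'o \<Rightarrow> 'm"
  Cmp :: "'m \<Rightarrow> 'm \<Rightarrow> 'm"  (infixl "\<cdot>\<index>" 70)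
  Add :: "'m \<Rightarrow> 'm \<Rightarrow> 'm"
  Zro :: "'o \<Rightarrow> 'o \<Rightarrow> 'm"
  Ses :: "('m \<times> 'm) set"

definition Hom :: "('o, 'm) excat \<Rightarrow> 'o \<Rightarrow> 'o \<Rightarrow> 'm set" where
  "Hom C A B = {f \<in> Arr C. Dom C f = A \<and> Cod C f = B}"

definition hom_group :: "('o, 'm) excat \<Rightarrow> 'o \<Rightarrow> 'o \<Rightarrow> 'm monoid" where
  "hom_group C A B = \<lparr>carrier = Hom C A B, monoid.mult = Add C, one = Zro C A B\<rparr>"

definition isomorphism :: "('o, 'm) excat \<Rightarrow> 'm \<Rightarrow> bool" where
  "isomorphism C f \<longleftrightarrow> f \<in> Arr C \<and>
     (\<exists>g \<in> Hom C (Cod C f) (Dom C f). g \<cdot>\<^bsub>C\<^esub> f = Idn C (Dom C f) \<and> f \<cdot>\<^bsub>C\<^esub> g = Idn C (Cod C f))"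

definition isomorphic :: "('o, 'm) excat \<Rightarrow> 'o \<Rightarrow> 'o \<Rightarrow> bool" where
  "isomorphic C A B \<longleftrightarrow> (\<exists>f \<in> Hom C A B. isomorphism C f)"

definition zero_object :: "('o, 'm) excat \<Rightarrow> 'o \<Rightarrow> bool" where
  "zero_object C Z \<longleftrightarrow> Z \<in> Obj C \<and>
     (\<forall>A \<in> Obj C. (\<exists>!f. f \<in> Hom C Z A) \<and> (\<exists>!f. f \<in> Hom C A Z))"

definition biproduct :: "('o, 'm) excat \<Rightarrow> 'o \<Rightarrow> 'o \<Rightarrow> 'o \<Rightarrow> 'm \<Rightarrow> 'm \<Rightarrow> 'm \<Rightarrow> 'm \<Rightarrow> bool" where
  "biproduct C A B S i j p q \<longleftrightarrow> A \<in> Obj C \<and> B \<in> Obj C \<and> S \<in> Obj C \<and>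
     i \<in> Hom C A S \<and> j \<in> Hom C B S \<and> p \<in> Hom C S A \<and> q \<in> Hom C S B \<and>
     p \<cdot>\<^bsub>C\<^esub> i = Idn C A \<and> q \<cdot>\<^bsub>C\<^esub> j = Idn C B \<and> p \<cdot>\<^bsub>C\<^esub> j = Zro C B A \<and> q \<cdot>\<^bsub>C\<^esub> i = Zro C A B \<and>
     Add C (i \<cdot>\<^bsub>C\<^esub> p) (j \<cdot>\<^bsub>C\<^esub> q) = Idn C S"

definition direct_sum :: "('o, 'm) excat \<Rightarrow> 'o \<Rightarrow> 'o \<Rightarrow> 'o \<Rightarrow> bool" where
  "direct_sum C A B S \<longleftrightarrow> (\<exists>i j p q. biproduct C A B S i j p q)"

definition kernel_of :: "('o, 'm) excat \<Rightarrow> 'm \<Rightarrow> 'm \<Rightarrow> bool" where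
  "kernel_of C p i \<longleftrightarrow> p \<in> Arr C \<and> i \<in> Arr C \<and> Cod C i = Dom C p \<and>
     p \<cdot>\<^bsub>C\<^esub> i = Zro C (Dom C i) (Cod C p) \<and>
     (\<forall>f \<in> Arr C. Cod C f = Dom C p \<longrightarrow> p \<cdot>\<^bsub>C\<^esub> f = Zro C (Dom C f) (Cod C p) \<longrightarrow>
        (\<exists>!h. h \<in> Hom C (Dom C f) (Dom C i) \<and> i \<cdot>\<^bsub>C\<^esub> h = f))"

definition cokernel_of :: "('o, 'm) excat \<Rightarrow> 'm \<Rightarrow> 'm \<Rightarrow> bool" where
  "cokernel_of C i p \<longleftrightarrow> i \<in> Arr C \<and> p \<in> Arr C \<and> Cod C i = Dom C p \<and>
     p \<cdot>\<^bsub>C\<^esub> i = Zro C (Dom C i) (Cod C p) \<and>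
     (\<forall>f \<in> Arr C. Dom C f = Cod C i \<longrightarrow> f \<cdot>\<^bsub>C\<^esub> i = Zro C (Dom C i) (Cod C f) \<longrightarrow>
        (\<exists>!h. h \<in> Hom C (Cod C p) (Cod C f) \<and> h \<cdot>\<^bsub>C\<^esub> p = f))"

text \<open>
  \<open>pullback C p f p' f'\<close>: the square with \<open>p \<cdot> f' = f \<cdot> p'\<close> is cartesian, so that \<open>p'\<close> is the base
  change of \<open>p\<close> along \<open>f\<close>. \<open>pushout C i f i' f'\<close>: the square with \<open>f' \<cdot> i = i' \<cdot> f\<close> is cocartesian,
  so that \<open>i'\<close> is the cobase change of \<open>i\<close> along \<open>f\<close>.
\<close>

definition pullback :: "('o, 'm) excat \<Rightarrow> 'm \<Rightarrow> 'm \<Rightarrow> 'm \<Rightarrow> 'm \<Rightarrow> bool" where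
  "pullback C p f p' f' \<longleftrightarrow> p \<in> Arr C \<and> f \<in> Arr C \<and> Cod C p = Cod C f \<and>
     (\<exists>P \<in> Obj C. p' \<in> Hom C P (Dom C f) \<and> f' \<in> Hom C P (Dom C p) \<and> p \<cdot>\<^bsub>C\<^esub> f' = f \<cdot>\<^bsub>C\<^esub> p' \<and>
       (\<forall>T \<in> Obj C. \<forall>a \<in> Hom C T (Dom C p). \<forall>b \<in> Hom C T (Dom C f). p \<cdot>\<^bsub>C\<^esub> a = f \<cdot>\<^bsub>C\<^esub> b \<longrightarrow>
          (\<exists>!h. h \<in> Hom C T P \<and> f' \<cdot>\<^bsub>C\<^esub> h = a \<and> p' \<cdot>\<^bsub>C\<^esub> h = b)))"

definition pushout :: "('o, 'm) excat \<Rightarrow> 'm \<Rightarrow> 'm \<Rightarrow> 'm \<Rightarrow> 'm \<Rightarrow> bool" where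
  "pushout C i f i' f' \<longleftrightarrow> i \<in> Arr C \<and> f \<in> Arr C \<and> Dom C i = Dom C f \<and>
     (\<exists>P \<in> Obj C. i' \<in> Hom C (Cod C f) P \<and> f' \<in> Hom C (Cod C i) P \<and> f' \<cdot>\<^bsub>C\<^esub> i = i' \<cdot>\<^bsub>C\<^esub> f \<and>
       (\<forall>T \<in> Obj C. \<forall>a \<in> Hom C (Cod C i) T. \<forall>b \<in> Hom C (Cod C f) T. a \<cdot>\<^bsub>C\<^esub> i = b \<cdot>\<^bsub>C\<^esub> f \<longrightarrow>
          (\<exists>!h. h \<in> Hom C P T \<and> h \<cdot>\<^bsub>C\<^esub> f' = a \<and> h \<cdot>\<^bsub>C\<^esub> i' = b)))"

definition admissible_mono :: "('o, 'm) excat \<Rightarrow> 'm \<Rightarrow> bool" where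
  "admissible_mono C i \<longleftrightarrow> (\<exists>p. (i, p) \<in> Ses C)"

definition admissible_epi :: "('o, 'm) excat \<Rightarrow> 'm \<Rightarrow> bool" where
  "admissible_epi C p \<longleftrightarrow> (\<exists>i. (i, p) \<in> Ses C)"

locale category =
  fixes C :: "('o, 'm) excat" (structure)
  assumes Dom_closed: "f \<in> Arr C \<Longrightarrow> Dom C f \<in> Obj C"
    and Cod_closed: "f \<in> Arr C \<Longrightarrow> Cod C f \<in> Obj C"
    and Idn_closed: "A \<in> Obj C \<Longrightarrow> Idn C A \<in> Hom C A A"
    and Cmp_closed: "\<lbrakk>f \<in> Arr C; g \<in> Arr C; Cod C f = Dom C g\<rbrakk> \<Longrightarrow> g \<cdot> f \<in> Hom C (Dom C f) (Cod C g)"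
    and Idn_left: "f \<in> Arr C \<Longrightarrow> Idn C (Cod C f) \<cdot> f = f"
    and Idn_right: "f \<in> Arr C \<Longrightarrow> f \<cdot> Idn C (Dom C f) = f"
    and Cmp_assoc: "\<lbrakk>f \<in> Arr C; g \<in> Arr C; h \<in> Arr C; Cod C f = Dom C g; Cod C g = Dom C h\<rbrakk>
        \<Longrightarrow> (h \<cdot> g) \<cdot> f = h \<cdot> (g \<cdot> f)"

locale additive_category = category +
  assumes hom_group: "\<lbrakk>A \<in> Obj C; B \<in> Obj C\<rbrakk> \<Longrightarrow> comm_group (hom_group C A B)"
    and Cmp_Add_left: "\<lbrakk>f \<in> Hom C A B; g \<in> Hom C B D; h \<in> Hom C B D\<rbrakk>
        \<Longrightarrow> Add C g h \<cdot> f = Add C (g \<cdot> f) (h \<cdot> f)"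
    and Cmp_Add_right: "\<lbrakk>f \<in> Hom C A B; g \<in> Hom C A B; h \<in> Hom C B D\<rbrakk>
        \<Longrightarrow> h \<cdot> Add C f g = Add C (h \<cdot> f) (h \<cdot> g)"
    and zero_object_exists: "\<exists>Z. zero_object C Z"
    and direct_sum_exists: "\<lbrakk>A \<in> Obj C; B \<in> Obj C\<rbrakk> \<Longrightarrow> \<exists>S. direct_sum C A B S"

text \<open>
  Quillen's axioms in their original form; the last two assumptions are his axiom c), which is
  known to follow from the others.
\<close>

locale exact_category = additive_category +
  assumes Ses_kernel: "(i, p) \<in> Ses C \<Longrightarrow> kernel_of C p i"
    and Ses_cokernel: "(i, p) \<in> Ses C \<Longrightarrow> cokernel_of C i p"
    and Ses_isomorphic: "\<lbrakk>(i, p) \<in> Ses C; isomorphism C a; isomorphism C b; isomorphism C c;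
          Dom C a = Dom C i; Dom C b = Cod C i; Dom C c = Cod C p;
          i' \<in> Hom C (Cod C a) (Cod C b); p' \<in> Hom C (Cod C b) (Cod C c);
          b \<cdot> i = i' \<cdot> a; c \<cdot> p = p' \<cdot> b\<rbrakk> \<Longrightarrow> (i', p') \<in> Ses C"
    and Ses_split: "biproduct C A B S i j p q \<Longrightarrow> (i, q) \<in> Ses C"
    and admissible_epi_Cmp: "\<lbrakk>admissible_epi C p; admissible_epi C q; Cod C p = Dom C q\<rbrakk>
          \<Longrightarrow> admissible_epi C (q \<cdot> p)"
    and admissible_mono_Cmp: "\<lbrakk>admissible_mono C i; admissible_mono C j; Cod C i = Dom C j\<rbrakk>
          \<Longrightarrow> admissible_mono C (j \<cdot> i)"
    and admissible_epi_base_change: "\<lbrakk>admissible_epi C p; f \<in> Arr C; Cod C f = Cod C p\<rbrakk>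
          \<Longrightarrow> \<exists>p' f'. pullback C p f p' f' \<and> admissible_epi C p'"
    and admissible_mono_cobase_change: "\<lbrakk>admissible_mono C i; f \<in> Arr C; Dom C f = Dom C i\<rbrakk>
          \<Longrightarrow> \<exists>i' f'. pushout C i f i' f' \<and> admissible_mono C i'"
    and admissible_epi_cancel: "\<lbrakk>p \<in> Arr C; kernel_of C p k; g \<in> Arr C; Cod C g = Dom C p;
          admissible_epi C (p \<cdot> g)\<rbrakk> \<Longrightarrow> admissible_epi C p"
    and admissible_mono_cancel: "\<lbrakk>i \<in> Arr C; cokernel_of C i k; g \<in> Arr C; Dom C g = Cod C i;
          admissible_mono C (g \<cdot> i)\<rbrakk> \<Longrightarrow> admissible_mono C i"


section \<open>Cofinal exact subcategories\<close>

definition full_subcategory :: "('o, 'm) excat \<Rightarrow> 'o set \<Rightarrow> ('o, 'm) excat" where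
  "full_subcategory N S = N\<lparr>Obj := S,
     Arr := {f \<in> Arr N. Dom N f \<in> S \<and> Cod N f \<in> S},
     Ses := {(i, p) \<in> Ses N. Dom N i \<in> S \<and> Cod N i \<in> S \<and> Cod N p \<in> S}\<rparr>"

text \<open>
  Closure under sums and extensions is up to isomorphism, as in Quillen's definition: the subcategory
  need not be closed under isomorphisms (if it is, this is plain closure).
\<close>

definition exact_subcategory :: "('o, 'm) excat \<Rightarrow> ('o, 'm) excat \<Rightarrow> bool" where
  "exact_subcategory M N \<longleftrightarrow> Obj M \<subseteq> Obj N \<and> M = full_subcategory N (Obj M) \<and>
     (\<exists>Z \<in> Obj M. zero_object N Z) \<and>
     (\<forall>A \<in> Obj M. \<forall>B \<in> Obj M. \<exists>S \<in> Obj M. direct_sum N A B S) \<and>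
     (\<forall>(i, p) \<in> Ses N. Dom N i \<in> Obj M \<longrightarrow> Cod N p \<in> Obj M \<longrightarrow>
        (\<exists>E \<in> Obj M. isomorphic N (Cod N i) E))"

definition cofinal_subcategory :: "('o, 'm) excat \<Rightarrow> ('o, 'm) excat \<Rightarrow> bool" where
  "cofinal_subcategory M N \<longleftrightarrow> (\<forall>A \<in> Obj N. \<exists>B \<in> Obj N. \<exists>S. direct_sum N A B S \<and>
     (\<exists>E \<in> Obj M. isomorphic N S E))"


section \<open>Acyclic binary complexes\<close>

text \<open>A complex \<open>(X, d)\<close> has differentials \<open>d k : X k \<rightarrow> X (k - 1)\<close> for all integers \<open>k\<close>.\<close>

definition bounded_complex :: "('o, 'm) excat \<Rightarrow> (int \<Rightarrow> 'o) \<Rightarrow> (int \<Rightarrow> 'm) \<Rightarrow> bool" where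
  "bounded_complex C X d \<longleftrightarrow> (\<forall>k. X k \<in> Obj C) \<and> (\<exists>b. \<forall>k. \<bar>k\<bar> > b \<longrightarrow> zero_object C (X k)) \<and>
     (\<forall>k. d k \<in> Hom C (X k) (X (k - 1))) \<and>
     (\<forall>k. d (k - 1) \<cdot>\<^bsub>C\<^esub> d k = Zro C (X k) (X (k - 2)))"

definition acyclic_complex :: "('o, 'm) excat \<Rightarrow> (int \<Rightarrow> 'o) \<Rightarrow> (int \<Rightarrow> 'm) \<Rightarrow> bool" where
  "acyclic_complex C X d \<longleftrightarrow> bounded_complex C X d \<and>
     (\<exists>Z m e. (\<forall>k. m k \<in> Hom C (Z k) (X k)) \<and> (\<forall>k. e k \<in> Hom C (X k) (Z (k - 1))) \<and>
        (\<forall>k. d k = m (k - 1) \<cdot>\<^bsub>C\<^esub> e k) \<and> (\<forall>k. (m k, e k) \<in> Ses C))"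

text \<open>
  To iterate the passage from an exact category to its category of acyclic binary complexes at a
  single type, the objects and arrows of all the iterates are collected in a pair of
  datatypes: \<open>Cpx X d d'\<close> is the binary complex \<open>(X, d, d')\<close>, and \<open>CpxArr X Y f\<close> is an arrow from
  \<open>X\<close> to \<open>Y\<close> with components \<open>f k\<close>. The objects of dimension 0 are those of the given category.
\<close>

datatype ('o, 'm) mobj =
    Base (base_obj: 'o)
  | Cpx (graded: "int \<Rightarrow> ('o, 'm) mobj") (diff1: "int \<Rightarrow> ('o, 'm) marr") (diff2: "int \<Rightarrow> ('o, 'm) marr")
and ('o, 'm) marr =
    BaseArr (base_arr: 'm)
  | CpxArr (source: "('o, 'm) mobj") (target: "('o, 'm) mobj") (component: "int \<Rightarrow> ('o, 'm) marr")

definition base_category :: "('o, 'm) excat \<Rightarrow> (('o, 'm) mobj, ('o, 'm) marr) excat" where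
  "base_category N = \<lparr>
     Obj = Base ` Obj N,
     Arr = BaseArr ` Arr N,
     Dom = (\<lambda>f. Base (Dom N (base_arr f))),
     Cod = (\<lambda>f. Base (Cod N (base_arr f))),
     Idn = (\<lambda>X. BaseArr (Idn N (base_obj X))),
     Cmp = (\<lambda>g f. BaseArr (base_arr g \<cdot>\<^bsub>N\<^esub> base_arr f)),
     Add = (\<lambda>f g. BaseArr (Add N (base_arr f) (base_arr g))),
     Zro = (\<lambda>X Y. BaseArr (Zro N (base_obj X) (base_obj Y))),
     Ses = {(BaseArr i, BaseArr p) | i p. (i, p) \<in> Ses N}\<rparr>"

definition Bq_obj :: "(('o, 'm) mobj, ('o, 'm) marr) excat \<Rightarrow> ('o, 'm) mobj set" where
  "Bq_obj C = {Cpx X d d' | X d d'. acyclic_complex C X d \<and> acyclic_complex C X d'}"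

definition Bq_arr :: "(('o, 'm) mobj, ('o, 'm) marr) excat \<Rightarrow> ('o, 'm) marr set" where
  "Bq_arr C = {CpxArr X Y f | X Y f. X \<in> Bq_obj C \<and> Y \<in> Bq_obj C \<and>
     (\<forall>k. f k \<in> Hom C (graded X k) (graded Y k)) \<and>
     (\<forall>k. f (k - 1) \<cdot>\<^bsub>C\<^esub> diff1 X k = diff1 Y k \<cdot>\<^bsub>C\<^esub> f k) \<and>
     (\<forall>k. f (k - 1) \<cdot>\<^bsub>C\<^esub> diff2 X k = diff2 Y k \<cdot>\<^bsub>C\<^esub> f k)}"

definition Bq :: "(('o, 'm) mobj, ('o, 'm) marr) excat \<Rightarrow> (('o, 'm) mobj, ('o, 'm) marr) excat" where
  "Bq C = \<lparr>
     Obj = Bq_obj C,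
     Arr = Bq_arr C,
     Dom = source,
     Cod = target,
     Idn = (\<lambda>X. CpxArr X X (\<lambda>k. Idn C (graded X k))),
     Cmp = (\<lambda>g f. CpxArr (source f) (target g) (\<lambda>k. component g k \<cdot>\<^bsub>C\<^esub> component f k)),
     Add = (\<lambda>f g. CpxArr (source f) (target f) (\<lambda>k. Add C (component f k) (component g k))),
     Zro = (\<lambda>X Y. CpxArr X Y (\<lambda>k. Zro C (graded X k) (graded Y k))),
     Ses = {(i, p). i \<in> Bq_arr C \<and> p \<in> Bq_arr C \<and> target i = source p \<and>
              (\<forall>k. (component i k, component p k) \<in> Ses C)}\<rparr>"

definition Bq_iter :: "nat \<Rightarrow> ('o, 'm) excat \<Rightarrow> (('o, 'm) mobj, ('o, 'm) marr) excat" where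
  "Bq_iter n N = (Bq ^^ n) (base_category N)"

text \<open>
  The directions of an \<open>n\<close>-dimensional multicomplex are numbered \<open>0, \<dots>, n - 1\<close> starting from the
  outermost one.
\<close>

primrec diagonal_in :: "nat \<Rightarrow> ('o, 'm) mobj \<Rightarrow> bool" where
  "diagonal_in 0 X \<longleftrightarrow> diff1 X = diff2 X"
| "diagonal_in (Suc i) X \<longleftrightarrow> (\<forall>k. diagonal_in i (graded X k))"

definition diagonal :: "nat \<Rightarrow> ('o, 'm) mobj \<Rightarrow> bool" where
  "diagonal n X \<longleftrightarrow> (\<exists>i < n. diagonal_in i X)"


section \<open>K-groups\<close>

definition K_free :: "nat \<Rightarrow> ('o, 'm) excat \<Rightarrow> (('o, 'm) mobj \<Rightarrow>\<^sub>0 int) monoid" where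
  "K_free n N = free_Abelian_group (Obj (Bq_iter n N))"

definition K_relators :: "nat \<Rightarrow> ('o, 'm) excat \<Rightarrow> (('o, 'm) mobj \<Rightarrow>\<^sub>0 int) set" where
  "K_relators n N =
     {frag_of (Dom (Bq_iter n N) i) + frag_of (Cod (Bq_iter n N) p) - frag_of (Cod (Bq_iter n N) i) | i p.
        (i, p) \<in> Ses (Bq_iter n N)}
     \<union> {frag_of T | T. T \<in> Obj (Bq_iter n N) \<and> diagonal n T}"

definition K_relations :: "nat \<Rightarrow> ('o, 'm) excat \<Rightarrow> (('o, 'm) mobj \<Rightarrow>\<^sub>0 int) set" where
  "K_relations n N = generate (K_free n N) (K_relators n N)"

definition K :: "nat \<Rightarrow> ('o, 'm) excat \<Rightarrow> (('o, 'm) mobj \<Rightarrow>\<^sub>0 int) set monoid" where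
  "K n N = K_free n N Mod K_relations n N"

text \<open>
  A functor is given by its maps \<open>F\<close> on objects and \<open>G\<close> on arrows; its term-wise application to
  multicomplexes is \<open>map_mobj F G\<close>. The union below joins the cosets of the images of
  all representatives of \<open>c\<close>; these coincide when the functor is exact.
\<close>

definition K_map :: "nat \<Rightarrow> ('o2, 'm2) excat \<Rightarrow> ('o \<Rightarrow> 'o2) \<Rightarrow> ('m \<Rightarrow> 'm2)
    \<Rightarrow> (('o, 'm) mobj \<Rightarrow>\<^sub>0 int) set \<Rightarrow> (('o2, 'm2) mobj \<Rightarrow>\<^sub>0 int) set" where
  "K_map n N F G c =
     (\<Union>x \<in> c. K_relations n N #>\<^bsub>K_free n N\<^esub> frag_extend (\<lambda>X. frag_of (map_mobj F G X)) x)"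

abbreviation inclusion_K :: "nat \<Rightarrow> ('o, 'm) excat
    \<Rightarrow> (('o, 'm) mobj \<Rightarrow>\<^sub>0 int) set \<Rightarrow> (('o, 'm) mobj \<Rightarrow>\<^sub>0 int) set" where
  "inclusion_K n N \<equiv> K_map n N (\<lambda>X. X) (\<lambda>f. f)"

end

theory Submission
  imports Defs "HOL-Library.Multiset"
begin

text \<open>
  Let \<open>C\<close> be the category of \<open>n\<close>-dimensional multicomplexes of \<open>N\<close> and \<open>S\<close> the set of those of \<open>M\<close>. Write
  \<open>A \<sim> B\<close> if \<open>A \<oplus> U\<close> and \<open>B \<oplus> U\<close> are isomorphic to objects of \<open>S\<close> for some \<open>U\<close>; the quotient is
  \<open>K\<^sub>0 C / K\<^sub>0 S\<close>, so \<open>\<sim>\<close> is additive on short exact sequences.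

  If two binary complexes \<open>X\<close>, \<open>Y\<close> satisfy \<open>X\<^sub>k \<sim> Y\<^sub>k\<close> for all \<open>k\<close>, then induction on \<open>k\<close> shows that all
  their cycle objects in degree \<open>k\<close>, for both differentials, are equivalent. Hence they have a
  common complement \<open>A\<^sub>k\<close>, and the diagonal complex with entries \<open>A\<^sub>k \<oplus> A\<^sub>k\<^sub>-\<^sub>1\<close> and cycles \<open>A\<^sub>k\<close> is
  a common complement of \<open>X\<close> and \<open>Y\<close> (after enlarging the \<open>A\<^sub>k\<close> to make the entries lie in \<open>S\<close>).
  This gives cofinality in all dimensions with diagonal complements, hence surjectivity on
  \<open>K\<^sub>n\<close> for \<open>n > 0\<close>. Only direct sums of short exact sequences are needed along the way, so the
  base change axioms are not carried over to complexes.

  For injectivity, a relation of \<open>N\<close> between objects of \<open>S\<close> is made a relation of \<open>S\<close> by adding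
  complements. A diagonal object \<open>T\<close> is replaced by a diagonal object \<open>T \<oplus> U\<close> of \<open>S\<close>, with \<open>U\<close> diagonal in
  the outermost direction. The error is a difference \<open>[X] - [Y]\<close> with \<open>X\<close>, \<open>Y\<close> diagonal in this
  direction and \<open>X \<sim> Y\<close>. Then \<open>X\<^sub>k \<sim> Y\<^sub>k\<close>, and a common diagonal complement rewrites the error as a
  difference of diagonal objects of \<open>S\<close>.
\<close>


section \<open>Additive categories\<close>

text \<open>The induction over dimensions shapes the proof: whatever is assumed of one category has
  to be reproduced by \<open>Bq\<close>. Closure of the subcategory under extensions is not carried
  along, since a complex belongs to the subcategory only if suitable cycle objects do. It is
  replaced by a condition on complements: for a short exact sequence, the middle term and the direct
  sum of the outer terms have a common complement. Applied in each degree, this makes two complexes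
  termwise equivalent, and their common diagonal complement gives the condition one dimension
  higher. A complement diagonal in the outermost direction alone may destroy diagonality in an inner
  direction. Cofinality is therefore also proved inside the class \<open>Q\<close> of objects that
  are diagonal in a fixed direction. A relation in a free abelian group may pass through arbitrary
  objects of \<open>N\<close>. Its relators are compared one at a time while the complements grow;
  equality of formal sums becomes equality of multisets, so that cancellation is available.\<close>

lemma Hom_iff: "f \<in> Hom C A B \<longleftrightarrow> f \<in> Arr C \<and> Dom C f = A \<and> Cod C f = B"
  by (auto simp: Hom_def)

context category
begin

lemma Idn_simps [simp]:
  assumes "A \<in> Obj C"
  shows "Idn C A \<in> Arr C" "Dom C (Idn C A) = A" "Cod C (Idn C A) = A"
  using Idn_closed[OF assms] by (auto simp: Hom_iff)

lemma Cmp_simps [simp]: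
  assumes "f \<in> Arr C" "g \<in> Arr C" "Cod C f = Dom C g"
  shows "g \<cdot> f \<in> Arr C" "Dom C (g \<cdot> f) = Dom C f" "Cod C (g \<cdot> f) = Cod C g"
  using Cmp_closed[OF assms] by (auto simp: Hom_iff)

lemma Idn_Cmp [simp]:
  assumes "f \<in> Arr C"
  shows "Cod C f = A \<Longrightarrow> Idn C A \<cdot> f = f" "Dom C f = A \<Longrightarrow> f \<cdot> Idn C A = f"
  using Idn_left Idn_right assms by auto

declare Dom_closed [simp] Cod_closed [simp] Cmp_assoc [simp]

text \<open>Simplification associates composites to the right, so an equation for
  \<open>p \<cdot> i\<close> does not match inside a longer composite; this is its reassociated
  form.\<close>

lemma Cmp_rewrite:
  assumes "p \<cdot> i = r" "f \<in> Arr C" "i \<in> Arr C" "p \<in> Arr C" "Cod C f = Dom C i" "Cod C i = Dom C p"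
  shows "p \<cdot> (i \<cdot> f) = r \<cdot> f"
  using Cmp_assoc[OF assms(2-6)] assms(1) by simp

end

context additive_category
begin

lemma Zro_simps [simp]:
  assumes "A \<in> Obj C" "B \<in> Obj C"
  shows "Zro C A B \<in> Arr C" "Dom C (Zro C A B) = A" "Cod C (Zro C A B) = B"
proof -
  interpret comm_group "hom_group C A B" using hom_group assms by blast
  have "Zro C A B \<in> Hom C A B" using one_closed by (simp add: hom_group_def)
  then show "Zro C A B \<in> Arr C" "Dom C (Zro C A B) = A" "Cod C (Zro C A B) = B"
    by (auto simp: Hom_iff)
qed

lemma Add_simps [simp]:
  assumes "f \<in> Arr C" "g \<in> Arr C" "Dom C f = Dom C g" "Cod C f = Cod C g"
  shows "Add C f g \<in> Arr C" "Dom C (Add C f g) = Dom C g" "Cod C (Add C f g) = Cod C g"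
proof -
  interpret comm_group "hom_group C (Dom C g) (Cod C g)" using hom_group assms by simp
  have "Add C f g \<in> Hom C (Dom C g) (Cod C g)"
    using m_closed[of f g] assms by (simp add: hom_group_def Hom_iff)
  then show "Add C f g \<in> Arr C" "Dom C (Add C f g) = Dom C g" "Cod C (Add C f g) = Cod C g"
    by (auto simp: Hom_iff)
qed

lemma Add_commute:
  assumes "f \<in> Arr C" "g \<in> Arr C" "Dom C f = Dom C g" "Cod C f = Cod C g"
  shows "Add C f g = Add C g f"
proof -
  interpret comm_group "hom_group C (Dom C g) (Cod C g)" using hom_group assms by simp
  show ?thesis using m_comm[of f g] assms by (simp add: hom_group_def Hom_iff)
qed

lemma Add_assoc:
  assumes "f \<in> Arr C" "g \<in> Arr C" "h \<in> Arr C" "Dom C f = Dom C h" "Cod C f = Cod C h"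
    "Dom C g = Dom C h" "Cod C g = Cod C h"
  shows "Add C (Add C f g) h = Add C f (Add C g h)"
proof -
  interpret comm_group "hom_group C (Dom C h) (Cod C h)" using hom_group assms by simp
  show ?thesis using m_assoc[of f g h] assms by (simp add: hom_group_def Hom_iff)
qed

lemma Add_Zro [simp]:
  assumes "f \<in> Arr C" "Dom C f = A" "Cod C f = B"
  shows "Add C f (Zro C A B) = f" "Add C (Zro C A B) f = f"
proof -
  interpret comm_group "hom_group C A B" using hom_group assms by auto
  show "Add C f (Zro C A B) = f" "Add C (Zro C A B) f = f"
    using r_one[of f] l_one[of f] assms by (simp_all add: hom_group_def Hom_iff)
qed

lemma Add_cancel:
  assumes "f \<in> Arr C" "g \<in> Arr C" "h \<in> Arr C" "Dom C f = Dom C h" "Cod C f = Cod C h"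
    "Dom C g = Dom C h" "Cod C g = Cod C h" "Add C h f = Add C h g"
  shows "f = g"
proof -
  interpret comm_group "hom_group C (Dom C h) (Cod C h)" using hom_group assms by simp
  show ?thesis using Units_l_cancel[unfolded Units_eq, of h f g] assms by (simp add: hom_group_def Hom_iff)
qed

lemma Add_inverse_exists:
  assumes "f \<in> Arr C"
  shows "\<exists>g \<in> Arr C. Dom C g = Dom C f \<and> Cod C g = Cod C f \<and> Add C g f = Zro C (Dom C f) (Cod C f)"
proof -
  interpret comm_group "hom_group C (Dom C f) (Cod C f)" using hom_group assms by simp
  show ?thesis using l_inv_ex[of f] assms by (auto simp: hom_group_def Hom_iff)
qed

lemma Cmp_Add [simp]:
  assumes "f \<in> Arr C" "g \<in> Arr C" "h \<in> Arr C"
  shows "Cod C f = Dom C h \<Longrightarrow> Dom C g = Dom C h \<Longrightarrow> Cod C g = Cod C h \<Longrightarrow>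
      Add C g h \<cdot> f = Add C (g \<cdot> f) (h \<cdot> f)"
    "Dom C f = Dom C g \<Longrightarrow> Cod C f = Cod C g \<Longrightarrow> Cod C g = Dom C h \<Longrightarrow>
      h \<cdot> Add C f g = Add C (h \<cdot> f) (h \<cdot> g)"
  using Cmp_Add_left[of f "Dom C f" "Dom C h" g "Cod C h" h] Cmp_Add_right[of f "Dom C f" "Dom C h" g h "Cod C h"] assms
  by (auto simp: Hom_iff)

lemma Add_idem_Zro:
  assumes "f \<in> Arr C" "Add C f f = f"
  shows "f = Zro C (Dom C f) (Cod C f)"
  using Add_cancel[of f "Zro C (Dom C f) (Cod C f)" f] assms by simp

lemma Cmp_Zro [simp]:
  assumes "f \<in> Arr C" "A \<in> Obj C"
  shows "Dom C f = B \<Longrightarrow> f \<cdot> Zro C A B = Zro C A (Cod C f)"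
    "Cod C f = B \<Longrightarrow> Zro C B A \<cdot> f = Zro C (Dom C f) A"
proof -
  assume B: "Dom C f = B"
  have z: "Add C (Zro C A B) (Zro C A B) = Zro C A B" using assms B by auto
  have "Add C (f \<cdot> Zro C A B) (f \<cdot> Zro C A B) = f \<cdot> Zro C A B"
    using Cmp_Add(2)[of "Zro C A B" "Zro C A B" f] z assms B by auto
  then show "f \<cdot> Zro C A B = Zro C A (Cod C f)"
    using Add_idem_Zro[of "f \<cdot> Zro C A B"] assms B by auto
next
  assume B: "Cod C f = B"
  have z: "Add C (Zro C B A) (Zro C B A) = Zro C B A" using assms B by auto
  have "Add C (Zro C B A \<cdot> f) (Zro C B A \<cdot> f) = Zro C B A \<cdot> f"
    using Cmp_Add(1)[of f "Zro C B A" "Zro C B A"] z assms B by auto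
  then show "Zro C B A \<cdot> f = Zro C (Dom C f) A"
    using Add_idem_Zro[of "Zro C B A \<cdot> f"] assms B by auto
qed

text \<open>The criterion involves only endomorphisms of \<open>Z\<close>, so it can be read off in
  each degree of a complex and does not change in a full subcategory.\<close>

lemma zero_object_iff: "zero_object C Z \<longleftrightarrow> Z \<in> Obj C \<and> Idn C Z = Zro C Z Z"
proof
  assume "zero_object C Z"
  then have Z: "Z \<in> Obj C" "\<exists>!f. f \<in> Hom C Z Z" by (auto simp: zero_object_def)
  moreover have "Idn C Z \<in> Hom C Z Z" "Zro C Z Z \<in> Hom C Z Z" using Z by (auto simp: Hom_iff)
  ultimately show "Z \<in> Obj C \<and> Idn C Z = Zro C Z Z" by blast
next
  assume Z: "Z \<in> Obj C \<and> Idn C Z = Zro C Z Z"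
  have "f = Zro C Z A" if "f \<in> Hom C Z A" for f A
  proof -
    have "f \<cdot> Idn C Z = f" using that by (simp add: Hom_iff)
    then show ?thesis using that Z by (auto simp: Hom_iff)
  qed
  moreover have "f = Zro C A Z" if "f \<in> Hom C A Z" for f A
  proof -
    have "Idn C Z \<cdot> f = f" using that by (simp add: Hom_iff)
    then show ?thesis using that Z by (auto simp: Hom_iff)
  qed
  moreover have "Zro C Z A \<in> Hom C Z A" "Zro C A Z \<in> Hom C A Z" if "A \<in> Obj C" for A
    using that Z by (auto simp: Hom_iff)
  ultimately show "zero_object C Z" using Z unfolding zero_object_def by blast
qed

lemma zero_object_arr:
  assumes "zero_object C Z" "f \<in> Arr C"
  shows "Dom C f = Z \<Longrightarrow> f = Zro C Z (Cod C f)" "Cod C f = Z \<Longrightarrow> f = Zro C (Dom C f) Z"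
  using assms Idn_right[of f] Idn_left[of f] by (auto simp: zero_object_iff)

section \<open>Biproducts and isomorphisms\<close>

lemma biproductD:
  assumes "biproduct C A B S i j p q"
  shows "A \<in> Obj C" "B \<in> Obj C" "S \<in> Obj C"
    "i \<in> Arr C" "Dom C i = A" "Cod C i = S" "j \<in> Arr C" "Dom C j = B" "Cod C j = S"
    "p \<in> Arr C" "Dom C p = S" "Cod C p = A" "q \<in> Arr C" "Dom C q = S" "Cod C q = B"
    "p \<cdot> i = Idn C A" "q \<cdot> j = Idn C B" "p \<cdot> j = Zro C B A" "q \<cdot> i = Zro C A B"
    "Add C (i \<cdot> p) (j \<cdot> q) = Idn C S"
  using assms by (auto simp: biproduct_def Hom_iff)

lemma biproduct_Cmp:
  assumes "biproduct C A B S i j p q" "f \<in> Arr C"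
  shows "Cod C f = A \<Longrightarrow> p \<cdot> (i \<cdot> f) = f" "Cod C f = B \<Longrightarrow> q \<cdot> (j \<cdot> f) = f"
    "Cod C f = B \<Longrightarrow> p \<cdot> (j \<cdot> f) = Zro C (Dom C f) A" "Cod C f = A \<Longrightarrow> q \<cdot> (i \<cdot> f) = Zro C (Dom C f) B"
  using biproductD[OF assms(1)] assms(2)
  by (auto simp: Cmp_rewrite[of p i] Cmp_rewrite[of q j] Cmp_rewrite[of p j] Cmp_rewrite[of q i])

lemmas biproduct_simps = biproductD biproduct_Cmp

lemma biproduct_sum_Cmp:
  assumes "biproduct C A B S i j p q" "f \<in> Arr C"
  shows "Cod C f = S \<Longrightarrow> Add C (i \<cdot> (p \<cdot> f)) (j \<cdot> (q \<cdot> f)) = f"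
    "Dom C f = S \<Longrightarrow> Add C (f \<cdot> (i \<cdot> p)) (f \<cdot> (j \<cdot> q)) = f"
proof -
  note [simp] = biproductD[OF assms(1)]
  show "Add C (i \<cdot> (p \<cdot> f)) (j \<cdot> (q \<cdot> f)) = f" if "Cod C f = S"
    using Cmp_Add(1)[of f "i \<cdot> p" "j \<cdot> q"] assms(2) that by (simp del: Cmp_Add)
  show "Add C (f \<cdot> (i \<cdot> p)) (f \<cdot> (j \<cdot> q)) = f" if "Dom C f = S"
    using Cmp_Add(2)[of "i \<cdot> p" "j \<cdot> q" f] assms(2) that by (simp del: Cmp_Add)
qed

lemma biproduct_eqI:
  assumes "biproduct C A B S i j p q" "f \<in> Arr C" "g \<in> Arr C" "Cod C f = S" "Cod C g = S"
    "p \<cdot> f = p \<cdot> g" "q \<cdot> f = q \<cdot> g"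
  shows "f = g"
  using biproduct_sum_Cmp(1)[OF assms(1), of f] biproduct_sum_Cmp(1)[OF assms(1), of g] assms(2-7) by metis

lemma biproduct_eqI2:
  assumes "biproduct C A B S i j p q" "f \<in> Arr C" "g \<in> Arr C" "Dom C f = S" "Dom C g = S"
    "f \<cdot> i = g \<cdot> i" "f \<cdot> j = g \<cdot> j"
  shows "f = g"
proof -
  note [simp] = biproductD[OF assms(1)]
  have "f \<cdot> (i \<cdot> p) = g \<cdot> (i \<cdot> p)" "f \<cdot> (j \<cdot> q) = g \<cdot> (j \<cdot> q)"
    using Cmp_assoc[of p i f] Cmp_assoc[of p i g] Cmp_assoc[of q j f] Cmp_assoc[of q j g] assms by auto
  then show ?thesis
    using biproduct_sum_Cmp(2)[OF assms(1), of f] biproduct_sum_Cmp(2)[OF assms(1), of g] assms(2-5) by metis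
qed

lemma biproduct_commute:
  assumes "biproduct C A B S i j p q"
  shows "biproduct C B A S j i q p"
  using biproductD[OF assms] by (auto simp: biproduct_def Hom_iff Add_commute)

text \<open>Sums are determined only up to isomorphism and none is chosen, so associativity is
  relative to three given sums; the injections and projections of the fourth are forced.\<close>

lemma biproduct_assoc:
  assumes 1: "biproduct C A B X i j p q" and 2: "biproduct C X D Y i' j' p' q'"
    and 3: "biproduct C B D W k l r s"
  shows "biproduct C A W Y (i' \<cdot> i) (Add C (i' \<cdot> (j \<cdot> r)) (j' \<cdot> s)) (p \<cdot> p') (Add C (k \<cdot> (q \<cdot> p')) (l \<cdot> q'))"
proof -
  note [simp] = biproduct_simps[OF 1] biproduct_simps[OF 2] biproduct_simps[OF 3]
  have "Add C (k \<cdot> r) (l \<cdot> s) = Idn C W" "Add C (i' \<cdot> p') (j' \<cdot> q') = Idn C Y" by simp_all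
  moreover have "Add C (i' \<cdot> (i \<cdot> (p \<cdot> p'))) (i' \<cdot> (j \<cdot> (q \<cdot> p'))) = i' \<cdot> p'"
    using biproduct_sum_Cmp(1)[OF 1, of p'] Cmp_Add(2)[of "i \<cdot> (p \<cdot> p')" "j \<cdot> (q \<cdot> p')" i'] by simp
  ultimately show ?thesis
    unfolding biproduct_def Hom_iff by (simp add: Add_assoc[symmetric])
qed

lemma biproduct_iso:
  assumes 1: "biproduct C A B S i j p q" and f: "f \<in> Hom C S T" "g \<in> Hom C T S" "g \<cdot> f = Idn C S" "f \<cdot> g = Idn C T"
  shows "biproduct C A B T (f \<cdot> i) (f \<cdot> j) (p \<cdot> g) (q \<cdot> g)"
proof -
  note [simp] = biproduct_simps[OF 1]
  have [simp]: "f \<in> Arr C" "g \<in> Arr C" "Dom C f = S" "Cod C f = T" "Dom C g = T" "Cod C g = S" "T \<in> Obj C"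
    using f by (auto simp: Hom_iff)
  have [simp]: "g \<cdot> (f \<cdot> h) = h" if "h \<in> Arr C" "Cod C h = S" for h
    using that f(3) Cmp_assoc[of h f g] by simp
  have "Add C (f \<cdot> (i \<cdot> (p \<cdot> g))) (f \<cdot> (j \<cdot> (q \<cdot> g))) = f \<cdot> g"
    using biproduct_sum_Cmp(1)[OF 1, of g] Cmp_Add(2)[of "i \<cdot> (p \<cdot> g)" "j \<cdot> (q \<cdot> g)" f] by simp
  then show ?thesis unfolding biproduct_def Hom_iff using f by simp
qed

lemma biproduct_unique:
  assumes 1: "biproduct C A B S i j p q" and 2: "biproduct C A B T i' j' p' q'"
  shows "isomorphic C S T"
proof -
  note [simp] = biproduct_simps[OF 1] biproduct_simps[OF 2]
  let ?f = "Add C (i' \<cdot> p) (j' \<cdot> q)" and ?g = "Add C (i \<cdot> p') (j \<cdot> q')"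
  have "?g \<cdot> ?f = Idn C S" "?f \<cdot> ?g = Idn C T" by simp_all
  then show ?thesis
    unfolding isomorphic_def isomorphism_def by (intro bexI[of _ ?f] conjI bexI[of _ ?g]) (auto simp: Hom_iff)
qed

lemma biproduct_zero:
  assumes "A \<in> Obj C" "zero_object C Z"
  shows "biproduct C A Z A (Idn C A) (Zro C Z A) (Idn C A) (Zro C A Z)"
  using assms unfolding biproduct_def Hom_iff by (auto simp: zero_object_iff)

lemma zero_object_biproduct:
  assumes 1: "biproduct C A B S i j p q" and "zero_object C A" "zero_object C B"
  shows "zero_object C S"
proof -
  note [simp] = biproduct_simps[OF 1]
  have "i = Zro C A S" "j = Zro C B S" using zero_object_arr(1)[of A i] zero_object_arr(1)[of B j] assms by auto
  then have "Idn C S = Zro C S S" using biproductD(20)[OF 1] by simp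
  then show ?thesis by (simp add: zero_object_iff)
qed

lemma isomorphicE:
  assumes "isomorphic C A B"
  obtains f g where "f \<in> Hom C A B" "g \<in> Hom C B A" "g \<cdot> f = Idn C A" "f \<cdot> g = Idn C B"
  using assms unfolding isomorphic_def isomorphism_def Bex_def Hom_iff by metis

lemma isomorphicI:
  assumes "f \<in> Hom C A B" "g \<in> Hom C B A" "g \<cdot> f = Idn C A" "f \<cdot> g = Idn C B"
  shows "isomorphic C A B"
  using assms unfolding isomorphic_def isomorphism_def Bex_def Hom_iff by metis

lemma isomorphic_refl: "A \<in> Obj C \<Longrightarrow> isomorphic C A A"
  by (rule isomorphicI[of "Idn C A" _ _ "Idn C A"]) (auto simp: Hom_iff)

lemma isomorphic_sym: "isomorphic C A B \<Longrightarrow> isomorphic C B A"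
  by (erule isomorphicE) (rule isomorphicI)

lemma isomorphic_Obj: "isomorphic C A B \<Longrightarrow> A \<in> Obj C" "isomorphic C A B \<Longrightarrow> B \<in> Obj C"
  by (auto elim!: isomorphicE simp: Hom_iff)

lemma zero_objects_isomorphic:
  assumes "zero_object C Y" "zero_object C Z"
  shows "isomorphic C Y Z"
  using assms by (intro isomorphicI[of "Zro C Y Z" _ _ "Zro C Z Y"]) (auto simp: Hom_iff zero_object_iff)

lemma zero_object_isomorphic:
  assumes "isomorphic C Y Z" "zero_object C Y"
  shows "zero_object C Z"
proof -
  obtain f g where fg: "f \<in> Hom C Y Z" "g \<in> Hom C Z Y" "g \<cdot> f = Idn C Y" "f \<cdot> g = Idn C Z"
    using assms isomorphicE by metis
  have "g = Zro C Z Y" using zero_object_arr(2)[OF assms(2), of g] fg by (simp add: Hom_iff)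
  then show ?thesis using fg by (auto simp: Hom_iff zero_object_iff)
qed

lemma direct_sum_Obj:
  assumes "direct_sum C A B S"
  shows "A \<in> Obj C" "B \<in> Obj C" "S \<in> Obj C"
  using assms by (auto simp: direct_sum_def biproduct_def)

lemma direct_sum_commute: "direct_sum C A B S \<Longrightarrow> direct_sum C B A S"
  unfolding direct_sum_def by (meson biproduct_commute)

lemma direct_sum_assoc:
  "\<lbrakk>direct_sum C A B X; direct_sum C X D Y; direct_sum C B D W\<rbrakk> \<Longrightarrow> direct_sum C A W Y"
  unfolding direct_sum_def by (meson biproduct_assoc)

lemma direct_sum_iso: "\<lbrakk>direct_sum C A B S; isomorphic C S T\<rbrakk> \<Longrightarrow> direct_sum C A B T"
  unfolding direct_sum_def by (meson biproduct_iso isomorphicE)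

lemma direct_sum_unique: "\<lbrakk>direct_sum C A B S; direct_sum C A B T\<rbrakk> \<Longrightarrow> isomorphic C S T"
  unfolding direct_sum_def by (meson biproduct_unique)

lemma direct_sum_zero: "\<lbrakk>A \<in> Obj C; zero_object C Z\<rbrakk> \<Longrightarrow> direct_sum C A Z A"
  unfolding direct_sum_def by (meson biproduct_zero)

lemma zero_object_direct_sum:
  "\<lbrakk>direct_sum C A B S; zero_object C A; zero_object C B\<rbrakk> \<Longrightarrow> zero_object C S"
  unfolding direct_sum_def by (meson zero_object_biproduct)

text \<open>Treating an isomorphism as a sum with a zero object reduces facts about isomorphisms,
  such as transitivity, to associativity of direct sums.\<close>

lemma direct_sum_zero_iff:
  assumes "zero_object C Z" shows "direct_sum C A Z B \<longleftrightarrow> isomorphic C A B"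
  by (meson assms direct_sum_Obj(1) direct_sum_iso direct_sum_unique direct_sum_zero isomorphic_Obj(1))

end


section \<open>Direct sums of short exact sequences\<close>

text \<open>The direct sum of the arrows \<open>f\<close> and \<open>g\<close>, with respect to
  injections \<open>i\<close>, \<open>j\<close> into the target sum and projections
  \<open>p\<close>, \<open>q\<close> from the source sum.\<close>

definition block :: "('o, 'm) excat \<Rightarrow> 'm \<Rightarrow> 'm \<Rightarrow> 'm \<Rightarrow> 'm \<Rightarrow> 'm \<Rightarrow> 'm \<Rightarrow> 'm" where
  "block C i j f g p q = Add C (i \<cdot>\<^bsub>C\<^esub> (f \<cdot>\<^bsub>C\<^esub> p)) (j \<cdot>\<^bsub>C\<^esub> (g \<cdot>\<^bsub>C\<^esub> q))"

text \<open>Every axiom can be checked degree by degree, hence passes to \<open>Bq C\<close>. Of the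
  kernel property only cancellation is kept: it detects zero subobjects and the equality of two
  differentials on a subcomplex.\<close>

locale weakly_exact_category = additive_category +
  assumes Ses_arr: "(i, p) \<in> Ses C \<Longrightarrow> i \<in> Arr C \<and> p \<in> Arr C \<and> Cod C i = Dom C p"
    and Ses_Cmp: "(i, p) \<in> Ses C \<Longrightarrow> p \<cdot> i = Zro C (Dom C i) (Cod C p)"
    and Ses_monic: "\<lbrakk>(i, p) \<in> Ses C; f \<in> Arr C; g \<in> Arr C; Cod C f = Dom C i; Cod C g = Dom C i;
          i \<cdot> f = i \<cdot> g\<rbrakk> \<Longrightarrow> f = g"
    and Ses_biproduct: "biproduct C A B S i j p q \<Longrightarrow> (i, q) \<in> Ses C"
    and Ses_sum: "\<lbrakk>(i, p) \<in> Ses C; (i', p') \<in> Ses C; biproduct C (Dom C i) (Dom C i') S1 i1 j1 p1 q1;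
          biproduct C (Cod C i) (Cod C i') S2 i2 j2 p2 q2; biproduct C (Cod C p) (Cod C p') S3 i3 j3 p3 q3\<rbrakk>
        \<Longrightarrow> (block C i2 j2 i i' p1 q1, block C i3 j3 p p' p2 q2) \<in> Ses C"

context additive_category
begin

lemma block_simps [simp]:
  assumes "biproduct C A A' S i j p q" "biproduct C B B' T i' j' p' q'"
    "f \<in> Arr C" "f' \<in> Arr C" "Dom C f = A" "Cod C f = B" "Dom C f' = A'" "Cod C f' = B'"
  shows "block C i' j' f f' p q \<in> Arr C" "Dom C (block C i' j' f f' p q) = S"
    "Cod C (block C i' j' f f' p q) = T"
  using biproduct_simps[OF assms(1)] biproduct_simps[OF assms(2)] assms(3-) by (simp_all add: block_def)

lemma block_proj:
  assumes "biproduct C A A' S i j p q" "biproduct C B B' T i' j' p' q'"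
    "f \<in> Arr C" "f' \<in> Arr C" "Dom C f = A" "Cod C f = B" "Dom C f' = A'" "Cod C f' = B'"
  shows "p' \<cdot> block C i' j' f f' p q = f \<cdot> p" "q' \<cdot> block C i' j' f f' p q = f' \<cdot> q"
    "block C i' j' f f' p q \<cdot> i = i' \<cdot> f" "block C i' j' f f' p q \<cdot> j = j' \<cdot> f'"
  using biproduct_simps[OF assms(1)] biproduct_simps[OF assms(2)] assms(3-) by (simp_all add: block_def)

lemma block_Cmp:
  assumes 1: "biproduct C A A' S i j p q" and 2: "biproduct C B B' T i' j' p' q'"
    and 3: "biproduct C D D' U i'' j'' p'' q''"
    and "f \<in> Arr C" "f' \<in> Arr C" "Dom C f = A" "Cod C f = B" "Dom C f' = A'" "Cod C f' = B'"
    "g \<in> Arr C" "g' \<in> Arr C" "Dom C g = B" "Cod C g = D" "Dom C g' = B'" "Cod C g' = D'"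
  shows "block C i'' j'' g g' p' q' \<cdot> block C i' j' f f' p q = block C i'' j'' (g \<cdot> f) (g' \<cdot> f') p q"
  using biproduct_simps[OF 1] biproduct_simps[OF 2] biproduct_simps[OF 3] assms(4-)
  by (simp add: block_def)

lemma block_Zro:
  assumes "biproduct C A A' S i j p q" "biproduct C B B' T i' j' p' q'"
  shows "block C i' j' (Zro C A B) (Zro C A' B') p q = Zro C S T"
  using biproduct_simps[OF assms(1)] biproduct_simps[OF assms(2)] by (simp add: block_def)

end

context exact_category
begin

lemma Ses_simps [simp]:
  assumes "(i, p) \<in> Ses C"
  shows "i \<in> Arr C" "p \<in> Arr C" "Cod C i = Dom C p" "p \<cdot> i = Zro C (Dom C i) (Cod C p)"
  using Ses_kernel[OF assms] by (auto simp: kernel_of_def)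

lemma Ses_unique_lift:
  assumes "(i, p) \<in> Ses C" "f \<in> Arr C" "Cod C f = Dom C p" "p \<cdot> f = Zro C (Dom C f) (Cod C p)"
  shows "\<exists>!h. h \<in> Hom C (Dom C f) (Dom C i) \<and> i \<cdot> h = f"
  using Ses_kernel[OF assms(1)] assms(2-) unfolding kernel_of_def by blast

lemma Ses_mono:
  assumes "(i, p) \<in> Ses C" "f \<in> Arr C" "g \<in> Arr C" "Cod C f = Dom C i" "Cod C g = Dom C i"
    "i \<cdot> f = i \<cdot> g"
  shows "f = g"
proof -
  note [simp] = Ses_simps[OF assms(1)]
  have eq: "Dom C f = Dom C g" using Cmp_simps(2)[of f i] Cmp_simps(2)[of g i] assms by simp
  have "p \<cdot> (i \<cdot> f) = Zro C (Dom C f) (Cod C p)"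
    using Cmp_rewrite[OF Ses_simps(4)[OF assms(1)], of f] assms by simp
  then have "\<exists>!h. h \<in> Hom C (Dom C f) (Dom C i) \<and> i \<cdot> h = i \<cdot> f"
    using Ses_unique_lift[OF assms(1), of "i \<cdot> f"] assms(2-5) by simp
  moreover have "f \<in> Hom C (Dom C f) (Dom C i)" "g \<in> Hom C (Dom C f) (Dom C i)"
    using assms eq by (auto simp: Hom_iff)
  ultimately show ?thesis using assms(6) by (metis (no_types))
qed

lemma Ses_lift:
  assumes "(i, p) \<in> Ses C" "f \<in> Arr C" "Cod C f = Dom C p" "p \<cdot> f = Zro C (Dom C f) (Cod C p)"
  obtains h where "h \<in> Arr C" "Dom C h = Dom C f" "Cod C h = Dom C i" "i \<cdot> h = f"
proof -
  obtain h where "h \<in> Hom C (Dom C f) (Dom C i)" "i \<cdot> h = f"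
    using Ses_unique_lift[OF assms] by blast
  then show thesis using that unfolding Hom_iff by blast
qed

lemma isomorphismI:
  assumes "f \<in> Arr C" "g \<in> Arr C" "Dom C g = Cod C f" "Cod C g = Dom C f"
    "g \<cdot> f = Idn C (Dom C f)" "f \<cdot> g = Idn C (Cod C f)"
  shows "isomorphism C f"
  unfolding isomorphism_def by (intro conjI bexI[of _ g]) (use assms in \<open>simp_all add: Hom_iff\<close>)

lemma isomorphism_Idn: "A \<in> Obj C \<Longrightarrow> isomorphism C (Idn C A)"
  by (rule isomorphismI[of _ "Idn C A"]) auto

text \<open>The sum of \<open>p\<close> with an identity is the base change of \<open>p\<close>
  along the projection of \<open>T\<close> to \<open>Cod C p\<close>. The axiom supplies some
  pullback \<open>P\<close>, which has to be identified with \<open>S\<close>.\<close>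

lemma admissible_epi_sum_Idn:
  assumes p: "admissible_epi C p" and 1: "biproduct C (Dom C p) D S i1 j1 p1 q1"
    and 2: "biproduct C (Cod C p) D T i2 j2 p2 q2"
  shows "admissible_epi C (block C i2 j2 p (Idn C D) p1 q1)"
proof -
  note [simp] = biproduct_simps[OF 1] biproduct_simps[OF 2]
  have [simp]: "p \<in> Arr C" using p by (auto simp: admissible_epi_def)
  let ?b = "block C i2 j2 p (Idn C D) p1 q1"
  obtain p' f' where pb: "pullback C p p2 p' f'" and p': "admissible_epi C p'"
    using admissible_epi_base_change[OF p, of p2] by auto
  obtain P where P [simp]: "P \<in> Obj C" "p' \<in> Arr C" "Dom C p' = P" "Cod C p' = T"
      "f' \<in> Arr C" "Dom C f' = P" "Cod C f' = Dom C p"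
    and comm: "p \<cdot> f' = p2 \<cdot> p'"
    and univ: "\<And>a b. a \<in> Arr C \<Longrightarrow> Cod C a = Dom C p \<Longrightarrow> b \<in> Arr C \<Longrightarrow> Cod C b = T \<Longrightarrow> Dom C a = Dom C b \<Longrightarrow>
      p \<cdot> a = p2 \<cdot> b \<Longrightarrow> \<exists>!h. h \<in> Hom C (Dom C b) P \<and> f' \<cdot> h = a \<and> p' \<cdot> h = b"
  proof -
    obtain P where P: "P \<in> Obj C" "p' \<in> Hom C P T" "f' \<in> Hom C P (Dom C p)" "p \<cdot> f' = p2 \<cdot> p'"
      and u: "\<And>U a b. U \<in> Obj C \<Longrightarrow> a \<in> Hom C U (Dom C p) \<Longrightarrow> b \<in> Hom C U T \<Longrightarrow> p \<cdot> a = p2 \<cdot> b \<Longrightarrow>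
        \<exists>!h. h \<in> Hom C U P \<and> f' \<cdot> h = a \<and> p' \<cdot> h = b"
      using pb unfolding pullback_def by auto
    show thesis
    proof (rule that[of P])
      fix a b assume "a \<in> Arr C" "Cod C a = Dom C p" "b \<in> Arr C" "Cod C b = T" "Dom C a = Dom C b" "p \<cdot> a = p2 \<cdot> b"
      then show "\<exists>!h. h \<in> Hom C (Dom C b) P \<and> f' \<cdot> h = a \<and> p' \<cdot> h = b"
        by (intro u) (auto simp: Hom_iff)
    qed (use P in \<open>simp_all add: Hom_iff\<close>)
  qed
  have b [simp]: "?b \<in> Arr C" "Dom C ?b = S" "Cod C ?b = T" "p2 \<cdot> ?b = p \<cdot> p1" "q2 \<cdot> ?b = q1"
    using block_simps[OF 1 2] block_proj[OF 1 2] by simp_all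
  obtain h where h [simp]: "h \<in> Arr C" "Dom C h = S" "Cod C h = P" "f' \<cdot> h = p1" "p' \<cdot> h = ?b"
    using univ[of p1 ?b] by (auto simp: Hom_iff)
  \<comment> \<open>The inverse of the comparison arrow \<open>h\<close>: its first coordinate is
    \<open>f'\<close>, its second is read off from \<open>p'\<close> through
    \<open>q2\<close>.\<close>
  let ?g = "Add C (i1 \<cdot> f') (j1 \<cdot> (q2 \<cdot> p'))"
  have gh: "?g \<cdot> h = Idn C S" by simp
  have "f' \<cdot> (h \<cdot> ?g) = f'" by (simp add: Cmp_rewrite[OF h(4)])
  moreover have "p' \<cdot> (h \<cdot> ?g) = p'"
  proof (rule biproduct_eqI[OF 2])
    have *: "p' \<cdot> (h \<cdot> ?g) = ?b \<cdot> ?g" using Cmp_rewrite[OF h(5), of ?g] by (simp del: Cmp_Add)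
    have "p2 \<cdot> (?b \<cdot> ?g) = (p \<cdot> p1) \<cdot> ?g" using Cmp_rewrite[OF b(4), of ?g] by (simp del: Cmp_Add)
    then show "p2 \<cdot> (p' \<cdot> (h \<cdot> ?g)) = p2 \<cdot> p'" using * comm by (simp)
    have "q2 \<cdot> (?b \<cdot> ?g) = q1 \<cdot> ?g" using Cmp_rewrite[OF b(5), of ?g] by (simp del: Cmp_Add)
    then show "q2 \<cdot> (p' \<cdot> (h \<cdot> ?g)) = q2 \<cdot> p'" using * by simp
  qed simp_all
  ultimately have hg: "h \<cdot> ?g = Idn C P"
  proof -
    have "\<exists>!u. u \<in> Hom C P P \<and> f' \<cdot> u = f' \<and> p' \<cdot> u = p'"
      using univ[of f' p'] comm by simp
    moreover have "Idn C P \<in> Hom C P P" "h \<cdot> ?g \<in> Hom C P P" by (simp_all add: Hom_iff)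
    ultimately show ?thesis using \<open>f' \<cdot> (h \<cdot> ?g) = f'\<close> \<open>p' \<cdot> (h \<cdot> ?g) = p'\<close>
      by (metis (no_types, lifting) Idn_Cmp(2) P(2,3,5,6))
  qed
  obtain k where k: "(k, p') \<in> Ses C" using p' by (auto simp: admissible_epi_def)
  \<comment> \<open>Transport of \<open>(k, p')\<close> along the isomorphism \<open>?g\<close>;
    this turns \<open>p'\<close> into the block because \<open>?b \<cdot> ?g = p'\<close>.\<close>
  have "(?g \<cdot> k, ?b) \<in> Ses C"
  proof (rule Ses_isomorphic[OF k isomorphism_Idn[of "Dom C k"] _ isomorphism_Idn[of T]])
    show "isomorphism C ?g" by (rule isomorphismI[of _ h]) (use gh hg in simp_all)
    have "?b \<cdot> ?g = p' \<cdot> (h \<cdot> ?g)" using Cmp_rewrite[OF h(5), of ?g] by (simp del: Cmp_Add)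
    then show "Idn C T \<cdot> p' = ?b \<cdot> ?g" using hg by simp
  qed (use k in \<open>simp_all add: Hom_iff\<close>)
  then show ?thesis by (auto simp: admissible_epi_def)
qed

lemma block_commute:
  assumes "biproduct C A A' S i j p q" "biproduct C B B' T i' j' p' q'"
    "f \<in> Arr C" "f' \<in> Arr C" "Dom C f = A" "Cod C f = B" "Dom C f' = A'" "Cod C f' = B'"
  shows "block C i' j' f f' p q = block C j' i' f' f q p"
  using biproduct_simps[OF assms(1)] biproduct_simps[OF assms(2)] assms(3-)
  by (simp add: block_def Add_commute)

text \<open>Two kernels of the same arrow differ by an isomorphism, and \<open>Ses C\<close> is
  closed under isomorphisms of sequences.\<close>

lemma kernel_Ses:
  assumes "(k, p) \<in> Ses C" "kernel_of C p i"
  shows "(i, p) \<in> Ses C"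
proof -
  note [simp] = Ses_simps[OF assms(1)]
  have [simp]: "i \<in> Arr C" "Cod C i = Dom C p" "p \<cdot> i = Zro C (Dom C i) (Cod C p)"
    and i: "\<And>f. f \<in> Arr C \<Longrightarrow> Cod C f = Dom C p \<Longrightarrow> p \<cdot> f = Zro C (Dom C f) (Cod C p) \<Longrightarrow>
        \<exists>!h. h \<in> Hom C (Dom C f) (Dom C i) \<and> i \<cdot> h = f"
    using assms(2) by (auto simp: kernel_of_def)
  obtain a where a: "a \<in> Arr C" "Dom C a = Dom C k" "Cod C a = Dom C i" "i \<cdot> a = k"
    using i[of k] by (auto simp: Hom_iff)
  obtain b where b: "b \<in> Arr C" "Dom C b = Dom C i" "Cod C b = Dom C k" "k \<cdot> b = i"
    using Ses_lift[OF assms(1), of i] by auto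
  have 1: "b \<cdot> a = Idn C (Dom C k)"
    by (rule Ses_mono[OF assms(1)]) (use a b Cmp_rewrite[OF b(4), of a] in simp_all)
  have "i \<cdot> (a \<cdot> b) = i" using Cmp_rewrite[OF a(4), of b] a b by simp
  then have 2: "a \<cdot> b = Idn C (Dom C i)"
  proof -
    have "\<exists>!h. h \<in> Hom C (Dom C i) (Dom C i) \<and> i \<cdot> h = i" using i[of i] by simp
    moreover have "Idn C (Dom C i) \<in> Hom C (Dom C i) (Dom C i)" "a \<cdot> b \<in> Hom C (Dom C i) (Dom C i)"
      using a b by (simp_all add: Hom_iff)
    moreover have "i \<cdot> Idn C (Dom C i) = i" by simp
    ultimately show ?thesis using \<open>i \<cdot> (a \<cdot> b) = i\<close> by blast
  qed
  have "isomorphism C a" by (rule isomorphismI[of _ b]) (use a b 1 2 in simp_all)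
  then show ?thesis
    by (rule Ses_isomorphic[OF assms(1) _ isomorphism_Idn[of "Dom C p"] isomorphism_Idn[of "Cod C p"]])
      (use a in \<open>simp_all add: Hom_iff\<close>)
qed

text \<open>The sum of two admissible epimorphisms factors as \<open>p\<close> plus an identity
  followed by an identity plus \<open>p'\<close>, so it is admissible as a composite. The sum of
  \<open>i\<close> and \<open>i'\<close> is its kernel, since lifts can be found in each
  coordinate.\<close>

lemma Ses_block:
  assumes s: "(i, p) \<in> Ses C" and s': "(i', p') \<in> Ses C"
    and 1: "biproduct C (Dom C i) (Dom C i') S1 i1 j1 p1 q1"
    and 2: "biproduct C (Cod C i) (Cod C i') S2 i2 j2 p2 q2"
    and 3: "biproduct C (Cod C p) (Cod C p') S3 i3 j3 p3 q3"
  shows "(block C i2 j2 i i' p1 q1, block C i3 j3 p p' p2 q2) \<in> Ses C"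
proof -
  note [simp] = Ses_simps[OF s] Ses_simps[OF s'] biproduct_simps[OF 1] biproduct_simps[OF 2] biproduct_simps[OF 3]
  note two = 2[unfolded Ses_simps[OF s] Ses_simps[OF s']]
  obtain X i4 j4 p4 q4 where 4: "biproduct C (Cod C p) (Dom C p') X i4 j4 p4 q4"
    using direct_sum_exists[of "Cod C p" "Dom C p'"] by (auto simp: direct_sum_def)
  note [simp] = biproduct_simps[OF 4]
  let ?P = "block C i3 j3 p p' p2 q2" and ?I = "block C i2 j2 i i' p1 q1"
  let ?P1 = "block C i4 j4 p (Idn C (Dom C p')) p2 q2" and ?P2 = "block C i3 j3 (Idn C (Cod C p)) p' p4 q4"
  have e1: "admissible_epi C ?P1"
    by (rule admissible_epi_sum_Idn[OF _ _ 4]) (use 2 s in \<open>auto simp: admissible_epi_def\<close>)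
  have "admissible_epi C (block C j3 i3 p' (Idn C (Cod C p)) q4 p4)"
    by (rule admissible_epi_sum_Idn[OF _ biproduct_commute[OF 4] biproduct_commute[OF 3]])
      (use s' in \<open>auto simp: admissible_epi_def\<close>)
  then have e2: "admissible_epi C ?P2" using block_commute[OF 4 3] by simp
  have "?P2 \<cdot> ?P1 = ?P" using block_Cmp[OF two 4 3] by simp
  then have "admissible_epi C ?P"
    using admissible_epi_Cmp[OF e1 e2] block_simps[OF two 4] block_simps[OF 4 3] by simp
  then obtain k where k: "(k, ?P) \<in> Ses C" by (auto simp: admissible_epi_def)
  have I [simp]: "?I \<in> Arr C" "Dom C ?I = S1" "Cod C ?I = S2" using block_simps[OF 1 two] by simp_all
  have P [simp]: "?P \<in> Arr C" "Dom C ?P = S2" "Cod C ?P = S3" using block_simps[OF two 3] by simp_all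
  have "kernel_of C ?P ?I"
    unfolding kernel_of_def
  proof (intro conjI ballI impI)
    show "?P \<cdot> ?I = Zro C (Dom C ?I) (Cod C ?P)"
      using block_Cmp[OF 1 two 3] block_Zro[OF 1 3] by simp
  next
    fix f assume f [simp]: "f \<in> Arr C" "Cod C f = Dom C ?P" and z: "?P \<cdot> f = Zro C (Dom C f) (Cod C ?P)"
    have "p3 \<cdot> (?P \<cdot> f) = p \<cdot> (p2 \<cdot> f)"
      using Cmp_rewrite[OF block_proj(1)[OF two 3, of p p'], of f] by simp
    then obtain u where u [simp]: "u \<in> Arr C" "Dom C u = Dom C f" "Cod C u = Dom C i" "i \<cdot> u = p2 \<cdot> f"
      using Ses_lift[OF s, of "p2 \<cdot> f"] z by auto
    have "q3 \<cdot> (?P \<cdot> f) = p' \<cdot> (q2 \<cdot> f)"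
      using Cmp_rewrite[OF block_proj(2)[OF two 3, of p p'], of f] by simp
    then obtain v where v [simp]: "v \<in> Arr C" "Dom C v = Dom C f" "Cod C v = Dom C i'" "i' \<cdot> v = q2 \<cdot> f"
      using Ses_lift[OF s', of "q2 \<cdot> f"] z by auto
    have pI: "p2 \<cdot> (?I \<cdot> h) = i \<cdot> (p1 \<cdot> h)" "q2 \<cdot> (?I \<cdot> h) = i' \<cdot> (q1 \<cdot> h)" if "h \<in> Arr C" "Cod C h = S1" for h
      using Cmp_rewrite[OF block_proj(1)[OF 1 two, of i i'], of h] Cmp_rewrite[OF block_proj(2)[OF 1 two, of i i'], of h] that
      by simp_all
    show "\<exists>!h. h \<in> Hom C (Dom C f) (Dom C ?I) \<and> ?I \<cdot> h = f"
    proof (rule ex1I)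
      have "?I \<cdot> Add C (i1 \<cdot> u) (j1 \<cdot> v) = f"
        by (rule biproduct_eqI[OF two]) (use pI[of "Add C (i1 \<cdot> u) (j1 \<cdot> v)"] in \<open>simp_all del: Cmp_Add(2)\<close>, simp_all)
      then show "Add C (i1 \<cdot> u) (j1 \<cdot> v) \<in> Hom C (Dom C f) (Dom C ?I) \<and> ?I \<cdot> Add C (i1 \<cdot> u) (j1 \<cdot> v) = f"
        by (simp add: Hom_iff)
    next
      fix h assume h: "h \<in> Hom C (Dom C f) (Dom C ?I) \<and> ?I \<cdot> h = f"
      then have h' [simp]: "h \<in> Arr C" "Dom C h = Dom C f" "Cod C h = S1" by (auto simp: Hom_iff)
      have "p1 \<cdot> h = u" by (rule Ses_mono[OF s]) (use pI(1)[of h] h in simp_all)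
      moreover have "q1 \<cdot> h = v" by (rule Ses_mono[OF s']) (use pI(2)[of h] h in simp_all)
      ultimately show "h = Add C (i1 \<cdot> u) (j1 \<cdot> v)"
        using biproduct_sum_Cmp(1)[OF 1, of h] by simp
    qed
  qed simp_all
  then show ?thesis by (rule kernel_Ses[OF k])
qed

lemma weakly_exact: "weakly_exact_category C"
proof
  show "(i, p) \<in> Ses C \<Longrightarrow> i \<in> Arr C \<and> p \<in> Arr C \<and> Cod C i = Dom C p" for i p by simp
  show "(i, p) \<in> Ses C \<Longrightarrow> p \<cdot> i = Zro C (Dom C i) (Cod C p)" for i p by simp
qed (fact Ses_mono Ses_split Ses_block)+

end

section \<open>The category in dimension zero\<close>

lemma base_category_simps [simp]:
  "Obj (base_category N) = Base ` Obj N" "Arr (base_category N) = BaseArr ` Arr N"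
  "Dom (base_category N) (BaseArr f) = Base (Dom N f)" "Cod (base_category N) (BaseArr f) = Base (Cod N f)"
  "Idn (base_category N) (Base A) = BaseArr (Idn N A)"
  "BaseArr g \<cdot>\<^bsub>base_category N\<^esub> BaseArr f = BaseArr (g \<cdot>\<^bsub>N\<^esub> f)"
  "Add (base_category N) (BaseArr f) (BaseArr g) = BaseArr (Add N f g)"
  "Zro (base_category N) (Base A) (Base B) = BaseArr (Zro N A B)"
  "(BaseArr i, BaseArr p) \<in> Ses (base_category N) \<longleftrightarrow> (i, p) \<in> Ses N"
  by (auto simp: base_category_def)

lemma base_Hom [simp]: "BaseArr f \<in> Hom (base_category N) (Base A) (Base B) \<longleftrightarrow> f \<in> Hom N A B"
  by (auto simp: Hom_iff)

lemma base_HomE: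
  assumes "f \<in> Hom (base_category N) A B"
  obtains f' A' B' where "f = BaseArr f'" "A = Base A'" "B = Base B'" "f' \<in> Hom N A' B'"
  using assms by (auto simp: Hom_iff)

lemma base_SesE:
  assumes "(i, p) \<in> Ses (base_category N)"
  obtains i' p' where "i = BaseArr i'" "p = BaseArr p'" "(i', p') \<in> Ses N"
  using assms by (auto simp: base_category_def)

lemma base_biproduct [simp]:
  "biproduct (base_category N) (Base A) (Base B) (Base S) (BaseArr i) (BaseArr j) (BaseArr p) (BaseArr q)
    \<longleftrightarrow> biproduct N A B S i j p q"
  by (auto simp: biproduct_def)

lemma base_biproductE:
  assumes "biproduct (base_category N) A B S i j p q"
  obtains A' B' S' i' j' p' q' where "A = Base A'" "B = Base B'" "S = Base S'" "i = BaseArr i'" "j = BaseArr j'"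
    "p = BaseArr p'" "q = BaseArr q'" "biproduct N A' B' S' i' j' p' q'"
proof -
  have "A \<in> Base ` Obj N" "B \<in> Base ` Obj N" "S \<in> Base ` Obj N" "i \<in> BaseArr ` Arr N" "j \<in> BaseArr ` Arr N"
    "p \<in> BaseArr ` Arr N" "q \<in> BaseArr ` Arr N"
    using assms by (auto simp: biproduct_def Hom_iff)
  then show thesis using that assms by (auto simp: image_iff)
qed

lemma base_block [simp]:
  "block (base_category N) (BaseArr i) (BaseArr j) (BaseArr f) (BaseArr g) (BaseArr p) (BaseArr q)
    = BaseArr (block N i j f g p q)"
  by (simp add: block_def)

lemma base_zero_object: "zero_object (base_category N) (Base Z) \<longleftrightarrow> zero_object N Z"
proof -
  have "(\<exists>!f. f \<in> Hom (base_category N) (Base A) (Base B)) \<longleftrightarrow> (\<exists>!f. f \<in> Hom N A B)" for A B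
  proof -
    have "Hom (base_category N) (Base A) (Base B) = BaseArr ` Hom N A B"
      by (auto elim!: base_HomE)
    then show ?thesis by auto
  qed
  then show ?thesis by (auto simp: zero_object_def)
qed

lemma comm_group_hom_group_base:
  assumes "comm_group (hom_group N A B)"
  shows "comm_group (hom_group (base_category N) (Base A) (Base B))"
proof -
  interpret comm_group "hom_group N A B" by fact
  note * = m_closed m_assoc m_comm one_closed l_one l_inv_ex
  note ** = *[unfolded hom_group_def, simplified]
  show ?thesis
  proof (rule comm_groupI)
    fix x assume "x \<in> carrier (hom_group (base_category N) (Base A) (Base B))"
    then obtain f where f: "x = BaseArr f" "f \<in> Hom N A B" by (auto simp: hom_group_def elim!: base_HomE)
    obtain g where "g \<in> Hom N A B" "Add N g f = Zro N A B" using **(6)[OF f(2)] by blast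
    then show "\<exists>y \<in> carrier (hom_group (base_category N) (Base A) (Base B)).
        y \<otimes>\<^bsub>hom_group (base_category N) (Base A) (Base B)\<^esub> x = \<one>\<^bsub>hom_group (base_category N) (Base A) (Base B)\<^esub>"
      using f by (intro bexI[of _ "BaseArr g"]) (auto simp: hom_group_def)
  qed (use **(1-5) in \<open>auto simp: hom_group_def elim!: base_HomE\<close>)
qed

lemma (in weakly_exact_category) weakly_exact_base: "weakly_exact_category (base_category C)"
proof (intro weakly_exact_category.intro weakly_exact_category_axioms.intro
    additive_category.intro additive_category_axioms.intro category.intro)
  show "comm_group (hom_group (base_category C) A B)"
    if "A \<in> Obj (base_category C)" "B \<in> Obj (base_category C)" for A B
    using that by (auto intro: comm_group_hom_group_base hom_group)
  obtain Z where "zero_object C Z" using zero_object_exists by blast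
  then show "\<exists>Z. zero_object (base_category C) Z" by (metis base_zero_object)
  show "\<exists>S. direct_sum (base_category C) A B S"
    if AB: "A \<in> Obj (base_category C)" "B \<in> Obj (base_category C)" for A B
  proof -
    obtain A' B' where "A = Base A'" "B = Base B'" "A' \<in> Obj C" "B' \<in> Obj C" using AB by auto
    moreover obtain S i j p q where "biproduct C A' B' S i j p q"
      using direct_sum_exists[of A' B'] calculation by (auto simp: direct_sum_def)
    ultimately have "biproduct (base_category C) A B (Base S) (BaseArr i) (BaseArr j) (BaseArr p) (BaseArr q)" by simp
    then show ?thesis unfolding direct_sum_def by blast
  qed
  show "(i, q) \<in> Ses (base_category C)" if "biproduct (base_category C) A B S i j p q" for A B S i j p q
    using that by (auto elim!: base_biproductE intro: Ses_biproduct)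
  show "(block (base_category C) i2 j2 i i' p1 q1, block (base_category C) i3 j3 p p' p2 q2) \<in> Ses (base_category C)"
    if s: "(i, p) \<in> Ses (base_category C)" "(i', p') \<in> Ses (base_category C)"
      and b: "biproduct (base_category C) (Dom (base_category C) i) (Dom (base_category C) i') S1 i1 j1 p1 q1"
          "biproduct (base_category C) (Cod (base_category C) i) (Cod (base_category C) i') S2 i2 j2 p2 q2"
          "biproduct (base_category C) (Cod (base_category C) p) (Cod (base_category C) p') S3 i3 j3 p3 q3"
    for i p i' p' S1 i1 j1 p1 q1 S2 i2 j2 p2 q2 S3 i3 j3 p3 q3
  proof -
    obtain a b where ab: "i = BaseArr a" "p = BaseArr b" "(a, b) \<in> Ses C" using s(1) by (rule base_SesE)
    obtain a' b' where ab': "i' = BaseArr a'" "p' = BaseArr b'" "(a', b') \<in> Ses C" using s(2) by (rule base_SesE)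
    show ?thesis using b unfolding ab ab'
      by (auto elim!: base_biproductE intro!: Ses_sum ab(3) ab'(3))
  qed
  show "i \<in> Arr (base_category C) \<and> p \<in> Arr (base_category C) \<and> Cod (base_category C) i = Dom (base_category C) p"
    if "(i, p) \<in> Ses (base_category C)" for i p
    using that by (auto elim!: base_SesE dest: Ses_arr)
  show "p \<cdot>\<^bsub>base_category C\<^esub> i = Zro (base_category C) (Dom (base_category C) i) (Cod (base_category C) p)"
    if "(i, p) \<in> Ses (base_category C)" for i p
    using that by (auto elim!: base_SesE dest: Ses_Cmp)
  show "f = g"
    if "(i, p) \<in> Ses (base_category C)" "f \<in> Arr (base_category C)" "g \<in> Arr (base_category C)"
      "Cod (base_category C) f = Dom (base_category C) i" "Cod (base_category C) g = Dom (base_category C) i"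
      "i \<cdot>\<^bsub>base_category C\<^esub> f = i \<cdot>\<^bsub>base_category C\<^esub> g" for i p f g
    using that by (auto elim!: base_SesE dest: Ses_monic)
qed (auto elim!: base_HomE simp: Hom_iff)

text \<open>Keeps the cycle objects \<open>Z\<close> visible, which \<open>acyclic_complex\<close>
  hides in an existential; they have to be compared and complemented later. Boundedness is separate
  because it concerns the entries alone.\<close>

definition acyclic_with where
  "acyclic_with C X d Z m e \<longleftrightarrow> (\<forall>k. m k \<in> Hom C (Z k) (X k)) \<and> (\<forall>k. e k \<in> Hom C (X k) (Z (k - 1))) \<and>
     (\<forall>k. d k = m (k - 1) \<cdot>\<^bsub>C\<^esub> e k) \<and> (\<forall>k::int. (m k, e k) \<in> Ses C)"

definition bounded_family :: "('o, 'm) excat \<Rightarrow> (int \<Rightarrow> 'o) \<Rightarrow> bool" where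
  "bounded_family C X \<longleftrightarrow> (\<forall>k. X k \<in> Obj C) \<and> (\<exists>b. \<forall>k. \<bar>k\<bar> > b \<longrightarrow> zero_object C (X k))"

lemma acyclic_withD:
  assumes "acyclic_with C X d Z m e"
  shows "m k \<in> Arr C" "Dom C (m k) = Z k" "Cod C (m k) = X k"
    "e k \<in> Arr C" "Dom C (e k) = X k" "Cod C (e k) = Z (k - 1)"
    "d k = m (k - 1) \<cdot>\<^bsub>C\<^esub> e k" "(m k, e k) \<in> Ses C"
  using assms by (auto simp: acyclic_with_def Hom_iff)

context weakly_exact_category
begin

text \<open>Two successive differentials compose to \<open>m \<cdot> e \<cdot> m \<cdot> e\<close>,
  and the inner \<open>e (k - 1) \<cdot> m (k - 1)\<close> vanishes as the composite of a short
  exact sequence.\<close>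

lemma acyclic_complex_iff:
  "acyclic_complex C X d \<longleftrightarrow> bounded_family C X \<and> (\<exists>Z m e. acyclic_with C X d Z m e)"
proof
  assume "acyclic_complex C X d"
  then show "bounded_family C X \<and> (\<exists>Z m e. acyclic_with C X d Z m e)"
    unfolding acyclic_complex_def bounded_complex_def acyclic_with_def bounded_family_def by blast
next
  assume *: "bounded_family C X \<and> (\<exists>Z m e. acyclic_with C X d Z m e)"
  then obtain Z m e where a: "acyclic_with C X d Z m e" by blast
  note [simp] = acyclic_withD[OF a]
  have "d k \<in> Hom C (X k) (X (k - 1))" for k by (simp add: Hom_iff)
  moreover have "d (k - 1) \<cdot> d k = Zro C (X k) (X (k - 2))" for k
  proof -
    have "Cod C (m (k - 1)) = Dom C (e (k - 1))" "Z (k - 1 - 1) = Z (k - 2)" "X (k - 1 - 1) = X (k - 2)"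
      by simp_all
    moreover have "X k \<in> Obj C" for k using Cod_closed[of "m k"] by simp
    moreover have "Z k \<in> Obj C" for k using Dom_closed[of "m k"] by simp
    ultimately show ?thesis
      using Ses_Cmp[of "m (k - 1)" "e (k - 1)"]
      by (simp add: Cmp_rewrite[of "e (k - 1)" "m (k - 1)"])
  qed
  ultimately show "acyclic_complex C X d"
    using * unfolding acyclic_complex_def bounded_complex_def bounded_family_def acyclic_with_def by blast
qed

text \<open>The cycles of the sum may be any sums \<open>W k\<close> of the given cycles. Choosing
  them in a subcategory later makes the sum acyclic there.\<close>

lemma acyclic_with_sum:
  assumes 1: "acyclic_with C X d Z m e" and 2: "acyclic_with C X' d' Z' m' e'"
    and b: "\<And>k. biproduct C (X k) (X' k) (E k) (i k) (j k) (p k) (q k)"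
    and c: "\<And>k. biproduct C (Z k) (Z' k) (W k) (a k) (b k) (r k) (s k)"
  shows "acyclic_with C E (\<lambda>k. block C (i (k - 1)) (j (k - 1)) (d k) (d' k) (p k) (q k)) W
    (\<lambda>k. block C (i k) (j k) (m k) (m' k) (r k) (s k))
    (\<lambda>k. block C (a (k - 1)) (b (k - 1)) (e k) (e' k) (p k) (q k))"
  unfolding acyclic_with_def
proof (intro conjI allI)
  note [simp] = acyclic_withD[OF 1] acyclic_withD[OF 2]
  fix k
  show "block C (i k) (j k) (m k) (m' k) (r k) (s k) \<in> Hom C (W k) (E k)"
    using block_simps[OF c b, of "m k" "m' k" k k] by (simp add: Hom_iff)
  show "block C (a (k - 1)) (b (k - 1)) (e k) (e' k) (p k) (q k) \<in> Hom C (E k) (W (k - 1))"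
    using block_simps[OF b c, of "e k" "e' k" k "k - 1"] by (simp add: Hom_iff)
  show "block C (i (k - 1)) (j (k - 1)) (d k) (d' k) (p k) (q k) =
      block C (i (k - 1)) (j (k - 1)) (m (k - 1)) (m' (k - 1)) (r (k - 1)) (s (k - 1)) \<cdot>
      block C (a (k - 1)) (b (k - 1)) (e k) (e' k) (p k) (q k)"
    using block_Cmp[OF b[of k] c[of "k - 1"] b[of "k - 1"], of "e k" "e' k" "m (k - 1)" "m' (k - 1)"] by simp
  show "(block C (i k) (j k) (m k) (m' k) (r k) (s k), block C (a (k - 1)) (b (k - 1)) (e k) (e' k) (p k) (q k)) \<in> Ses C"
    by (rule Ses_sum[of "m k" "e k" "m' k" "e' k", OF _ _ _ _ c[of "k - 1", folded acyclic_withD(6)[OF 1] acyclic_withD(6)[OF 2]]])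
      (use b c in simp_all)
qed

lemma bounded_family_sum:
  assumes "bounded_family C X" "bounded_family C X'" "\<And>k. biproduct C (X k) (X' k) (E k) (i k) (j k) (p k) (q k)"
  shows "bounded_family C E"
proof -
  obtain b b' where "\<And>k. \<bar>k\<bar> > b \<Longrightarrow> zero_object C (X k)" "\<And>k. \<bar>k\<bar> > b' \<Longrightarrow> zero_object C (X' k)"
    using assms(1,2) unfolding bounded_family_def by blast
  then have "zero_object C (E k)" if "\<bar>k\<bar> > max b b'" for k
    using that zero_object_biproduct[OF assms(3)] by auto
  then show ?thesis unfolding bounded_family_def using biproductD(3)[OF assms(3)] by blast
qed

end


section \<open>Categories of acyclic binary complexes\<close>

lemma Bq_simps [simp]:
  "Obj (Bq C) = Bq_obj C" "Arr (Bq C) = Bq_arr C" "Dom (Bq C) = source" "Cod (Bq C) = target"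
  "Idn (Bq C) X = CpxArr X X (\<lambda>k. Idn C (graded X k))"
  "g \<cdot>\<^bsub>Bq C\<^esub> f = CpxArr (source f) (target g) (\<lambda>k. component g k \<cdot>\<^bsub>C\<^esub> component f k)"
  "Add (Bq C) f g = CpxArr (source f) (target f) (\<lambda>k. Add C (component f k) (component g k))"
  "Zro (Bq C) X Y = CpxArr X Y (\<lambda>k. Zro C (graded X k) (graded Y k))"
  by (simp_all add: Bq_def)

lemma Bq_Hom_iff: "f \<in> Hom (Bq C) X Y \<longleftrightarrow> f \<in> Bq_arr C \<and> source f = X \<and> target f = Y"
  by (simp add: Hom_iff)

lemma Bq_Ses_iff:
  "(i, p) \<in> Ses (Bq C) \<longleftrightarrow> i \<in> Bq_arr C \<and> p \<in> Bq_arr C \<and> target i = source p \<and>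
     (\<forall>k. (component i k, component p k) \<in> Ses C)"
  by (simp add: Bq_def)

lemma Bq_arr_iff:
  "f \<in> Bq_arr C \<longleftrightarrow> (\<exists>\<phi>. f = CpxArr (source f) (target f) \<phi>) \<and> source f \<in> Bq_obj C \<and> target f \<in> Bq_obj C \<and>
     (\<forall>k. component f k \<in> Hom C (graded (source f) k) (graded (target f) k)) \<and>
     (\<forall>k. component f (k - 1) \<cdot>\<^bsub>C\<^esub> diff1 (source f) k = diff1 (target f) k \<cdot>\<^bsub>C\<^esub> component f k) \<and>
     (\<forall>k. component f (k - 1) \<cdot>\<^bsub>C\<^esub> diff2 (source f) k = diff2 (target f) k \<cdot>\<^bsub>C\<^esub> component f k)"
  by (cases f) (auto simp: Bq_arr_def)

lemma Bq_arrD: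
  assumes "f \<in> Bq_arr C"
  shows "CpxArr (source f) (target f) (component f) = f" "source f \<in> Bq_obj C" "target f \<in> Bq_obj C"
    "component f k \<in> Arr C" "Dom C (component f k) = graded (source f) k" "Cod C (component f k) = graded (target f) k"
    "component f (k - 1) \<cdot>\<^bsub>C\<^esub> diff1 (source f) k = diff1 (target f) k \<cdot>\<^bsub>C\<^esub> component f k"
    "component f (k - 1) \<cdot>\<^bsub>C\<^esub> diff2 (source f) k = diff2 (target f) k \<cdot>\<^bsub>C\<^esub> component f k"
  using assms unfolding Bq_arr_iff by (cases f; auto simp: Hom_iff)+

lemma Bq_arr_eqI:
  assumes "f \<in> Bq_arr C" "g \<in> Bq_arr C" "source f = source g" "target f = target g"
    "\<And>k. component f k = component g k"
  shows "f = g"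
proof -
  have "component f = component g" using assms(5) by (rule ext)
  then show ?thesis using Bq_arrD(1)[OF assms(1)] Bq_arrD(1)[OF assms(2)] assms(3,4) by metis
qed

lemma Bq_objE:
  assumes "X \<in> Bq_obj C"
  obtains "X = Cpx (graded X) (diff1 X) (diff2 X)" "acyclic_complex C (graded X) (diff1 X)" "acyclic_complex C (graded X) (diff2 X)"
  using assms by (auto simp: Bq_obj_def)

lemma Cpx_Bq_obj: "Cpx X d d' \<in> Bq_obj C \<longleftrightarrow> acyclic_complex C X d \<and> acyclic_complex C X d'"
  by (auto simp: Bq_obj_def)

lemma Bq_objD:
  assumes "X \<in> Bq_obj C"
  shows "graded X k \<in> Obj C" "diff1 X k \<in> Arr C" "diff2 X k \<in> Arr C"
    "Dom C (diff1 X k) = graded X k" "Cod C (diff1 X k) = graded X (k - 1)"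
    "Dom C (diff2 X k) = graded X k" "Cod C (diff2 X k) = graded X (k - 1)" "bounded_family C (graded X)"
  using assms by (auto elim!: Bq_objE simp: acyclic_complex_def bounded_complex_def Hom_iff bounded_family_def)

text \<open>With this choice of types \<open>Bq\<close> can be applied to its own result, so weak
  exactness can serve as an induction invariant.\<close>

locale weakly_exact_multicomplexes = weakly_exact_category C
  for C :: "(('o, 'm) mobj, ('o, 'm) marr) excat" (structure)
begin

lemma Bq_arr_Cmp:
  assumes "f \<in> Bq_arr C" "g \<in> Bq_arr C" "target f = source g"
  shows "CpxArr (source f) (target g) (\<lambda>k. component g k \<cdot> component f k) \<in> Bq_arr C"
proof -
  note f [simp] = Bq_arrD[OF assms(1)] and g [simp] = Bq_arrD[OF assms(2)]
  note [simp] = Bq_objD[OF f(2)] Bq_objD[OF f(3)] Bq_objD[OF g(2)] Bq_objD[OF g(3)]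
  have "component g (k - 1) \<cdot> (component f (k - 1) \<cdot> diff1 (source f) k) = diff1 (target g) k \<cdot> (component g k \<cdot> component f k)"
    "component g (k - 1) \<cdot> (component f (k - 1) \<cdot> diff2 (source f) k) = diff2 (target g) k \<cdot> (component g k \<cdot> component f k)" for k
    using Cmp_rewrite[OF g(7), of "component f k" k] Cmp_rewrite[OF g(8), of "component f k" k] assms(3) by simp_all
  then show ?thesis using assms(3) by (auto simp: Bq_arr_iff Hom_iff)
qed

lemma Bq_arr_Add:
  assumes "f \<in> Bq_arr C" "g \<in> Bq_arr C" "source f = source g" "target f = target g"
  shows "CpxArr (source f) (target f) (\<lambda>k. Add C (component f k) (component g k)) \<in> Bq_arr C"
proof -
  note f [simp] = Bq_arrD[OF assms(1)] and g [simp] = Bq_arrD[OF assms(2)]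
  note [simp] = Bq_objD[OF f(2)] Bq_objD[OF f(3)] Bq_objD[OF g(2)] Bq_objD[OF g(3)]
  show ?thesis using f(7,8) assms(3,4) by (auto simp: Bq_arr_iff Hom_iff)
qed

lemma Bq_arr_Zro:
  assumes "X \<in> Bq_obj C" "Y \<in> Bq_obj C"
  shows "CpxArr X Y (\<lambda>k. Zro C (graded X k) (graded Y k)) \<in> Bq_arr C"
  using Bq_objD[OF assms(1)] Bq_objD[OF assms(2)] assms by (auto simp: Bq_arr_iff Hom_iff)

lemma Bq_arr_Idn:
  assumes "X \<in> Bq_obj C"
  shows "CpxArr X X (\<lambda>k. Idn C (graded X k)) \<in> Bq_arr C"
  using Bq_objD[OF assms(1)] assms by (auto simp: Bq_arr_iff Hom_iff)

lemma Bq_arr_inverse: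
  assumes "f \<in> Bq_arr C"
  obtains g where "g \<in> Bq_arr C" "source g = source f" "target g = target f"
    "\<And>k. Add C (component g k) (component f k) = Zro C (graded (source f) k) (graded (target f) k)"
proof -
  note f [simp] = Bq_arrD[OF assms(1)]
  note [simp] = Bq_objD[OF f(2)] Bq_objD[OF f(3)]
  have "\<exists>h. \<forall>k. h k \<in> Arr C \<and> Dom C (h k) = graded (source f) k \<and> Cod C (h k) = graded (target f) k \<and>
      Add C (h k) (component f k) = Zro C (graded (source f) k) (graded (target f) k)"
    using Add_inverse_exists[of "component f k" for k] by (intro choice) auto
  then obtain h where h [simp]: "\<And>k. h k \<in> Arr C" "\<And>k. Dom C (h k) = graded (source f) k"
      "\<And>k. Cod C (h k) = graded (target f) k"
    and inv: "\<And>k. Add C (h k) (component f k) = Zro C (graded (source f) k) (graded (target f) k)"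
    by metis
  \<comment> \<open>Termwise negatives commute with the differentials by cancellation: adding
    \<open>component f (k - 1) \<cdot> d\<close> to either side gives zero.\<close>
  have *: "h (k - 1) \<cdot> d = d' \<cdot> h k"
    if [simp]: "d \<in> Arr C" "d' \<in> Arr C" "Dom C d = graded (source f) k" "Cod C d = graded (source f) (k - 1)"
      "Dom C d' = graded (target f) k" "Cod C d' = graded (target f) (k - 1)"
      and eq: "component f (k - 1) \<cdot> d = d' \<cdot> component f k" for k d d'
  proof (rule Add_cancel[of _ _ "component f (k - 1) \<cdot> d"])
    have "Add C (component f (k - 1) \<cdot> d) (h (k - 1) \<cdot> d) = Add C (h (k - 1)) (component f (k - 1)) \<cdot> d"
      by (simp add: Add_commute)
    also have "\<dots> = d' \<cdot> Add C (h k) (component f k)" by (simp add: inv del: Cmp_Add)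
    also have "\<dots> = Add C (component f (k - 1) \<cdot> d) (d' \<cdot> h k)" by (simp add: Add_commute eq)
    finally show "Add C (component f (k - 1) \<cdot> d) (h (k - 1) \<cdot> d) = Add C (component f (k - 1) \<cdot> d) (d' \<cdot> h k)" .
  qed simp_all
  show thesis
  proof (rule that[of "CpxArr (source f) (target f) h"])
    show "CpxArr (source f) (target f) h \<in> Bq_arr C"
      by (auto simp: Bq_arr_iff Hom_iff intro!: *)
  qed (simp_all add: inv)
qed

lemma Bq_sum_obj:
  assumes X: "X \<in> Bq_obj C" and Y: "Y \<in> Bq_obj C"
    and b: "\<And>k. biproduct C (graded X k) (graded Y k) (E k) (i k) (j k) (p k) (q k)"
  defines "S \<equiv> Cpx E (\<lambda>k. block C (i (k - 1)) (j (k - 1)) (diff1 X k) (diff1 Y k) (p k) (q k))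
      (\<lambda>k. block C (i (k - 1)) (j (k - 1)) (diff2 X k) (diff2 Y k) (p k) (q k))"
  shows "S \<in> Bq_obj C"
proof -
  have *: "acyclic_complex C E (\<lambda>k. block C (i (k - 1)) (j (k - 1)) (d k) (d' k) (p k) (q k))"
    if d: "acyclic_complex C (graded X) d" and d': "acyclic_complex C (graded Y) d'" for d d'
  proof -
    obtain Z m e where 1: "acyclic_with C (graded X) d Z m e" using d by (auto simp: acyclic_complex_iff)
    obtain Z' m' e' where 2: "acyclic_with C (graded Y) d' Z' m' e'" using d' by (auto simp: acyclic_complex_iff)
    have "Z k \<in> Obj C" "Z' k \<in> Obj C" for k
      using acyclic_withD(1,2)[OF 1, of k] acyclic_withD(1,2)[OF 2, of k] Dom_closed by metis+
    then have "\<forall>k. \<exists>W i j p q. biproduct C (Z k) (Z' k) W i j p q"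
      using direct_sum_exists by (simp add: direct_sum_def)
    then obtain W a b r s where "\<And>k. biproduct C (Z k) (Z' k) (W k) (a k) (b k) (r k) (s k)" by metis
    from acyclic_with_sum[OF 1 2 b this] show ?thesis
      using bounded_family_sum[of "graded X" "graded Y", OF _ _ b] d d' unfolding acyclic_complex_iff by blast
  qed
  show ?thesis unfolding S_def Cpx_Bq_obj using X Y by (auto elim!: Bq_objE intro!: *)
qed

lemma Bq_biproduct:
  assumes X: "X \<in> Bq_obj C" and Y: "Y \<in> Bq_obj C"
    and b: "\<And>k. biproduct C (graded X k) (graded Y k) (E k) (i k) (j k) (p k) (q k)"
  defines "S \<equiv> Cpx E (\<lambda>k. block C (i (k - 1)) (j (k - 1)) (diff1 X k) (diff1 Y k) (p k) (q k))
      (\<lambda>k. block C (i (k - 1)) (j (k - 1)) (diff2 X k) (diff2 Y k) (p k) (q k))"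
  shows "biproduct (Bq C) X Y S (CpxArr X S i) (CpxArr Y S j) (CpxArr S X p) (CpxArr S Y q)"
proof -
  have S: "S \<in> Bq_obj C" unfolding S_def by (rule Bq_sum_obj[OF X Y b])
  have [simp]: "graded S = E" "diff1 S k = block C (i (k - 1)) (j (k - 1)) (diff1 X k) (diff1 Y k) (p k) (q k)"
    "diff2 S k = block C (i (k - 1)) (j (k - 1)) (diff2 X k) (diff2 Y k) (p k) (q k)" for k
    by (simp_all add: S_def)
  note [simp] = biproductD[OF b]
  note x = Bq_objD[OF X] and y = Bq_objD[OF Y]
  have "CpxArr X S i \<in> Bq_arr C" "CpxArr Y S j \<in> Bq_arr C" "CpxArr S X p \<in> Bq_arr C" "CpxArr S Y q \<in> Bq_arr C"
    unfolding Bq_arr_iff using X Y S x y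
    by (auto simp: Hom_iff block_proj[OF b b])
  then show ?thesis using X Y S by (simp add: biproduct_def Bq_Hom_iff)
qed

lemma Bq_zero_object:
  assumes "Z \<in> Bq_obj C" "\<And>k. zero_object C (graded Z k)"
  shows "zero_object (Bq C) Z"
proof -
  have "\<exists>!f. f \<in> Hom (Bq C) Z A" "\<exists>!f. f \<in> Hom (Bq C) A Z" if A: "A \<in> Bq_obj C" for A
  proof -
    show "\<exists>!f. f \<in> Hom (Bq C) Z A"
    proof (rule ex1I)
      show "CpxArr Z A (\<lambda>k. Zro C (graded Z k) (graded A k)) \<in> Hom (Bq C) Z A"
        using Bq_arr_Zro[OF assms(1) A] by (simp add: Bq_Hom_iff)
      fix f assume "f \<in> Hom (Bq C) Z A"
      then have f: "f \<in> Bq_arr C" "source f = Z" "target f = A" by (simp_all add: Bq_Hom_iff)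
      show "f = CpxArr Z A (\<lambda>k. Zro C (graded Z k) (graded A k))"
      proof (rule Bq_arr_eqI[OF f(1) Bq_arr_Zro[OF assms(1) A]])
        fix k
        show "component f k = component (CpxArr Z A (\<lambda>k. Zro C (graded Z k) (graded A k))) k"
          using zero_object_arr(1)[OF assms(2) Bq_arrD(4)[OF f(1)], of k k] Bq_arrD(5,6)[OF f(1), of k] f by simp
      qed (simp_all add: f)
    qed
    show "\<exists>!f. f \<in> Hom (Bq C) A Z"
    proof (rule ex1I)
      show "CpxArr A Z (\<lambda>k. Zro C (graded A k) (graded Z k)) \<in> Hom (Bq C) A Z"
        using Bq_arr_Zro[OF A assms(1)] by (simp add: Bq_Hom_iff)
      fix f assume "f \<in> Hom (Bq C) A Z"
      then have f: "f \<in> Bq_arr C" "source f = A" "target f = Z" by (simp_all add: Bq_Hom_iff)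
      show "f = CpxArr A Z (\<lambda>k. Zro C (graded A k) (graded Z k))"
      proof (rule Bq_arr_eqI[OF f(1) Bq_arr_Zro[OF A assms(1)]])
        fix k
        show "component f k = component (CpxArr A Z (\<lambda>k. Zro C (graded A k) (graded Z k))) k"
          using zero_object_arr(2)[OF assms(2) Bq_arrD(4)[OF f(1)], of k k] Bq_arrD(5,6)[OF f(1), of k] f by simp
      qed (simp_all add: f)
    qed
  qed
  then show ?thesis using assms(1) by (simp add: zero_object_def)
qed

text \<open>The split complex on a family \<open>A\<close>: \<open>U k\<close> projects onto
  \<open>A (k - 1)\<close>, which is included in \<open>U (k - 1)\<close>. It provides the diagonal
  complements and, for zero \<open>A\<close>, the zero complex.\<close>

lemma acyclic_with_biproduct:
  assumes "\<And>k. biproduct C (A k) (A (k - 1)) (U k) (i k) (j k) (p k) (q k)"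
  shows "acyclic_with C U (\<lambda>k. i (k - 1) \<cdot> q k) A i q"
  using biproductD[OF assms] Ses_biproduct[OF assms] by (simp add: acyclic_with_def Hom_iff)

lemma zero_complex:
  assumes "zero_object C Z"
  shows "Cpx (\<lambda>_. Z) (\<lambda>_. Zro C Z Z) (\<lambda>_. Zro C Z Z) \<in> Bq_obj C"
proof -
  have Z: "Z \<in> Obj C" "Idn C Z = Zro C Z Z" using assms by (simp_all add: zero_object_iff)
  have "acyclic_with C (\<lambda>_. Z) (\<lambda>_. Zro C Z Z) (\<lambda>_. Z) (\<lambda>_. Zro C Z Z) (\<lambda>_. Zro C Z Z)"
    using acyclic_with_biproduct[of "\<lambda>_. Z" "\<lambda>_. Z" "\<lambda>_. Idn C Z" "\<lambda>_. Zro C Z Z" "\<lambda>_. Idn C Z" "\<lambda>_. Zro C Z Z",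
      OF biproduct_zero[OF Z(1) assms]] Z by simp
  moreover have "bounded_family C (\<lambda>_. Z)" using assms Z by (simp add: bounded_family_def)
  ultimately show ?thesis by (auto simp: Cpx_Bq_obj acyclic_complex_iff)
qed

lemma biproduct_component:
  assumes "biproduct (Bq C) X Y S i j p q"
  shows "biproduct C (graded X k) (graded Y k) (graded S k)
    (component i k) (component j k) (component p k) (component q k)"
  using assms by (auto simp: biproduct_def Bq_Hom_iff Bq_arr_iff intro: Bq_objD dest: fun_cong)

lemma Bq_additive: "additive_category (Bq C)"
proof (intro additive_category.intro additive_category_axioms.intro category.intro)
  show "comm_group (hom_group (Bq C) A B)" if "A \<in> Obj (Bq C)" "B \<in> Obj (Bq C)" for A B
  proof (rule comm_groupI)
    fix f assume "f \<in> carrier (hom_group (Bq C) A B)"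
    then have f: "f \<in> Bq_arr C" "source f = A" "target f = B" by (simp_all add: hom_group_def Bq_Hom_iff)
    obtain g where "g \<in> Bq_arr C" "source g = A" "target g = B"
      "\<And>k. Add C (component g k) (component f k) = Zro C (graded A k) (graded B k)"
      using Bq_arr_inverse[OF f(1)] f by metis
    then show "\<exists>g \<in> carrier (hom_group (Bq C) A B). g \<otimes>\<^bsub>hom_group (Bq C) A B\<^esub> f = \<one>\<^bsub>hom_group (Bq C) A B\<^esub>"
      by (intro bexI[of _ g]) (simp_all add: hom_group_def Bq_Hom_iff)
  next
    fix f assume "f \<in> carrier (hom_group (Bq C) A B)"
    then have f: "f \<in> Bq_arr C" "source f = A" "target f = B" by (simp_all add: hom_group_def Bq_Hom_iff)
    then show "\<one>\<^bsub>hom_group (Bq C) A B\<^esub> \<otimes>\<^bsub>hom_group (Bq C) A B\<^esub> f = f"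
      using Bq_arrD[OF f(1)] by (cases f) (auto simp: hom_group_def)
  next
    fix f g assume fg: "f \<in> carrier (hom_group (Bq C) A B)" "g \<in> carrier (hom_group (Bq C) A B)"
    then have f: "f \<in> Bq_arr C" "source f = A" "target f = B" and g: "g \<in> Bq_arr C" "source g = A" "target g = B"
      by (simp_all add: hom_group_def Bq_Hom_iff)
    show "f \<otimes>\<^bsub>hom_group (Bq C) A B\<^esub> g \<in> carrier (hom_group (Bq C) A B)"
      using Bq_arr_Add[OF f(1) g(1)] f g by (simp add: hom_group_def Bq_Hom_iff)
    show "f \<otimes>\<^bsub>hom_group (Bq C) A B\<^esub> g = g \<otimes>\<^bsub>hom_group (Bq C) A B\<^esub> f"
      using f g Add_commute[of "component f k" "component g k" for k]
      by (simp add: hom_group_def Bq_arrD[OF f(1)] Bq_arrD[OF g(1)])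
    fix h assume "h \<in> carrier (hom_group (Bq C) A B)"
    then have h: "h \<in> Bq_arr C" "source h = A" "target h = B" by (simp_all add: hom_group_def Bq_Hom_iff)
    show "f \<otimes>\<^bsub>hom_group (Bq C) A B\<^esub> g \<otimes>\<^bsub>hom_group (Bq C) A B\<^esub> h =
        f \<otimes>\<^bsub>hom_group (Bq C) A B\<^esub> (g \<otimes>\<^bsub>hom_group (Bq C) A B\<^esub> h)"
      using f g h Add_assoc[of "component f k" "component g k" "component h k" for k]
      by (simp add: hom_group_def Bq_arrD[OF f(1)] Bq_arrD[OF g(1)] Bq_arrD[OF h(1)])
  next
    show "\<one>\<^bsub>hom_group (Bq C) A B\<^esub> \<in> carrier (hom_group (Bq C) A B)"
      using that by (simp add: hom_group_def Bq_Hom_iff Bq_arr_Zro)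
  qed
  obtain Z where "zero_object C Z" using zero_object_exists by blast
  then show "\<exists>Z. zero_object (Bq C) Z" using Bq_zero_object[OF zero_complex] by auto
  show "\<exists>S. direct_sum (Bq C) X Y S" if "X \<in> Obj (Bq C)" "Y \<in> Obj (Bq C)" for X Y
  proof -
    have XY: "X \<in> Bq_obj C" "Y \<in> Bq_obj C" using that by simp_all
    have "\<forall>k. \<exists>E i j p q. biproduct C (graded X k) (graded Y k) E i j p q"
      using direct_sum_exists XY by (simp add: direct_sum_def Bq_objD)
    then obtain E i j p q where "\<And>k. biproduct C (graded X k) (graded Y k) (E k) (i k) (j k) (p k) (q k)" by metis
    from Bq_biproduct[OF XY this] show ?thesis unfolding direct_sum_def by blast
  qed
  show "A \<in> Obj (Bq C) \<Longrightarrow> Idn (Bq C) A \<in> Hom (Bq C) A A" for A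
    by (simp add: Bq_Hom_iff Bq_arr_Idn)
  show "\<lbrakk>f \<in> Arr (Bq C); g \<in> Arr (Bq C); Cod (Bq C) f = Dom (Bq C) g\<rbrakk>
      \<Longrightarrow> g \<cdot>\<^bsub>Bq C\<^esub> f \<in> Hom (Bq C) (Dom (Bq C) f) (Cod (Bq C) g)" for f g
    by (simp add: Bq_Hom_iff Bq_arr_Cmp)
  show "f \<in> Arr (Bq C) \<Longrightarrow> Idn (Bq C) (Cod (Bq C) f) \<cdot>\<^bsub>Bq C\<^esub> f = f" for f
    using Bq_arrD[of f C] by (cases f) auto
  show "f \<in> Arr (Bq C) \<Longrightarrow> f \<cdot>\<^bsub>Bq C\<^esub> Idn (Bq C) (Dom (Bq C) f) = f" for f
    using Bq_arrD[of f C] by (cases f) auto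
qed (auto simp: Bq_Hom_iff Bq_arrD)

text \<open>Short exactness in \<open>Bq C\<close> is termwise, and a biproduct of complexes is a
  biproduct in every degree, so each axiom is inherited from \<open>C\<close>.\<close>

lemma weakly_exact_Bq: "weakly_exact_multicomplexes (Bq C)"
proof -
  interpret B: additive_category "Bq C" by (rule Bq_additive)
  show ?thesis
  proof (intro weakly_exact_multicomplexes.intro weakly_exact_category.intro weakly_exact_category_axioms.intro Bq_additive)
    show "p \<cdot>\<^bsub>Bq C\<^esub> i = Zro (Bq C) (Dom (Bq C) i) (Cod (Bq C) p)" if "(i, p) \<in> Ses (Bq C)" for i p
      using that Ses_Cmp[of "component i k" "component p k" for k] by (auto simp: Bq_Ses_iff Bq_arrD)
    show "f = g" if "(i, p) \<in> Ses (Bq C)" "f \<in> Arr (Bq C)" "g \<in> Arr (Bq C)" "Cod (Bq C) f = Dom (Bq C) i"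
        "Cod (Bq C) g = Dom (Bq C) i" "i \<cdot>\<^bsub>Bq C\<^esub> f = i \<cdot>\<^bsub>Bq C\<^esub> g" for i p f g
    proof (rule Bq_arr_eqI[of _ C])
      fix k
      have "component i k \<cdot> component f k = component i k \<cdot> component g k"
        using that(6) by (auto dest: fun_cong)
      moreover have i: "i \<in> Bq_arr C" "(component i k, component p k) \<in> Ses C"
        using that(1) by (auto simp: Bq_Ses_iff)
      moreover have "f \<in> Bq_arr C" "g \<in> Bq_arr C" "target f = source i" "target g = source i"
        using that(2-5) by simp_all
      ultimately show "component f k = component g k"
        by - (rule Ses_monic[OF i(2)], simp_all add: Bq_arrD)
    qed (use that(2-6) in simp_all)
    show "(i, q) \<in> Ses (Bq C)" if b: "biproduct (Bq C) A B S i j p q" for A B S i j p q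
      using B.biproductD[OF b] Ses_biproduct[OF biproduct_component[OF b]] by (auto simp: Bq_Ses_iff)
    show "(block (Bq C) i2 j2 i i' p1 q1, block (Bq C) i3 j3 p p' p2 q2) \<in> Ses (Bq C)"
      if s: "(i, p) \<in> Ses (Bq C)" "(i', p') \<in> Ses (Bq C)"
        and 1: "biproduct (Bq C) (Dom (Bq C) i) (Dom (Bq C) i') S1 i1 j1 p1 q1"
        and 2: "biproduct (Bq C) (Cod (Bq C) i) (Cod (Bq C) i') S2 i2 j2 p2 q2"
        and 3: "biproduct (Bq C) (Cod (Bq C) p) (Cod (Bq C) p') S3 i3 j3 p3 q3"
      for i p i' p' S1 i1 j1 p1 q1 S2 i2 j2 p2 q2 S3 i3 j3 p3 q3
    proof -
      have a: "i \<in> Bq_arr C" "p \<in> Bq_arr C" "i' \<in> Bq_arr C" "p' \<in> Bq_arr C" "target i = source p" "target i' = source p'"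
        and c: "\<And>k. (component i k, component p k) \<in> Ses C" "\<And>k. (component i' k, component p' k) \<in> Ses C"
        using s by (auto simp: Bq_Ses_iff)
      have "(component (block (Bq C) i2 j2 i i' p1 q1) k, component (block (Bq C) i3 j3 p p' p2 q2) k) \<in> Ses C" for k
        using Ses_sum[OF c[of k], of "graded S1 k" _ _ _ _ "graded S2 k" _ _ _ _ "graded S3 k"]
          biproduct_component[OF 1, of k] biproduct_component[OF 2, of k] biproduct_component[OF 3, of k] a
        by (simp add: block_def Bq_arrD)
      moreover note B.block_simps[OF 1 2, of i i'] B.block_simps[OF 2[unfolded Bq_simps a] 3, of p p'] a
      ultimately show ?thesis by (simp add: Bq_Ses_iff)
    qed
  qed (auto simp: Bq_Ses_iff)
qed

end

section \<open>Full subcategories and their complexes\<close>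

lemma full_subcategory_simps [simp]:
  "Obj (full_subcategory C S) = S" "Dom (full_subcategory C S) = Dom C" "Cod (full_subcategory C S) = Cod C"
  "Idn (full_subcategory C S) = Idn C" "Cmp (full_subcategory C S) = Cmp C"
  "Add (full_subcategory C S) = Add C" "Zro (full_subcategory C S) = Zro C"
  "f \<in> Arr (full_subcategory C S) \<longleftrightarrow> f \<in> Arr C \<and> Dom C f \<in> S \<and> Cod C f \<in> S"
  "(i, p) \<in> Ses (full_subcategory C S) \<longleftrightarrow> (i, p) \<in> Ses C \<and> Dom C i \<in> S \<and> Cod C i \<in> S \<and> Cod C p \<in> S"
  by (auto simp: full_subcategory_def)

lemma full_subcategory_Hom [simp]:
  "f \<in> Hom (full_subcategory C S) A B \<longleftrightarrow> f \<in> Hom C A B \<and> A \<in> S \<and> B \<in> S"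
  by (auto simp: Hom_iff)

lemma (in additive_category) full_subcategory_zero_object:
  assumes "S \<subseteq> Obj C"
  shows "zero_object (full_subcategory C S) Z \<longleftrightarrow> Z \<in> S \<and> zero_object C Z"
proof
  assume "zero_object (full_subcategory C S) Z"
  then have Z: "Z \<in> S" "\<exists>!f. f \<in> Hom C Z Z" by (auto simp: zero_object_def)
  moreover have "Idn C Z \<in> Hom C Z Z" "Zro C Z Z \<in> Hom C Z Z" using Z assms by (auto simp: Hom_iff)
  ultimately show "Z \<in> S \<and> zero_object C Z" unfolding zero_object_iff using assms by blast
next
  assume "Z \<in> S \<and> zero_object C Z"
  then show "zero_object (full_subcategory C S) Z" using assms by (simp add: zero_object_def subset_iff)
qed

lemma base_category_full_subcategory:
  "base_category (full_subcategory N S) = full_subcategory (base_category N) (Base ` S)"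
  unfolding base_category_def full_subcategory_def by (auto simp: image_iff)

context weakly_exact_category
begin

text \<open>Acyclicity inside the subcategory asks for more than entries in \<open>S\<close>: there
  must be cycle objects in \<open>S\<close>, too. Hence complements are needed for entries and
  cycles simultaneously.\<close>

lemma full_subcategory_acyclic_complex:
  assumes S: "S \<subseteq> Obj C"
  shows "acyclic_complex (full_subcategory C S) X d \<longleftrightarrow> bounded_family C X \<and> (\<forall>k. X k \<in> S) \<and>
    (\<exists>Z m e. acyclic_with C X d Z m e \<and> (\<forall>k. Z k \<in> S))"
proof
  assume a: "acyclic_complex (full_subcategory C S) X d"
  then have "bounded_family C X \<and> (\<forall>k. X k \<in> S)"
    using S unfolding acyclic_complex_def bounded_complex_def bounded_family_def full_subcategory_zero_object[OF S]
    by auto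
  moreover have "\<exists>Z m e. acyclic_with C X d Z m e \<and> (\<forall>k. Z k \<in> S)"
  proof -
    obtain Z m e where "(\<forall>k. m k \<in> Hom (full_subcategory C S) (Z k) (X k)) \<and>
      (\<forall>k. e k \<in> Hom (full_subcategory C S) (X k) (Z (k - 1))) \<and>
      (\<forall>k. d k = m (k - 1) \<cdot>\<^bsub>full_subcategory C S\<^esub> e k) \<and> (\<forall>k. (m k, e k) \<in> Ses (full_subcategory C S))"
      using a unfolding acyclic_complex_def by blast
    then have "acyclic_with C X d Z m e \<and> (\<forall>k. Z k \<in> S)" by (simp add: acyclic_with_def)
    then show ?thesis by blast
  qed
  ultimately show "bounded_family C X \<and> (\<forall>k. X k \<in> S) \<and> (\<exists>Z m e. acyclic_with C X d Z m e \<and> (\<forall>k. Z k \<in> S))"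
    by blast
next
  assume a: "bounded_family C X \<and> (\<forall>k. X k \<in> S) \<and> (\<exists>Z m e. acyclic_with C X d Z m e \<and> (\<forall>k. Z k \<in> S))"
  then obtain Z m e where Z: "acyclic_with C X d Z m e" "\<And>k. Z k \<in> S" by blast
  have "acyclic_complex C X d" using a by (auto simp: acyclic_complex_iff)
  then have "bounded_complex (full_subcategory C S) X d"
    using a unfolding acyclic_complex_def bounded_complex_def full_subcategory_zero_object[OF S] by simp
  moreover have "(\<forall>k. m k \<in> Hom (full_subcategory C S) (Z k) (X k)) \<and>
      (\<forall>k. e k \<in> Hom (full_subcategory C S) (X k) (Z (k - 1))) \<and>
      (\<forall>k. d k = m (k - 1) \<cdot>\<^bsub>full_subcategory C S\<^esub> e k) \<and> (\<forall>k. (m k, e k) \<in> Ses (full_subcategory C S))"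
    using a Z(2) acyclic_withD[OF Z(1)] by (simp add: Hom_iff)
  ultimately show "acyclic_complex (full_subcategory C S) X d"
    unfolding acyclic_complex_def by blast
qed

end

context weakly_exact_multicomplexes
begin

lemma Bq_obj_full_subcategory:
  assumes S: "S \<subseteq> Obj C"
  shows "X \<in> Bq_obj (full_subcategory C S) \<longleftrightarrow> (\<exists>T d d'. X = Cpx T d d' \<and> bounded_family C T \<and> (\<forall>k. T k \<in> S) \<and>
    (\<exists>Z m e. acyclic_with C T d Z m e \<and> (\<forall>k. Z k \<in> S)) \<and>
    (\<exists>Z m e. acyclic_with C T d' Z m e \<and> (\<forall>k. Z k \<in> S)))"
  unfolding Bq_obj_def full_subcategory_acyclic_complex[OF S] by blast

lemma Bq_obj_full_subset:
  assumes S: "S \<subseteq> Obj C"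
  shows "Bq_obj (full_subcategory C S) \<subseteq> Bq_obj C"
proof
  fix X assume "X \<in> Bq_obj (full_subcategory C S)"
  then obtain T d d' Z m e Z' m' e' where "X = Cpx T d d'" "bounded_family C T"
    "acyclic_with C T d Z m e" "acyclic_with C T d' Z' m' e'"
    unfolding Bq_obj_full_subcategory[OF S] by blast
  then show "X \<in> Bq_obj C" unfolding Cpx_Bq_obj acyclic_complex_iff by (simp add: Cpx_Bq_obj acyclic_complex_iff) blast
qed

lemma Bq_obj_full_graded:
  assumes "S \<subseteq> Obj C" "X \<in> Bq_obj (full_subcategory C S)"
  shows "graded X k \<in> S"
  using assms(2) by (auto simp: Bq_obj_full_subcategory[OF assms(1)])

text \<open>A complex of the subcategory has its entries in \<open>S\<close>, so termwise exactness
  means the same in both categories. Stated as an equation of records, the identification can be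
  iterated.\<close>

lemma Bq_full_subcategory:
  assumes S: "S \<subseteq> Obj C"
  shows "Bq (full_subcategory C S) = full_subcategory (Bq C) (Bq_obj (full_subcategory C S))"
proof -
  have arr: "f \<in> Bq_arr (full_subcategory C S) \<longleftrightarrow> f \<in> Bq_arr C \<and>
      source f \<in> Bq_obj (full_subcategory C S) \<and> target f \<in> Bq_obj (full_subcategory C S)" for f
    using Bq_obj_full_graded[OF S, of "source f"] Bq_obj_full_graded[OF S, of "target f"] Bq_obj_full_subset[OF S]
    by (auto simp: Bq_arr_iff)
  have ses: "(i, p) \<in> Ses (Bq (full_subcategory C S)) \<longleftrightarrow>
      (i, p) \<in> Ses (full_subcategory (Bq C) (Bq_obj (full_subcategory C S)))" for i p
  proof
    assume "(i, p) \<in> Ses (Bq (full_subcategory C S))"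
    then show "(i, p) \<in> Ses (full_subcategory (Bq C) (Bq_obj (full_subcategory C S)))"
      by (simp add: Bq_Ses_iff arr)
  next
    assume h: "(i, p) \<in> Ses (full_subcategory (Bq C) (Bq_obj (full_subcategory C S)))"
    then have i: "i \<in> Bq_arr C" "p \<in> Bq_arr C" and ip: "target i = source p"
      and ob: "source i \<in> Bq_obj (full_subcategory C S)" "source p \<in> Bq_obj (full_subcategory C S)"
        "target p \<in> Bq_obj (full_subcategory C S)"
      by (auto simp: Bq_Ses_iff)
    show "(i, p) \<in> Ses (Bq (full_subcategory C S))"
      using h ob by (simp add: Bq_Ses_iff arr ip Bq_arrD(5,6)[OF i(1)] Bq_arrD(5,6)[OF i(2)] Bq_obj_full_graded[OF S])
  qed
  show ?thesis
  proof (rule excat.equality)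
    show "Arr (Bq (full_subcategory C S)) = Arr (full_subcategory (Bq C) (Bq_obj (full_subcategory C S)))"
      by (auto simp: arr)
    show "Ses (Bq (full_subcategory C S)) = Ses (full_subcategory (Bq C) (Bq_obj (full_subcategory C S)))"
      using ses by auto
  qed (auto intro!: ext)
qed

text \<open>The sums of the entries and of the two families of cycles can be chosen in
  \<open>S\<close> independently of each other; \<open>acyclic_with_sum\<close> accepts any such
  choice.\<close>

lemma Bq_direct_sum_in_subcategory:
  assumes S: "S \<subseteq> Obj C" and X: "X \<in> Bq_obj C" and Y: "Y \<in> Bq_obj C"
    and sum: "\<And>k. \<exists>E\<in>S. direct_sum C (graded X k) (graded Y k) E"
    and x1: "acyclic_with C (graded X) (diff1 X) Z1 m1 e1" and y1: "acyclic_with C (graded Y) (diff1 Y) Z1' m1' e1'"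
    and z1: "\<And>k. \<exists>W\<in>S. direct_sum C (Z1 k) (Z1' k) W"
    and x2: "acyclic_with C (graded X) (diff2 X) Z2 m2 e2" and y2: "acyclic_with C (graded Y) (diff2 Y) Z2' m2' e2'"
    and z2: "\<And>k. \<exists>W\<in>S. direct_sum C (Z2 k) (Z2' k) W"
  shows "\<exists>E \<in> Bq_obj (full_subcategory C S). direct_sum (Bq C) X Y E"
proof -
  have "\<forall>k. \<exists>E i j p q. E \<in> S \<and> biproduct C (graded X k) (graded Y k) E i j p q"
    using sum unfolding direct_sum_def by blast
  then obtain E i j p q where E: "\<And>k. E k \<in> S"
    and b: "\<And>k. biproduct C (graded X k) (graded Y k) (E k) (i k) (j k) (p k) (q k)" by metis
  have "\<forall>k. \<exists>W i j p q. W \<in> S \<and> biproduct C (Z1 k) (Z1' k) W i j p q"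
    using z1 unfolding direct_sum_def by blast
  then obtain W1 a1 b1 r1 s1 where W1: "\<And>k. W1 k \<in> S"
    and c1: "\<And>k. biproduct C (Z1 k) (Z1' k) (W1 k) (a1 k) (b1 k) (r1 k) (s1 k)" by metis
  have "\<forall>k. \<exists>W i j p q. W \<in> S \<and> biproduct C (Z2 k) (Z2' k) W i j p q"
    using z2 unfolding direct_sum_def by blast
  then obtain W2 a2 b2 r2 s2 where W2: "\<And>k. W2 k \<in> S"
    and c2: "\<And>k. biproduct C (Z2 k) (Z2' k) (W2 k) (a2 k) (b2 k) (r2 k) (s2 k)" by metis
  let ?E = "Cpx E (\<lambda>k. block C (i (k - 1)) (j (k - 1)) (diff1 X k) (diff1 Y k) (p k) (q k))
      (\<lambda>k. block C (i (k - 1)) (j (k - 1)) (diff2 X k) (diff2 Y k) (p k) (q k))"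
  have "bounded_family C E" by (rule bounded_family_sum[OF _ _ b]) (use X Y in \<open>auto intro: Bq_objD\<close>)
  then have "?E \<in> Bq_obj (full_subcategory C S)"
    using acyclic_with_sum[OF x1 y1 b c1] acyclic_with_sum[OF x2 y2 b c2] E W1 W2
    unfolding Bq_obj_full_subcategory[OF S] by blast
  then show ?thesis using Bq_biproduct[OF X Y b] unfolding direct_sum_def by blast
qed

text \<open>The injections commute with both differentials, and an arrow out of a biproduct is
  determined by its composites with the injections. Hence this holds for every sum, not just for
  block-diagonal ones.\<close>

lemma diagonal_direct_sum:
  assumes "direct_sum (Bq C) X Y E" "diff1 X = diff2 X" "diff1 Y = diff2 Y"
  shows "diff1 E = diff2 E"
proof
  fix k
  obtain i j p q where b: "biproduct (Bq C) X Y E i j p q" using assms(1) by (auto simp: direct_sum_def)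
  have ar: "i \<in> Bq_arr C" "j \<in> Bq_arr C" "E \<in> Bq_obj C" "source i = X" "target i = E" "source j = Y" "target j = E"
    using b by (auto simp: biproduct_def Bq_Hom_iff)
  note bk = biproduct_component[OF b, of k]
  show "diff1 E k = diff2 E k"
  proof (rule biproduct_eqI2[OF bk])
    show "diff1 E k \<cdot> component i k = diff2 E k \<cdot> component i k"
      using Bq_arrD(7,8)[OF ar(1), of k] ar assms by simp
    show "diff1 E k \<cdot> component j k = diff2 E k \<cdot> component j k"
      using Bq_arrD(7,8)[OF ar(2), of k] ar assms by simp
  qed (use Bq_objD[OF ar(3)] in simp_all)
qed

text \<open>The two differentials of the subcomplex agree after composition with
  \<open>component i (k - 1)\<close>, which can be cancelled.\<close>

lemma diagonal_sub:
  assumes "(i, p) \<in> Ses (Bq C)" "diff1 (target i) = diff2 (target i)"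
  shows "diff1 (source i) = diff2 (source i)"
proof
  fix k
  have i: "i \<in> Bq_arr C" and s: "(component i (k - 1), component p (k - 1)) \<in> Ses C"
    using assms(1) by (auto simp: Bq_Ses_iff)
  show "diff1 (source i) k = diff2 (source i) k"
    by (rule Ses_monic[OF s]) (use Bq_arrD[OF i] Bq_objD[OF Bq_arrD(2)[OF i]] assms(2) in simp_all)
qed

end


section \<open>Isomorphism classes and complements\<close>

text \<open>Abstracts isomorphism classes under direct sum; \<open>T\<close> singles out the classes
  represented in the subcategory. Associativity and commutativity are unconditional so that they can
  be used as rewrite rules, while the zero law depends on \<open>Q\<close>.\<close>

locale cofinal_monoid =
  fixes plus :: "'a \<Rightarrow> 'a \<Rightarrow> 'a" (infixl "\<oplus>" 65) and zero :: 'a ("\<zero>") and Q :: "'a set" and T :: "'a \<Rightarrow> bool"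
  assumes plus_assoc: "a \<oplus> b \<oplus> c = a \<oplus> (b \<oplus> c)"
    and plus_commute: "a \<oplus> b = b \<oplus> a"
    and plus_zero [simp]: "a \<in> Q \<Longrightarrow> a \<oplus> \<zero> = a"
    and plus_closed [simp]: "\<lbrakk>a \<in> Q; b \<in> Q\<rbrakk> \<Longrightarrow> a \<oplus> b \<in> Q"
    and zero_closed [simp]: "\<zero> \<in> Q"
    and T_zero [simp]: "T \<zero>"
    and T_plus: "\<lbrakk>T a; T b\<rbrakk> \<Longrightarrow> T (a \<oplus> b)"
    and cofinal: "a \<in> Q \<Longrightarrow> \<exists>u \<in> Q. T (a \<oplus> u)"
begin

lemma plus_left_commute: "a \<oplus> (b \<oplus> c) = b \<oplus> (a \<oplus> c)"
  by (metis plus_assoc plus_commute)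

lemmas plus_ac = plus_assoc plus_commute plus_left_commute

definition eqv :: "'a \<Rightarrow> 'a \<Rightarrow> bool" where
  "eqv a b \<longleftrightarrow> (\<exists>u \<in> Q. T (a \<oplus> u) \<and> T (b \<oplus> u))"

lemma eqv_refl: "a \<in> Q \<Longrightarrow> eqv a a"
  using cofinal by (auto simp: eqv_def)

lemma eqv_sym: "eqv a b \<Longrightarrow> eqv b a"
  by (auto simp: eqv_def)

lemma eqv_trans:
  assumes "eqv a b" "eqv b c" "b \<in> Q"
  shows "eqv a c"
proof -
  obtain u v where u: "u \<in> Q" "T (a \<oplus> u)" "T (b \<oplus> u)" and v: "v \<in> Q" "T (b \<oplus> v)" "T (c \<oplus> v)"
    using assms by (auto simp: eqv_def)
  \<comment> \<open>The intermediate \<open>b\<close> becomes part of the complement: it absorbs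
    \<open>v\<close> on one side and \<open>u\<close> on the other.\<close>
  have "T ((a \<oplus> u) \<oplus> (b \<oplus> v))" "T ((c \<oplus> v) \<oplus> (b \<oplus> u))" using u v T_plus by blast+
  then have "T (a \<oplus> (b \<oplus> u \<oplus> v))" "T (c \<oplus> (b \<oplus> u \<oplus> v))" by (simp_all add: plus_ac)
  then show ?thesis using u v assms(3) unfolding eqv_def by (meson plus_closed)
qed

lemma eqv_plus:
  assumes "eqv a b" "eqv c d"
  shows "eqv (a \<oplus> c) (b \<oplus> d)"
proof -
  obtain u v where u: "u \<in> Q" "T (a \<oplus> u)" "T (b \<oplus> u)" and v: "v \<in> Q" "T (c \<oplus> v)" "T (d \<oplus> v)"
    using assms by (auto simp: eqv_def)
  have "T ((a \<oplus> u) \<oplus> (c \<oplus> v))" "T ((b \<oplus> u) \<oplus> (d \<oplus> v))" using u v T_plus by blast+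
  then have "T (a \<oplus> c \<oplus> (u \<oplus> v))" "T (b \<oplus> d \<oplus> (u \<oplus> v))" by (simp_all add: plus_ac)
  then show ?thesis using u v unfolding eqv_def by (meson plus_closed)
qed

text \<open>After crosswise addition of \<open>d\<close> and \<open>c\<close>, both sides contain
  \<open>c \<oplus> d\<close>, which is then absorbed into the complement.\<close>

lemma eqv_cancel:
  assumes "eqv (a \<oplus> c) (b \<oplus> d)" "eqv c d" "c \<in> Q" "d \<in> Q"
  shows "eqv a b"
proof -
  have "eqv (a \<oplus> c \<oplus> d) (b \<oplus> d \<oplus> c)" using assms eqv_plus eqv_sym by blast
  then obtain u where "u \<in> Q" "T (a \<oplus> (c \<oplus> d \<oplus> u))" "T (b \<oplus> (c \<oplus> d \<oplus> u))"
    unfolding eqv_def by (auto simp: plus_ac)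
  then show ?thesis unfolding eqv_def using assms(3,4) by (meson plus_closed)
qed

lemma T_eqv_zero: "\<lbrakk>T a; a \<in> Q\<rbrakk> \<Longrightarrow> eqv a \<zero>"
  unfolding eqv_def by (rule bexI[of _ \<zero>]) simp_all

text \<open>Equivalence provides a complement for two elements at a time; the induction merges these
  into a single one for a finite set.\<close>

lemma common_complement:
  assumes "finite F" "F \<subseteq> Q" "a \<in> Q" "\<And>f. f \<in> F \<Longrightarrow> eqv a f"
  shows "\<exists>u \<in> Q. T (a \<oplus> u) \<and> (\<forall>f \<in> F. T (f \<oplus> u))"
  using assms
proof (induction F rule: finite_induct)
  case empty
  then show ?case using cofinal by auto
next
  case (insert f F)
  obtain u where u: "u \<in> Q" "T (a \<oplus> u)" "\<And>g. g \<in> F \<Longrightarrow> T (g \<oplus> u)" using insert by auto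
  obtain v where v: "v \<in> Q" "T (a \<oplus> v)" "T (f \<oplus> v)"
    using insert.prems(3)[of f] by (auto simp: eqv_def)
  \<comment> \<open>In the new complement \<open>u \<oplus> (a \<oplus> v)\<close>, each element is
    paired with \<open>u\<close> or \<open>v\<close>, and the copy of \<open>a\<close> with the
    other one.\<close>
  have "T (g \<oplus> (u \<oplus> (a \<oplus> v)))" if "g \<in> F" for g
    using T_plus[OF u(3)[OF that] v(2)] by (simp add: plus_ac)
  moreover have "T (f \<oplus> (u \<oplus> (a \<oplus> v)))" "T (a \<oplus> (u \<oplus> (a \<oplus> v)))"
    using T_plus[OF v(3) u(2)] T_plus[OF u(2) v(2)] by (simp_all add: plus_ac)
  ultimately show ?case using u v insert by (intro bexI[of _ "u \<oplus> (a \<oplus> v)"]) auto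
qed

lemma cycles_eqv:
  fixes z w :: "int \<Rightarrow> 'a"
  assumes "\<And>k. z k \<in> Q" "\<And>k. w k \<in> Q" "\<And>k. eqv (z k \<oplus> z (k - 1)) (w k \<oplus> w (k - 1))"
    and "\<And>k. k < b \<Longrightarrow> z k = \<zero>" "\<And>k. k < b \<Longrightarrow> w k = \<zero>"
  shows "eqv (z k) (w k)"
proof (cases "k < b")
  case True
  then show ?thesis using assms(4,5) eqv_refl[OF zero_closed] by simp
next
  case False
  \<comment> \<open>The induction starts one degree below \<open>b\<close>, where both families
    still vanish.\<close>
  then have "k \<ge> b - 1" by simp
  then show ?thesis
  proof (induction k rule: int_ge_induct)
    case base
    then show ?case using assms(4,5)[of "b - 1"] eqv_refl[OF zero_closed] by simp
  next
    case (step k)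
    then show ?case using assms(3)[of "k + 1"] assms(1,2) eqv_cancel by simp
  qed
qed

text \<open>
  \<open>F k\<close> stands for the cycles and \<open>G k\<close> for the entries in degree \<open>k\<close>. A common complement \<open>u k\<close> of the
  cycles only makes the entries equivalent to \<open>\<zero>\<close>; the summands \<open>v k\<close>, which satisfy \<open>T\<close> themselves,
  correct this without affecting the cycles.
\<close>

lemma complement_family:
  fixes F G :: "int \<Rightarrow> 'a set"
  assumes fin: "\<And>k. finite (F k)" "\<And>k. finite (G k)" and FQ: "\<And>k. F k \<subseteq> Q" "\<And>k. G k \<subseteq> Q" and ne: "\<And>k. F k \<noteq> {}"
    and F: "\<And>k f f'. f \<in> F k \<Longrightarrow> f' \<in> F k \<Longrightarrow> eqv f f'"
    and G: "\<And>k f f' g. f \<in> F k \<Longrightarrow> f' \<in> F (k - 1) \<Longrightarrow> g \<in> G k \<Longrightarrow> eqv g (f \<oplus> f')"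
    and b: "\<And>k. \<bar>k\<bar> > b \<Longrightarrow> F k \<subseteq> {\<zero>}" "\<And>k. \<bar>k\<bar> > b \<Longrightarrow> G k \<subseteq> {\<zero>}"
  obtains a b' where "\<And>k. a k \<in> Q" "\<And>k. \<bar>k\<bar> > b' \<Longrightarrow> a k = \<zero>"
    "\<And>k f. f \<in> F k \<Longrightarrow> T (f \<oplus> a k)" "\<And>k g. g \<in> G k \<Longrightarrow> T (g \<oplus> (a k \<oplus> a (k - 1)))"
proof -
  have "\<exists>u \<in> Q. (\<bar>k\<bar> > b \<longrightarrow> u = \<zero>) \<and> (\<forall>f \<in> F k. T (f \<oplus> u))" for k
  proof (cases "\<bar>k\<bar> > b")
    case True
    then have "\<forall>f \<in> F k. f = \<zero>" using b(1) by auto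
    then show ?thesis by (intro bexI[of _ \<zero>]) auto
  next
    case False
    obtain f where "f \<in> F k" using ne by blast
    then show ?thesis using common_complement[OF fin(1) FQ(1), of f k] F FQ(1) False by blast
  qed
  then obtain u where u: "\<And>k. u k \<in> Q" "\<And>k. \<bar>k\<bar> > b \<Longrightarrow> u k = \<zero>" "\<And>k f. f \<in> F k \<Longrightarrow> T (f \<oplus> u k)"
    by metis
  have g: "eqv \<zero> (g \<oplus> (u k \<oplus> u (k - 1)))" if "g \<in> G k" for g k
  proof -
    obtain f f' where f: "f \<in> F k" "f' \<in> F (k - 1)" using ne by blast
    have Q: "f \<in> Q" "f' \<in> Q" "g \<in> Q" using f FQ that by blast+
    have "eqv (g \<oplus> (u k \<oplus> u (k - 1))) (f \<oplus> f' \<oplus> (u k \<oplus> u (k - 1)))"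
      by (rule eqv_plus[OF G[OF f that] eqv_refl]) (simp add: u)
    moreover have "f \<oplus> f' \<oplus> (u k \<oplus> u (k - 1)) = (f \<oplus> u k) \<oplus> (f' \<oplus> u (k - 1))" by (simp add: plus_ac)
    moreover have "eqv ((f \<oplus> u k) \<oplus> (f' \<oplus> u (k - 1))) \<zero>"
      by (rule T_eqv_zero) (use T_plus u f Q in simp_all)
    ultimately show ?thesis using eqv_trans eqv_sym Q u by (metis plus_closed)
  qed
  \<comment> \<open>Degree \<open>k\<close> involves both \<open>u k\<close> and
    \<open>u (k - 1)\<close>, so the correction is known to vanish only beyond
    \<open>b + 1\<close>.\<close>
  have "\<exists>v \<in> Q. (\<bar>k\<bar> > b + 1 \<longrightarrow> v = \<zero>) \<and> T v \<and> (\<forall>g \<in> G k. T (g \<oplus> (u k \<oplus> u (k - 1)) \<oplus> v))" for k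
  proof (cases "\<bar>k\<bar> > b + 1")
    case True
    then have G0: "\<And>g. g \<in> G k \<Longrightarrow> g = \<zero>" and [simp]: "u k = \<zero>" "u (k - 1) = \<zero>"
      using b(2)[of k] u(2)[of k] u(2)[of "k - 1"] by auto
    show ?thesis by (rule bexI[of _ \<zero>]) (auto dest!: G0)
  next
    case False
    let ?G = "(\<lambda>g. g \<oplus> (u k \<oplus> u (k - 1))) ` G k"
    \<comment> \<open>Including \<open>\<zero>\<close> among the elements to be complemented forces
      \<open>T v\<close>.\<close>
    have "\<exists>v \<in> Q. T (\<zero> \<oplus> v) \<and> (\<forall>g \<in> ?G. T (g \<oplus> v))"
      by (rule common_complement) (use fin subsetD[OF FQ(2)[of k]] u g in auto)
    then show ?thesis using False plus_commute[of \<zero>] by auto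
  qed
  then obtain v where v: "\<And>k. v k \<in> Q" "\<And>k. \<bar>k\<bar> > b + 1 \<Longrightarrow> v k = \<zero>" "\<And>k. T (v k)"
    "\<And>k g. g \<in> G k \<Longrightarrow> T (g \<oplus> (u k \<oplus> u (k - 1)) \<oplus> v k)"
    by metis
  \<comment> \<open>In \<open>a k \<oplus> a (k - 1)\<close> one copy of \<open>v k\<close> corrects
    the entry and the other three summands \<open>v\<close> satisfy \<open>T\<close>. The term
    \<open>v (k + 1)\<close> accounts for the bound \<open>b + 2\<close>.\<close>
  define a where "a k = u k \<oplus> (v k \<oplus> v (k + 1))" for k
  show thesis
  proof (rule that[of a "b + 2"])
    show "a k \<in> Q" for k by (simp add: a_def u v)
    show "a k = \<zero>" if "\<bar>k\<bar> > b + 2" for k using that u(2)[of k] v(2)[of k] v(2)[of "k + 1"] by (simp add: a_def)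
    show "T (f \<oplus> a k)" if "f \<in> F k" for k f
      using T_plus[OF u(3)[OF that] T_plus[OF v(3)[of k] v(3)[of "k + 1"]]] by (simp add: a_def plus_ac)
    show "T (g \<oplus> (a k \<oplus> a (k - 1)))" if "g \<in> G k" for k g
      using T_plus[OF v(4)[OF that] T_plus[OF T_plus[OF v(3)[of k] v(3)[of "k + 1"]] v(3)[of "k - 1"]]]
      by (simp add: a_def plus_ac)
  qed
qed

end

section \<open>Isomorphism classes under direct sum\<close>

context additive_category
begin

text \<open>Collecting all direct sums avoids a choice of sum objects, and makes commutativity and
  associativity equations between arbitrary sets of objects.\<close>

definition osum :: "'a set \<Rightarrow> 'a set \<Rightarrow> 'a set" where
  "osum P Q = {E. \<exists>A \<in> P. \<exists>B \<in> Q. direct_sum C A B E}"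

definition iso_class :: "'a \<Rightarrow> 'a set" where
  "iso_class A = {B. isomorphic C A B}"

definition null_class :: "'a set" where
  "null_class = {Z. zero_object C Z}"

lemma osum_commute: "osum P Q = osum Q P"
  unfolding osum_def using direct_sum_commute by blast

lemma osum_assoc_subset: "osum (osum P Q) R \<subseteq> osum P (osum Q R)"
proof
  fix Y assume "Y \<in> osum (osum P Q) R"
  then obtain A B D X where a: "A \<in> P" "B \<in> Q" "D \<in> R" "direct_sum C A B X" "direct_sum C X D Y"
    by (auto simp: osum_def)
  obtain W where "direct_sum C B D W"
    using direct_sum_exists[OF direct_sum_Obj(2)[OF a(4)] direct_sum_Obj(2)[OF a(5)]] by blast
  moreover from this have "direct_sum C A W Y" by (rule direct_sum_assoc[OF a(4,5)])
  ultimately show "Y \<in> osum P (osum Q R)" using a by (auto simp: osum_def)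
qed

lemma osum_assoc: "osum (osum P Q) R = osum P (osum Q R)"
  using osum_assoc_subset[of P Q R] osum_assoc_subset[of R Q P] osum_commute by auto

lemma isomorphic_trans: "\<lbrakk>isomorphic C A B; isomorphic C B D\<rbrakk> \<Longrightarrow> isomorphic C A D"
  using zero_object_exists direct_sum_iso direct_sum_zero_iff by blast

lemma iso_class_osum_zero: "osum (iso_class A) null_class = iso_class A"
proof (intro equalityI subsetI)
  fix E assume "E \<in> osum (iso_class A) null_class"
  then obtain B Z where "isomorphic C A B" "zero_object C Z" "direct_sum C B Z E"
    by (auto simp: osum_def iso_class_def null_class_def)
  then show "E \<in> iso_class A" using direct_sum_zero_iff[of Z B E] isomorphic_trans[of A B E] by (simp add: iso_class_def)
next
  fix E assume E: "E \<in> iso_class A"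
  obtain Z where "zero_object C Z" using zero_object_exists by blast
  moreover from this have "direct_sum C E Z E" using direct_sum_zero E isomorphic_Obj by (auto simp: iso_class_def)
  ultimately show "E \<in> osum (iso_class A) null_class" using E by (auto simp: osum_def null_class_def)
qed

lemma iso_class_zero: "zero_object C Z \<Longrightarrow> iso_class Z = null_class"
  unfolding iso_class_def null_class_def using zero_object_isomorphic[of Z] zero_objects_isomorphic[of Z] by blast

lemma iso_class_eq_zero: "\<lbrakk>iso_class Z = null_class; Z \<in> Obj C\<rbrakk> \<Longrightarrow> zero_object C Z"
  using isomorphic_refl[of Z] by (auto simp: iso_class_def null_class_def)

lemma iso_class_direct_sum:
  assumes "direct_sum C A B E"
  shows "osum (iso_class A) (iso_class B) = iso_class E"
proof -
  \<comment> \<open>\<open>A\<close> is a sum of \<open>A'\<close> with a zero object, and that zero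
    object disappears into \<open>B\<close> by associativity.\<close>
  have *: "direct_sum C A' B E'" if "direct_sum C A B E'" "isomorphic C A A'" for A A' B E'
  proof -
    obtain Z where Z: "zero_object C Z" using zero_object_exists by blast
    have "direct_sum C A' Z A" using that(2) Z direct_sum_zero_iff isomorphic_sym by blast
    moreover have "direct_sum C Z B B" using direct_sum_commute[OF direct_sum_zero[OF direct_sum_Obj(2)[OF that(1)] Z]] .
    ultimately show ?thesis using that(1) direct_sum_assoc by blast
  qed
  show ?thesis
  proof (intro equalityI subsetI)
    fix E' assume "E' \<in> osum (iso_class A) (iso_class B)"
    then obtain A' B' where "isomorphic C A A'" "isomorphic C B B'" "direct_sum C A' B' E'"
      by (auto simp: osum_def iso_class_def)
    then have "direct_sum C A B E'" using * direct_sum_commute isomorphic_sym by meson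
    then show "E' \<in> iso_class E" using direct_sum_unique assms by (simp add: iso_class_def)
  next
    fix E' assume "E' \<in> iso_class E"
    then have "direct_sum C A B E'" using assms direct_sum_iso by (simp add: iso_class_def)
    then show "E' \<in> osum (iso_class A) (iso_class B)"
      unfolding osum_def iso_class_def
      using isomorphic_refl[OF direct_sum_Obj(1)[OF assms]] isomorphic_refl[OF direct_sum_Obj(2)[OF assms]] by blast
  qed
qed

lemma iso_class_osum_iff:
  assumes "A \<in> Obj C" "B \<in> Obj C"
  shows "E \<in> osum (iso_class A) (iso_class B) \<longleftrightarrow> direct_sum C A B E"
proof -
  obtain S where S: "direct_sum C A B S" using direct_sum_exists assms by blast
  have "E \<in> iso_class S \<longleftrightarrow> direct_sum C A B E"
    unfolding iso_class_def mem_Collect_eq by (rule iffI[OF direct_sum_iso[OF S] direct_sum_unique[OF S]])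
  then show ?thesis by (simp add: iso_class_direct_sum[OF S])
qed

end

text \<open>
  The class \<open>Q\<close> is either all of \<open>Obj C\<close> or the class of objects diagonal in a fixed direction;
  in the second case complements are required to be diagonal in this direction, too.
\<close>

locale cofinal_subclass = weakly_exact_category +
  fixes Q S
  assumes Q_Obj: "Q \<subseteq> Obj C" and S_Obj: "S \<subseteq> Obj C"
    and Q_sub: "\<lbrakk>(i, p) \<in> Ses C; Cod C i \<in> Q\<rbrakk> \<Longrightarrow> Dom C i \<in> Q"
    and Q_sum: "\<lbrakk>A \<in> Q; B \<in> Q; direct_sum C A B E\<rbrakk> \<Longrightarrow> E \<in> Q"
    and Q_zero: "zero_object C Z \<Longrightarrow> Z \<in> Q"
    and S_zero: "\<exists>Z \<in> S. zero_object C Z"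
    and S_sum: "\<lbrakk>A \<in> S; B \<in> S\<rbrakk> \<Longrightarrow> \<exists>E \<in> S. direct_sum C A B E"
    and S_cofinal: "A \<in> Q \<Longrightarrow> \<exists>U \<in> Q. \<exists>E \<in> S. direct_sum C A U E"
    and S_Ses: "\<lbrakk>(i, p) \<in> Ses C; Dom C i \<in> Q; Cod C i \<in> Q; Cod C p \<in> Q; direct_sum C (Dom C i) (Cod C p) W\<rbrakk>
      \<Longrightarrow> \<exists>U \<in> Q. (\<exists>E \<in> S. direct_sum C (Cod C i) U E) \<and> (\<exists>E \<in> S. direct_sum C W U E)"
begin

text \<open>\<open>S\<close> need not be closed under isomorphism, so a class is only asked to have
  a representative in \<open>S\<close>.\<close>

definition meets :: "'a set \<Rightarrow> bool" where
  "meets x \<longleftrightarrow> (\<exists>E \<in> S. E \<in> x)"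

lemma meets_osum_iff:
  "\<lbrakk>A \<in> Obj C; B \<in> Obj C\<rbrakk> \<Longrightarrow> meets (osum (iso_class A) (iso_class B)) \<longleftrightarrow> (\<exists>E \<in> S. direct_sum C A B E)"
  by (simp add: meets_def iso_class_osum_iff)

sublocale cofinal_monoid osum null_class "iso_class ` Q" meets
proof
  show "osum a null_class = a" if "a \<in> iso_class ` Q" for a
    using that iso_class_osum_zero by auto
  show "osum a b \<in> iso_class ` Q" if ab: "a \<in> iso_class ` Q" "b \<in> iso_class ` Q" for a b
  proof -
    obtain A B where "A \<in> Q" "B \<in> Q" "a = iso_class A" "b = iso_class B" using ab by blast
    moreover from this obtain E where "direct_sum C A B E" using direct_sum_exists Q_Obj by blast
    ultimately show ?thesis using iso_class_direct_sum Q_sum by blast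
  qed
  show "null_class \<in> iso_class ` Q"
    using zero_object_exists Q_zero iso_class_zero by blast
  show "meets null_class" using S_zero by (auto simp: meets_def null_class_def)
  show "meets (osum a b)" if "meets a" "meets b" for a b
    using that S_sum unfolding meets_def osum_def by blast
  show "\<exists>u \<in> iso_class ` Q. meets (osum a u)" if a: "a \<in> iso_class ` Q" for a
  proof -
    obtain A where "A \<in> Q" "a = iso_class A" using a by blast
    moreover from this obtain U where "U \<in> Q" "\<exists>E \<in> S. direct_sum C A U E" using S_cofinal by blast
    ultimately show ?thesis using meets_osum_iff[of A U] Q_Obj by blast
  qed
qed (fact osum_assoc osum_commute)+

abbreviation sim :: "'a \<Rightarrow> 'a \<Rightarrow> bool" where
  "sim A B \<equiv> eqv (iso_class A) (iso_class B)"

lemma sim_iff: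
  assumes "A \<in> Obj C" "B \<in> Obj C"
  shows "sim A B \<longleftrightarrow> (\<exists>U \<in> Q. (\<exists>E \<in> S. direct_sum C A U E) \<and> (\<exists>E \<in> S. direct_sum C B U E))"
proof -
  have "U \<in> Obj C" if "U \<in> Q" for U using that Q_Obj by blast
  then show ?thesis using assms by (simp add: eqv_def meets_osum_iff cong: bex_cong_simp)
qed

text \<open>The form in which extension closure is available in every dimension: in the quotient by
  \<open>S\<close>, a short exact sequence behaves as if it were split.\<close>

lemma Ses_eqv:
  assumes s: "(i, p) \<in> Ses C" and "Dom C i \<in> Q" "Cod C i \<in> Q" "Cod C p \<in> Q"
  shows "eqv (iso_class (Cod C i)) (osum (iso_class (Dom C i)) (iso_class (Cod C p)))"
proof -
  obtain W where W: "direct_sum C (Dom C i) (Cod C p) W"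
    using direct_sum_exists[of "Dom C i" "Cod C p"] assms Q_Obj by blast
  have "sim (Cod C i) W"
    using S_Ses[OF assms W] sim_iff[of "Cod C i" W] direct_sum_Obj(3)[OF W] assms(3) Q_Obj by blast
  then show ?thesis using iso_class_direct_sum[OF W] by simp
qed

lemma Ses_zero:
  assumes "(i, p) \<in> Ses C" "zero_object C (Cod C i)"
  shows "zero_object C (Dom C i)"
proof -
  have [simp]: "i \<in> Arr C" using Ses_arr[OF assms(1)] by simp
  have "i \<cdot> Idn C (Dom C i) = i" "i \<cdot> Zro C (Dom C i) (Dom C i) = Zro C (Dom C i) (Cod C i)" by simp_all
  then have "i \<cdot> Idn C (Dom C i) = i \<cdot> Zro C (Dom C i) (Dom C i)"
    using zero_object_arr(2)[OF assms(2), of i] by simp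
  then have "Idn C (Dom C i) = Zro C (Dom C i) (Dom C i)"
    by - (rule Ses_monic[OF assms(1)], simp_all del: Idn_Cmp Cmp_Zro)
  then show ?thesis by (simp add: zero_object_iff)
qed

text \<open>Closure of \<open>Q\<close> under admissible subobjects keeps the cycles in
  \<open>Q\<close>, so that their complements can be chosen in \<open>Q\<close> as well.\<close>

lemma acyclic_with_cycles:
  assumes a: "acyclic_with C X d Z m e" and X: "\<And>k. X k \<in> Q"
  shows "Z k \<in> Q" "eqv (iso_class (X k)) (osum (iso_class (Z k)) (iso_class (Z (k - 1))))"
    "zero_object C (X k) \<Longrightarrow> zero_object C (Z k)"
proof -
  note * = acyclic_withD[OF a]
  show Z: "Z k \<in> Q" for k using Q_sub[OF *(8)[of k]] X * by simp
  show "eqv (iso_class (X k)) (osum (iso_class (Z k)) (iso_class (Z (k - 1))))"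
    using Ses_eqv[OF *(8)[of k]] X Z * by simp
  show "zero_object C (X k) \<Longrightarrow> zero_object C (Z k)"
    using Ses_zero[OF *(8)[of k]] * by simp
qed

text \<open>A diagonal complement of both \<open>X\<close> and \<open>Y\<close> has one family of
  cycles, which must fit the cycles of four differentials; hence four families are treated together.
  The entries of \<open>X\<close> and \<open>Y\<close> are complemented by sums of neighbouring
  \<open>A\<close>.\<close>

lemma complement_cycles:
  assumes Q: "\<And>k. X k \<in> Q" "\<And>k. Y k \<in> Q" and sim: "\<And>k. sim (X k) (Y k)"
    and bd: "bounded_family C X" "bounded_family C Y"
    and ac: "acyclic_with C X d1 Z1 m1 e1" "acyclic_with C X d2 Z2 m2 e2"
      "acyclic_with C Y d3 Z3 m3 e3" "acyclic_with C Y d4 Z4 m4 e4"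
  obtains A where "\<And>k. A k \<in> Q" "bounded_family C A"
    "\<And>k Z. Z \<in> {Z1, Z2, Z3, Z4} \<Longrightarrow> \<exists>E \<in> S. direct_sum C (Z k) (A k) E"
    "\<And>k W U. W \<in> {X, Y} \<Longrightarrow> direct_sum C (A k) (A (k - 1)) U \<Longrightarrow> \<exists>E \<in> S. direct_sum C (W k) U E"
proof -
  obtain b1 b2 where b: "\<And>k. \<bar>k\<bar> > b1 \<Longrightarrow> zero_object C (X k)" "\<And>k. \<bar>k\<bar> > b2 \<Longrightarrow> zero_object C (Y k)"
    using bd unfolding bounded_family_def by blast
  define b where "b = max b1 b2"
  let ?Z = "{Z1, Z2, Z3, Z4}"
  have ZQ: "Z k \<in> Q" if "Z \<in> ?Z" for Z k
    using that acyclic_with_cycles(1)[OF ac(1) Q(1)] acyclic_with_cycles(1)[OF ac(2) Q(1)]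
      acyclic_with_cycles(1)[OF ac(3) Q(2)] acyclic_with_cycles(1)[OF ac(4) Q(2)] by blast
  have Zeqv: "eqv (iso_class (X k)) (osum (iso_class (Z k)) (iso_class (Z (k - 1))))" if "Z \<in> ?Z" for Z k
    using that acyclic_with_cycles(2)[OF ac(1) Q(1), of k] acyclic_with_cycles(2)[OF ac(2) Q(1), of k]
      eqv_trans[OF sim acyclic_with_cycles(2)[OF ac(3) Q(2), of k]]
      eqv_trans[OF sim acyclic_with_cycles(2)[OF ac(4) Q(2), of k]] Q(2) by blast
  have Zzero: "iso_class (Z k) = null_class" if "Z \<in> ?Z" "\<bar>k\<bar> > b" for Z k
  proof -
    have "zero_object C (X k)" "zero_object C (Y k)" using b[of k] that(2) by (simp_all add: b_def)
    then have "zero_object C (Z k)"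
      using that(1) acyclic_with_cycles(3)[OF ac(1) Q(1), of k] acyclic_with_cycles(3)[OF ac(2) Q(1), of k]
        acyclic_with_cycles(3)[OF ac(3) Q(2), of k] acyclic_with_cycles(3)[OF ac(4) Q(2), of k] by blast
    then show ?thesis by (rule iso_class_zero)
  qed
  have Zsim: "sim (Z k) (Z' k)" if "Z \<in> ?Z" "Z' \<in> ?Z" for Z Z' k
  \<comment> \<open>Below \<open>min (- b) 0\<close> every degree has absolute value greater than
    \<open>b\<close>, whatever the sign of \<open>b\<close>.\<close>
  proof (rule cycles_eqv[of "\<lambda>k. iso_class (Z k)" "\<lambda>k. iso_class (Z' k)" "min (- b) 0"])
    fix k
    show "eqv (osum (iso_class (Z k)) (iso_class (Z (k - 1)))) (osum (iso_class (Z' k)) (iso_class (Z' (k - 1))))"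
      using eqv_trans[OF eqv_sym[OF Zeqv[OF that(1)]] Zeqv[OF that(2)]] Q by blast
  qed (use that Zzero ZQ in auto)
  let ?F = "\<lambda>k. (\<lambda>Z. iso_class (Z k)) ` ?Z" and ?G = "\<lambda>k. {iso_class (X k), iso_class (Y k)}"
  obtain a b' where a: "\<And>k. a k \<in> iso_class ` Q" "\<And>k. \<bar>k\<bar> > b' \<Longrightarrow> a k = null_class"
    and aF: "\<And>k f. f \<in> ?F k \<Longrightarrow> meets (osum f (a k))"
    and aG: "\<And>k g. g \<in> ?G k \<Longrightarrow> meets (osum g (osum (a k) (a (k - 1))))"
  proof (rule complement_family[of ?F ?G b])
    show "?F k \<subseteq> iso_class ` Q" for k using ZQ by blast
    show "?G k \<subseteq> iso_class ` Q" for k using Q by blast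
    show "eqv f f'" if "f \<in> ?F k" "f' \<in> ?F k" for k f f' using that Zsim by blast
    show "eqv g (osum f f')" if f: "f \<in> ?F k" and f': "f' \<in> ?F (k - 1)" and g: "g \<in> ?G k" for k f f' g
    proof -
      obtain Z Z' where Z: "Z \<in> ?Z" "f = iso_class (Z k)" "Z' \<in> ?Z" "f' = iso_class (Z' (k - 1))"
        using f f' by blast
      have "eqv (osum (iso_class (Z k)) (iso_class (Z (k - 1)))) (osum f f')"
        unfolding Z(2,4) by (intro eqv_plus Zsim eqv_refl Z imageI ZQ)
      then have x: "eqv (iso_class (X k)) (osum f f')"
        by (rule eqv_trans[OF Zeqv[OF Z(1)]]) (intro plus_closed imageI ZQ Z(1))
      have "eqv (iso_class (Y k)) (osum f f')"
        by (rule eqv_trans[OF eqv_sym[OF sim] x imageI[OF Q(1)]])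
      with x show ?thesis using g by blast
    qed
    show "?F k \<subseteq> {null_class}" if "\<bar>k\<bar> > b" for k using that Zzero by blast
    show "?G k \<subseteq> {null_class}" if "\<bar>k\<bar> > b" for k
      using that b[of k] iso_class_zero by (auto simp: b_def)
  qed auto
  have "\<forall>k. \<exists>A \<in> Q. a k = iso_class A" using a(1) by blast
  then obtain A where A: "\<And>k. A k \<in> Q" "\<And>k. a k = iso_class (A k)" by metis
  have AO: "A k \<in> Obj C" for k using A(1) Q_Obj by blast
  show thesis
  proof (rule that[of A])
    have "zero_object C (A k)" if "\<bar>k\<bar> > b'" for k
      using a(2)[OF that] A(2) AO iso_class_eq_zero by simp
    then show "bounded_family C A" using AO unfolding bounded_family_def by blast
    show "\<exists>E \<in> S. direct_sum C (Z k) (A k) E" if "Z \<in> ?Z" for k Z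
    proof -
      have "Z k \<in> Obj C" using ZQ[OF that] Q_Obj by blast
      then show ?thesis using aF[of "iso_class (Z k)" k] that A(2) AO by (auto simp: meets_osum_iff)
    qed
    show "\<exists>E \<in> S. direct_sum C (W k) U E" if W: "W \<in> {X, Y}" and U: "direct_sum C (A k) (A (k - 1)) U" for k W U
    proof -
      have "W k \<in> Obj C" using W Q Q_Obj by blast
      then show ?thesis
        using aG[of "iso_class (W k)" k] W A(2) iso_class_direct_sum[OF U] direct_sum_Obj(3)[OF U]
        by (auto simp: meets_osum_iff)
    qed
  qed (rule A)
qed

end

section \<open>Diagonal complements and the passage to binary complexes\<close>

locale cofinal_multicomplexes = weakly_exact_multicomplexes + cofinal_subclass
begin

lemma diagonal_complement:
  assumes X: "X \<in> Bq_obj C" "\<And>k. graded X k \<in> Q" and Y: "Y \<in> Bq_obj C" "\<And>k. graded Y k \<in> Q"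
    and sim: "\<And>k. sim (graded X k) (graded Y k)"
  obtains U E E' where "U \<in> Bq_obj C" "diff1 U = diff2 U" "\<And>k. graded U k \<in> Q"
    "E \<in> Bq_obj (full_subcategory C S)" "direct_sum (Bq C) X U E"
    "E' \<in> Bq_obj (full_subcategory C S)" "direct_sum (Bq C) Y U E'"
proof -
  obtain Z1 m1 e1 Z2 m2 e2 where 1: "acyclic_with C (graded X) (diff1 X) Z1 m1 e1"
    and 2: "acyclic_with C (graded X) (diff2 X) Z2 m2 e2"
    using X(1) by (auto elim!: Bq_objE simp: acyclic_complex_iff)
  obtain Z3 m3 e3 Z4 m4 e4 where 3: "acyclic_with C (graded Y) (diff1 Y) Z3 m3 e3"
    and 4: "acyclic_with C (graded Y) (diff2 Y) Z4 m4 e4"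
    using Y(1) by (auto elim!: Bq_objE simp: acyclic_complex_iff)
  obtain A where A: "\<And>k. A k \<in> Q" "bounded_family C A"
    "\<And>k Z. Z \<in> {Z1, Z2, Z3, Z4} \<Longrightarrow> \<exists>E \<in> S. direct_sum C (Z k) (A k) E"
    "\<And>k W U. W \<in> {graded X, graded Y} \<Longrightarrow> direct_sum C (A k) (A (k - 1)) U \<Longrightarrow> \<exists>E \<in> S. direct_sum C (W k) U E"
    using complement_cycles[OF X(2) Y(2) sim Bq_objD(8)[OF X(1)] Bq_objD(8)[OF Y(1)] 1 2 3 4] by metis
  have "A k \<in> Obj C" for k using A(1) Q_Obj by blast
  then have "\<forall>k. \<exists>U i j p q. biproduct C (A k) (A (k - 1)) U i j p q"
    using direct_sum_exists by (simp add: direct_sum_def)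
  then obtain U i j p q where u: "\<And>k. biproduct C (A k) (A (k - 1)) (U k) (i k) (j k) (p k) (q k)" by metis
  let ?d = "\<lambda>k. i (k - 1) \<cdot> q k"
  have u': "direct_sum C (A k) (A (k - 1)) (U k)" for k using u unfolding direct_sum_def by blast
  obtain b where "\<And>k. \<bar>k\<bar> > b \<Longrightarrow> zero_object C (A k)" using A(2) unfolding bounded_family_def by blast
  \<comment> \<open>\<open>U k\<close> contains \<open>A (k - 1)\<close>, which widens the support
    by one.\<close>
  then have "zero_object C (U k)" if "\<bar>k\<bar> > b + 1" for k
    using that by (intro zero_object_direct_sum[OF u']) auto
  then have "bounded_family C U" unfolding bounded_family_def using direct_sum_Obj(3)[OF u'] by blast
  moreover note au = acyclic_with_biproduct[of A U i j p q, OF u]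
  ultimately have U: "Cpx U ?d ?d \<in> Bq_obj C" unfolding Cpx_Bq_obj acyclic_complex_iff by blast
  have au': "acyclic_with C (graded (Cpx U ?d ?d)) (diff1 (Cpx U ?d ?d)) A i q"
    "acyclic_with C (graded (Cpx U ?d ?d)) (diff2 (Cpx U ?d ?d)) A i q" using au by simp_all
  have "\<exists>E \<in> Bq_obj (full_subcategory C S). direct_sum (Bq C) X (Cpx U ?d ?d) E"
    by (rule Bq_direct_sum_in_subcategory[OF S_Obj X(1) U _ 1 au'(1) _ 2 au'(2)]) (use A(3,4) u' in auto)
  moreover have "\<exists>E \<in> Bq_obj (full_subcategory C S). direct_sum (Bq C) Y (Cpx U ?d ?d) E"
    by (rule Bq_direct_sum_in_subcategory[OF S_Obj Y(1) U _ 3 au'(1) _ 4 au'(2)]) (use A(3,4) u' in auto)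
  moreover have "U k \<in> Q" for k using Q_sum[OF A(1) A(1) u'] .
  ultimately show thesis using that[of "Cpx U ?d ?d"] U by auto
qed

text \<open>The induction step. With \<open>flag\<close> false, a diagonality condition on the
  entries becomes one in the next inner direction; with \<open>flag\<close> true, diagonality in the
  outermost direction is added. Both work since the complements are diagonal there and have entries
  in \<open>Q\<close>.\<close>

lemma cofinal_Bq:
  "cofinal_multicomplexes (Bq C) {X \<in> Bq_obj C. (\<forall>k. graded X k \<in> Q) \<and> (flag \<longrightarrow> diff1 X = diff2 X)}
    (Bq_obj (full_subcategory C S))" (is "cofinal_multicomplexes _ ?Q ?S")
proof -
  interpret B: weakly_exact_multicomplexes "Bq C" by (rule weakly_exact_Bq)
  have comp: "direct_sum C (graded X k) (graded Y k) (graded E k)" if "direct_sum (Bq C) X Y E" for X Y E k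
    using that biproduct_component unfolding direct_sum_def by blast
  show ?thesis
  proof (intro cofinal_multicomplexes.intro cofinal_subclass.intro cofinal_subclass_axioms.intro weakly_exact_Bq
      B.weakly_exact_category_axioms)
    show "?Q \<subseteq> Obj (Bq C)" by auto
    show "?S \<subseteq> Obj (Bq C)" using Bq_obj_full_subset[OF S_Obj] by simp
    show "Dom (Bq C) i \<in> ?Q" if s: "(i, p) \<in> Ses (Bq C)" and q: "Cod (Bq C) i \<in> ?Q" for i p
    proof -
      have i: "i \<in> Bq_arr C" using s by (simp add: Bq_Ses_iff)
      have "graded (source i) k \<in> Q" for k
        using s q Q_sub[of "component i k" "component p k"] by (auto simp: Bq_Ses_iff Bq_arrD[OF i])
      then show ?thesis using Bq_arrD(2)[OF i] diagonal_sub[OF s] q by auto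
    qed
    show "E \<in> ?Q" if "A \<in> ?Q" "B \<in> ?Q" "direct_sum (Bq C) A B E" for A B E
      using that Q_sum[OF _ _ comp[OF that(3)]] B.direct_sum_Obj(3)[OF that(3)] diagonal_direct_sum[OF that(3)] by auto
    show "Z \<in> ?Q" if Z: "zero_object (Bq C) Z" for Z
    proof -
      have ZO: "Z \<in> Bq_obj C" and "Idn (Bq C) Z = Zro (Bq C) Z Z" using Z by (auto simp: B.zero_object_iff)
      then have z: "zero_object C (graded Z k)" for k
        using Bq_objD(1)[OF ZO] by (auto simp: zero_object_iff dest: fun_cong)
      have "diff1 Z k = diff2 Z k" for k
        using zero_object_arr(1)[OF z Bq_objD(2)[OF ZO], of k k] zero_object_arr(1)[OF z Bq_objD(3)[OF ZO], of k k]
          Bq_objD(4-7)[OF ZO, of k] by simp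
      then show ?thesis using ZO Q_zero[OF z] by auto
    qed
    show "\<exists>Z \<in> ?S. zero_object (Bq C) Z"
    proof -
      obtain Z where Z: "Z \<in> S" "zero_object C Z" using S_zero by blast
      let ?Z = "Cpx (\<lambda>_. Z) (\<lambda>_. Zro C Z Z) (\<lambda>_. Zro C Z Z)"
      have ZO: "Z \<in> Obj C" "Idn C Z = Zro C Z Z" using Z(2) by (simp_all add: zero_object_iff)
      have "acyclic_with C (\<lambda>_. Z) (\<lambda>_. Zro C Z Z) (\<lambda>_. Z) (\<lambda>_. Zro C Z Z) (\<lambda>_. Zro C Z Z)"
        using acyclic_with_biproduct[of "\<lambda>_. Z" "\<lambda>_. Z" "\<lambda>_. Idn C Z" "\<lambda>_. Zro C Z Z" "\<lambda>_. Idn C Z" "\<lambda>_. Zro C Z Z",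
          OF biproduct_zero[OF ZO(1) Z(2)]] ZO by simp
      moreover have "bounded_family C (\<lambda>_. Z)" using Z ZO by (simp add: bounded_family_def)
      ultimately have "?Z \<in> ?S" using Z(1) unfolding Bq_obj_full_subcategory[OF S_Obj] by blast
      then show ?thesis using Bq_zero_object[OF zero_complex[OF Z(2)]] Z(2) by auto
    qed
    show "\<exists>E \<in> ?S. direct_sum (Bq C) A B E" if "A \<in> ?S" "B \<in> ?S" for A B
    proof -
      have AB: "A \<in> Bq_obj C" "B \<in> Bq_obj C" using that Bq_obj_full_subset[OF S_Obj] by blast+
      obtain Z1 m1 e1 Z2 m2 e2 where "acyclic_with C (graded A) (diff1 A) Z1 m1 e1" "\<And>k. Z1 k \<in> S"
        "acyclic_with C (graded A) (diff2 A) Z2 m2 e2" "\<And>k. Z2 k \<in> S"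
        using \<open>A \<in> ?S\<close> unfolding Bq_obj_full_subcategory[OF S_Obj] by auto
      moreover obtain Z3 m3 e3 Z4 m4 e4 where "acyclic_with C (graded B) (diff1 B) Z3 m3 e3" "\<And>k. Z3 k \<in> S"
        "acyclic_with C (graded B) (diff2 B) Z4 m4 e4" "\<And>k. Z4 k \<in> S"
        using \<open>B \<in> ?S\<close> unfolding Bq_obj_full_subcategory[OF S_Obj] by auto
      moreover have "graded A k \<in> S" "graded B k \<in> S" for k
        using that Bq_obj_full_graded[OF S_Obj] by blast+
      ultimately show ?thesis
        using Bq_direct_sum_in_subcategory[OF S_Obj AB, of Z1 m1 e1 Z3 m3 e3 Z2 m2 e2 Z4 m4 e4] S_sum by blast
    qed
    show "\<exists>U \<in> ?Q. \<exists>E \<in> ?S. direct_sum (Bq C) A U E" if "A \<in> ?Q" for A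
    proof -
      have A: "A \<in> Bq_obj C" "\<And>k. graded A k \<in> Q" using that by auto
      show ?thesis
      proof (rule diagonal_complement[OF A A])
        show "sim (graded A k) (graded A k)" for k using A(2) by (intro eqv_refl imageI)
        fix U E E' assume "U \<in> Bq_obj C" "diff1 U = diff2 U" "\<And>k. graded U k \<in> Q"
          "E \<in> ?S" "direct_sum (Bq C) A U E" "E' \<in> ?S" "direct_sum (Bq C) A U E'"
        then show ?thesis by (intro bexI[of _ U] bexI[of _ E]) auto
      qed
    qed
    show "\<exists>U \<in> ?Q. (\<exists>E \<in> ?S. direct_sum (Bq C) (Cod (Bq C) i) U E) \<and> (\<exists>E \<in> ?S. direct_sum (Bq C) W U E)"
      if s: "(i, p) \<in> Ses (Bq C)" and q: "Dom (Bq C) i \<in> ?Q" "Cod (Bq C) i \<in> ?Q" "Cod (Bq C) p \<in> ?Q"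
        and W: "direct_sum (Bq C) (Dom (Bq C) i) (Cod (Bq C) p) W" for i p W
    proof -
      have i: "i \<in> Bq_arr C" and p: "p \<in> Bq_arr C" and c: "\<And>k. (component i k, component p k) \<in> Ses C"
        using s by (auto simp: Bq_Ses_iff)
      have 1: "target i \<in> Bq_obj C" "\<And>k. graded (target i) k \<in> Q" using q by auto
      have 2: "W \<in> Bq_obj C" "\<And>k. graded W k \<in> Q"
        using B.direct_sum_Obj(3)[OF W] Q_sum[OF _ _ comp[OF W]] q by auto
      \<comment> \<open>\<open>Ses_eqv\<close> in each degree makes the middle term and the split
        extension termwise equivalent, so a single diagonal complement serves both.\<close>
      have "sim (graded (target i) k) (graded W k)" for k
        using Ses_eqv[OF c, of k] iso_class_direct_sum[OF comp[OF W], of k] q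
        by (simp add: Bq_arrD[OF i] Bq_arrD[OF p])
      then show ?thesis
      proof (rule diagonal_complement[OF 1 2])
        fix U E E' assume "U \<in> Bq_obj C" "diff1 U = diff2 U" "\<And>k. graded U k \<in> Q"
          "E \<in> ?S" "direct_sum (Bq C) (target i) U E" "E' \<in> ?S" "direct_sum (Bq C) W U E'"
        then show ?thesis by (intro bexI[of _ U] conjI bexI[of _ E] bexI[of _ E']) auto
      qed
    qed
  qed
qed

end

text \<open>Complement the outer terms by \<open>U1\<close> and \<open>U2\<close> and add the split
  sequence on these: the outer terms are now in \<open>M\<close>, so the new middle term is
  isomorphic to an object of \<open>M\<close> by extension closure. Rearranging summands shows that
  \<open>U\<close>, the sum of \<open>U1\<close> and \<open>U2\<close>, also complements
  \<open>W\<close>.\<close>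

lemma (in exact_category) cofinal_exact_subcategory:
  assumes M: "exact_subcategory M C" and cof: "cofinal_subcategory M C"
  shows "cofinal_subclass C (Obj C) (Obj M)"
proof -
  interpret W: weakly_exact_category C by (rule weakly_exact)
  have MC: "Obj M \<subseteq> Obj C"
    and ext: "\<And>i p. (i, p) \<in> Ses C \<Longrightarrow> Dom C i \<in> Obj M \<Longrightarrow> Cod C p \<in> Obj M \<Longrightarrow> \<exists>E \<in> Obj M. isomorphic C (Cod C i) E"
    and sum: "\<And>A B. A \<in> Obj M \<Longrightarrow> B \<in> Obj M \<Longrightarrow> \<exists>S \<in> Obj M. direct_sum C A B S"
    and zero: "\<exists>Z \<in> Obj M. zero_object C Z"
    using M unfolding exact_subcategory_def by blast+
  have compl: "\<exists>U \<in> Obj C. \<exists>E \<in> Obj M. direct_sum C A U E" if "A \<in> Obj C" for A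
    using cof that direct_sum_iso unfolding cofinal_subcategory_def by meson
  show ?thesis
  proof (intro cofinal_subclass.intro cofinal_subclass_axioms.intro weakly_exact)
    show "\<exists>U \<in> Obj C. (\<exists>E \<in> Obj M. direct_sum C (Cod C i) U E) \<and> (\<exists>E \<in> Obj M. direct_sum C W U E)"
      if s: "(i, p) \<in> Ses C" and W: "direct_sum C (Dom C i) (Cod C p) W" for i p W
    proof -
      note [simp] = Ses_simps[OF s]
      obtain U1 A where U1: "U1 \<in> Obj C" "A \<in> Obj M" "direct_sum C (Dom C i) U1 A" using compl[of "Dom C i"] by auto
      obtain U2 B where U2: "U2 \<in> Obj C" "B \<in> Obj M" "direct_sum C (Cod C p) U2 B" using compl[of "Cod C p"] by auto
      obtain U where U: "direct_sum C U1 U2 U" using direct_sum_exists U1 U2 by blast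
      have UO: "U \<in> Obj C" using direct_sum_Obj(3)[OF U] .
      obtain X where X: "direct_sum C (Cod C i) U X" using direct_sum_exists[of "Cod C i" U] UO by auto
      obtain i' j' p' q' where bU: "biproduct C U1 U2 U i' j' p' q'" using U by (auto simp: direct_sum_def)
      note bUD [simp] = biproductD[OF bU]
      obtain i1 j1 p1 q1 where b1: "biproduct C (Dom C i) (Dom C i') A i1 j1 p1 q1"
        using U1(3) by (auto simp: direct_sum_def)
      obtain i2 j2 p2 q2 where b2: "biproduct C (Cod C i) (Cod C i') X i2 j2 p2 q2"
        using X by (auto simp: direct_sum_def)
      obtain i3 j3 p3 q3 where b3: "biproduct C (Cod C p) (Cod C q') B i3 j3 p3 q3"
        using U2(3) by (auto simp: direct_sum_def)
      have "\<exists>E \<in> Obj M. isomorphic C X E"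
        using ext[OF Ses_block[OF s W.Ses_biproduct[OF bU] b1 b2 b3]] U1(2) U2(2)
          block_simps[OF b1 b2, of i i'] block_simps[OF b2 b3, of p q'] by simp
      then obtain E where "E \<in> Obj M" "direct_sum C (Cod C i) U E" using X direct_sum_iso by blast
      moreover have "\<exists>E \<in> Obj M. direct_sum C W U E"
      proof -
        obtain E where E: "E \<in> Obj M" "direct_sum C A B E" using sum U1(2) U2(2) by blast
        have AB: "A \<in> Obj C" "B \<in> Obj C" using direct_sum_Obj E(2) by blast+
        have "E \<in> osum (iso_class A) (iso_class B)" using iso_class_osum_iff[OF AB] E(2) by simp
        also have "osum (iso_class A) (iso_class B) = osum (iso_class W) (iso_class U)"
          unfolding iso_class_direct_sum[OF U1(3), symmetric] iso_class_direct_sum[OF U2(3), symmetric]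
            iso_class_direct_sum[OF W, symmetric] iso_class_direct_sum[OF U, symmetric]
          by (metis osum_assoc osum_commute)
        finally show ?thesis using E(1) iso_class_osum_iff[OF direct_sum_Obj(3)[OF W] UO] by blast
      qed
      ultimately show ?thesis using UO by blast
    qed
    show "Dom C i \<in> Obj C" if "(i, p) \<in> Ses C" for i p using that by simp
    show "E \<in> Obj C" if "direct_sum C A B E" for A B E using direct_sum_Obj(3)[OF that] .
    show "Z \<in> Obj C" if "zero_object C Z" for Z using that by (simp add: zero_object_iff)
  qed (fact MC zero sum compl subset_refl)+
qed

lemma base_direct_sum: "direct_sum (base_category N) (Base A) (Base B) (Base E) \<longleftrightarrow> direct_sum N A B E"
proof
  assume "direct_sum (base_category N) (Base A) (Base B) (Base E)"
  then obtain i j p q where "biproduct (base_category N) (Base A) (Base B) (Base E) i j p q"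
    by (auto simp: direct_sum_def)
  then show "direct_sum N A B E" by (elim base_biproductE) (auto simp: direct_sum_def)
next
  assume "direct_sum N A B E"
  then obtain i j p q where "biproduct N A B E i j p q" by (auto simp: direct_sum_def)
  then have "biproduct (base_category N) (Base A) (Base B) (Base E) (BaseArr i) (BaseArr j) (BaseArr p) (BaseArr q)"
    by simp
  then show "direct_sum (base_category N) (Base A) (Base B) (Base E)" unfolding direct_sum_def by blast
qed

lemma cofinal_base_category:
  assumes "cofinal_subclass N (Obj N) S"
  shows "cofinal_multicomplexes (base_category N) (Obj (base_category N)) (Base ` S)"
proof -
  interpret cofinal_subclass N "Obj N" S by fact
  interpret B: weakly_exact_category "base_category N" by (rule weakly_exact_base)
  let ?B = "base_category N"
  have ds: "(\<exists>E \<in> Base ` S. direct_sum ?B (Base A) (Base B) E) \<longleftrightarrow> (\<exists>E \<in> S. direct_sum N A B E)" for A B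
    by (simp add: base_direct_sum)
  show ?thesis
  proof (intro cofinal_multicomplexes.intro weakly_exact_multicomplexes.intro weakly_exact_base
      cofinal_subclass.intro cofinal_subclass_axioms.intro)
    show "Base ` S \<subseteq> Obj ?B" using S_Obj by auto
    show "Dom ?B i \<in> Obj ?B" if "(i, p) \<in> Ses ?B" for i p using B.Ses_arr[OF that] by (simp del: base_category_simps)
    show "E \<in> Obj ?B" if "direct_sum ?B A B E" for A B E using B.direct_sum_Obj(3)[OF that] .
    show "Z \<in> Obj ?B" if "zero_object ?B Z" for Z using that by (simp add: B.zero_object_iff)
    show "\<exists>Z \<in> Base ` S. zero_object ?B Z" using S_zero by (simp add: base_zero_object)
    show "\<exists>E \<in> Base ` S. direct_sum ?B A B E" if AB: "A \<in> Base ` S" "B \<in> Base ` S" for A B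
    proof -
      obtain A' B' where "A = Base A'" "B = Base B'" "A' \<in> S" "B' \<in> S" using AB by blast
      then show ?thesis using S_sum ds by simp
    qed
    show "\<exists>U \<in> Obj ?B. \<exists>E \<in> Base ` S. direct_sum ?B A U E" if A: "A \<in> Obj ?B" for A
    proof -
      obtain A' where "A = Base A'" "A' \<in> Obj N" using A by auto
      moreover from this obtain U where "U \<in> Obj N" "\<exists>E \<in> S. direct_sum N A' U E" using S_cofinal by blast
      ultimately show ?thesis by (auto simp: base_direct_sum)
    qed
    show "\<exists>U \<in> Obj ?B. (\<exists>E \<in> Base ` S. direct_sum ?B (Cod ?B i) U E) \<and> (\<exists>E \<in> Base ` S. direct_sum ?B W U E)"
      if s: "(i, p) \<in> Ses ?B" and W: "direct_sum ?B (Dom ?B i) (Cod ?B p) W" for i p W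
    proof -
      obtain i' p' where ip: "i = BaseArr i'" "p = BaseArr p'" "(i', p') \<in> Ses N" using s by (rule base_SesE)
      obtain W' where W': "W = Base W'" using B.direct_sum_Obj(3)[OF W] by auto
      have "direct_sum N (Dom N i') (Cod N p') W'" using W unfolding ip W' by (simp add: base_direct_sum)
      moreover have "Dom N i' \<in> Obj N" "Cod N i' \<in> Obj N" "Cod N p' \<in> Obj N" using Ses_arr[OF ip(3)] by auto
      ultimately obtain U where "U \<in> Obj N" "\<exists>E \<in> S. direct_sum N (Cod N i') U E" "\<exists>E \<in> S. direct_sum N W' U E"
        using S_Ses[OF ip(3)] by blast
      then show ?thesis unfolding ip W' by (auto simp: base_direct_sum)
    qed
  qed simp_all
qed

section \<open>Multicomplexes of arbitrary dimension\<close>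

lemma Bq_iter_simps: "Bq_iter 0 N = base_category N" "Bq_iter (Suc n) N = Bq (Bq_iter n N)"
  by (simp_all add: Bq_iter_def)

text \<open>The parts are proved together because each step needs the subcategory to be full below.
  Direction 0 arises from all objects and the flag, direction \<open>Suc j\<close> from entries
  diagonal in direction \<open>j\<close>.\<close>

lemma cofinal_Bq_iter:
  assumes N: "exact_category N" and M: "exact_subcategory M N" and cof: "cofinal_subcategory M N"
  shows "cofinal_multicomplexes (Bq_iter n N) (Obj (Bq_iter n N)) (Obj (Bq_iter n M)) \<and>
    Bq_iter n M = full_subcategory (Bq_iter n N) (Obj (Bq_iter n M)) \<and>
    (\<forall>i < n. cofinal_multicomplexes (Bq_iter n N) {X \<in> Obj (Bq_iter n N). diagonal_in i X} (Obj (Bq_iter n M)))"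
proof (induction n)
  case 0
  have "Obj M \<subseteq> Obj N" and *: "M = full_subcategory N (Obj M)" using M unfolding exact_subcategory_def by blast+
  then have "base_category M = full_subcategory (base_category N) (Base ` Obj M)"
    using base_category_full_subcategory by metis
  then show ?case
    using cofinal_base_category[OF exact_category.cofinal_exact_subcategory[OF N M cof]]
    by (simp add: Bq_iter_simps)
next
  case (Suc n)
  let ?C = "Bq_iter n N" and ?S = "Obj (Bq_iter n M)"
  have IH: "cofinal_multicomplexes ?C (Obj ?C) ?S" "Bq_iter n M = full_subcategory ?C ?S"
    "\<And>i. i < n \<Longrightarrow> cofinal_multicomplexes ?C {X \<in> Obj ?C. diagonal_in i X} ?S"
    using Suc by blast+
  interpret cofinal_multicomplexes ?C "Obj ?C" ?S by (rule IH)
  have O: "Obj (Bq_iter (Suc n) M) = Bq_obj (full_subcategory ?C ?S)"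
    using IH(2) by (metis Bq_iter_simps(2) Bq_simps(1))
  have gr: "graded X k \<in> Obj ?C" if "X \<in> Bq_obj ?C" for X k using that by (rule Bq_objD)
  have "cofinal_multicomplexes (Bq_iter (Suc n) N) (Obj (Bq_iter (Suc n) N)) (Obj (Bq_iter (Suc n) M))"
    using cofinal_Bq[of False] unfolding O by (simp add: Bq_iter_simps gr cong: conj_cong)
  moreover have "Bq_iter (Suc n) M = full_subcategory (Bq_iter (Suc n) N) (Obj (Bq_iter (Suc n) M))"
    unfolding O using Bq_full_subcategory[OF S_Obj] IH(2) by (metis Bq_iter_simps(2))
  moreover have "cofinal_multicomplexes (Bq_iter (Suc n) N) {X \<in> Obj (Bq_iter (Suc n) N). diagonal_in i X}
      (Obj (Bq_iter (Suc n) M))" if "i < Suc n" for i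
  proof (cases i)
    case 0
    then show ?thesis
      using cofinal_Bq[of True] unfolding O by (simp add: Bq_iter_simps gr cong: conj_cong)
  next
    case (Suc j)
    then have "j < n" using that by simp
    have "{X \<in> Bq_obj ?C. (\<forall>k. graded X k \<in> {X \<in> Obj ?C. diagonal_in j X}) \<and> (False \<longrightarrow> diff1 X = diff2 X)}
        = {X \<in> Bq_obj ?C. diagonal_in i X}"
      using gr Suc by auto
    then show ?thesis
      using cofinal_multicomplexes.cofinal_Bq[OF IH(3)[OF \<open>j < n\<close>], of False] unfolding O by (simp add: Bq_iter_simps)
  qed
  ultimately show ?case by blast
qed


section \<open>Relations between classes\<close>

text \<open>The generated subgroup, built by adding or subtracting one generator at a time; this
  matches the later inductions over the relators of a relation.\<close>

inductive_set addspan :: "'a::ab_group_add set \<Rightarrow> 'a set" for R where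
  zero: "0 \<in> addspan R"
| plus: "\<lbrakk>x \<in> addspan R; r \<in> R\<rbrakk> \<Longrightarrow> x + r \<in> addspan R"
| minus: "\<lbrakk>x \<in> addspan R; r \<in> R\<rbrakk> \<Longrightarrow> x - r \<in> addspan R"

lemma addspan_base: "r \<in> R \<Longrightarrow> r \<in> addspan R"
  using addspan.plus[OF addspan.zero] by fastforce

lemma addspan_add:
  assumes "x \<in> addspan R" "y \<in> addspan R"
  shows "x + y \<in> addspan R"
  using assms(2)
proof induction
  case (plus y r)
  then show ?case using addspan.plus[of "x + y" R r] by (simp add: add.assoc)
next
  case (minus y r)
  then show ?case using addspan.minus[of "x + y" R r] by (simp add: add_diff_eq)
qed (simp add: assms(1))

lemma addspan_uminus: "x \<in> addspan R \<Longrightarrow> - x \<in> addspan R"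
proof (induction rule: addspan.induct)
  case (plus x r)
  then show ?case using addspan.minus[of "- x" R r] by simp
next
  case (minus x r)
  then show ?case using addspan.plus[of "- x" R r] by simp
qed (simp add: addspan.zero)

lemma addspan_diff: "\<lbrakk>x \<in> addspan R; y \<in> addspan R\<rbrakk> \<Longrightarrow> x - y \<in> addspan R"
  using addspan_add[of x R "- y"] addspan_uminus[of y R] by simp

lemma addspan_subset:
  assumes "R \<subseteq> addspan R'"
  shows "addspan R \<subseteq> addspan R'"
proof
  fix x assume "x \<in> addspan R"
  then show "x \<in> addspan R'"
    by induction (use assms in \<open>auto intro: addspan.zero addspan_add addspan_diff\<close>)
qed

lemma addspan_mono: "R \<subseteq> R' \<Longrightarrow> addspan R \<subseteq> addspan R'"
  by (intro addspan_subset) (auto intro: addspan_base)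

lemma addspan_frag_of: "addspan (frag_of ` A) = {x. Poly_Mapping.keys x \<subseteq> A}"
proof (intro equalityI subsetI)
  fix x :: "'a \<Rightarrow>\<^sub>0 int" assume "x \<in> addspan (frag_of ` A)"
  then show "x \<in> {x. Poly_Mapping.keys x \<subseteq> A}"
    by induction (use keys_add keys_diff in \<open>fastforce simp: keys_frag_of\<close>)+
next
  fix x :: "'a \<Rightarrow>\<^sub>0 int" assume "x \<in> {x. Poly_Mapping.keys x \<subseteq> A}"
  then have "Poly_Mapping.keys x \<subseteq> A" by simp
  then show "x \<in> addspan (frag_of ` A)"
    by (induction rule: frag_induction) (auto intro: addspan.zero addspan_base addspan_diff)
qed

lemma generate_free_Abelian_group:
  assumes "R \<subseteq> carrier (free_Abelian_group A)"
  shows "generate (free_Abelian_group A) R = addspan R"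
proof (intro equalityI subsetI)
  fix x assume "x \<in> generate (free_Abelian_group A) R"
  then show "x \<in> addspan R"
  proof induction
    case (inv h)
    then have "inv\<^bsub>free_Abelian_group A\<^esub> h = - h" using assms by auto
    then show ?case using addspan_uminus[OF addspan_base[OF inv]] by simp
  qed (simp_all add: addspan.zero addspan_base addspan_add)
next
  fix x assume "x \<in> addspan R"
  then show "x \<in> generate (free_Abelian_group A) R"
  proof induction
    case zero
    then show ?case using generate.one[of "free_Abelian_group A" R] by simp
  next
    case (plus x r)
    then show ?case using generate.eng[OF plus(3) generate.incl[OF plus(2)]] by simp
  next
    case (minus x r)
    then have "inv\<^bsub>free_Abelian_group A\<^esub> r = - r" using assms by auto
    then show ?case using generate.eng[OF minus(3) generate.inv[OF minus(2)]] by simp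
  qed
qed

definition frag_sum :: "'a multiset \<Rightarrow> 'a \<Rightarrow>\<^sub>0 int" where
  "frag_sum P = (\<Sum>A\<in>#P. frag_of A)"

lemma frag_sum_simps [simp]:
  "frag_sum {#} = 0" "frag_sum (add_mset A P) = frag_of A + frag_sum P" "frag_sum (P + Q) = frag_sum P + frag_sum Q"
  by (simp_all add: frag_sum_def)

lemma lookup_frag_sum: "Poly_Mapping.lookup (frag_sum P) x = int (count P x)"
  by (induction P) (auto simp: lookup_add)

text \<open>Turns an equation between formal differences into an equality of multisets, on which
  evaluation in the monoid of classes is defined.\<close>

lemma frag_sum_inject: "frag_sum P = frag_sum Q \<Longrightarrow> P = Q"
  by (rule multiset_eqI) (metis lookup_frag_sum of_nat_eq_iff)

lemma frag_sum_exists: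
  assumes "Poly_Mapping.keys x \<subseteq> A"
  shows "\<exists>P Q. set_mset P \<subseteq> A \<and> set_mset Q \<subseteq> A \<and> x = frag_sum P - frag_sum Q"
  using assms
proof (induction rule: frag_induction)
  case zero
  then show ?case by (intro exI[of _ "{#}"]) simp
next
  case (one x)
  then show ?case by (intro exI[of _ "{#x#}"] exI[of _ "{#}"]) simp
next
  case (diff a b)
  then obtain P Q P' Q' where "set_mset P \<subseteq> A" "set_mset Q \<subseteq> A" "a = frag_sum P - frag_sum Q"
    "set_mset P' \<subseteq> A" "set_mset Q' \<subseteq> A" "b = frag_sum P' - frag_sum Q'" by blast
  then show ?case by (intro exI[of _ "P + Q'"] exI[of _ "Q + P'"]) simp
qed

section \<open>Grothendieck groups of a cofinal pair\<close>

definition ses_relators :: "('o, 'm) excat \<Rightarrow> ('o \<Rightarrow>\<^sub>0 int) set" where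
  "ses_relators C = {frag_of (Dom C i) + frag_of (Cod C p) - frag_of (Cod C i) | i p. (i, p) \<in> Ses C}"

lemma ses_relatorI: "(i, p) \<in> Ses C \<Longrightarrow> Dom C i = A \<Longrightarrow> Cod C i = E \<Longrightarrow> Cod C p = B \<Longrightarrow>
    frag_of A + frag_of B - frag_of E \<in> ses_relators C"
  by (auto simp: ses_relators_def)

text \<open>Here relations come from short exact sequences alone, so this is the theory of
  Grothendieck groups, applied to multicomplexes of every dimension. Diagonal relators are dealt
  with separately.\<close>

locale cofinal_category = cofinal_subclass C "Obj C" S for C :: "('o, 'm) excat" (structure) and S
begin

abbreviation relM :: "('o \<Rightarrow>\<^sub>0 int) set" where
  "relM \<equiv> addspan (ses_relators (full_subcategory C S))"

abbreviation relN :: "('o \<Rightarrow>\<^sub>0 int) set" where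
  "relN \<equiv> addspan (ses_relators C)"

lemma direct_sum_relN: "direct_sum C A B E \<Longrightarrow> frag_of A + frag_of B - frag_of E \<in> relN"
  unfolding direct_sum_def
  by (auto intro!: addspan_base ses_relatorI[OF Ses_biproduct] simp: biproductD)

lemma direct_sum_relM:
  assumes "direct_sum C A B E" "A \<in> S" "B \<in> S" "E \<in> S"
  shows "frag_of A + frag_of B - frag_of E \<in> relM"
proof -
  obtain i j p q where b: "biproduct C A B E i j p q" using assms(1) by (auto simp: direct_sum_def)
  show ?thesis
    by (rule addspan_base, rule ses_relatorI[of i q]) (use Ses_biproduct[OF b] assms in \<open>simp_all add: biproductD[OF b]\<close>)
qed

definition class_sum :: "'o multiset \<Rightarrow> 'o set" where
  "class_sum P = fold_mset osum null_class (image_mset iso_class P)"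

lemma class_sum_simps [simp]:
  "class_sum {#} = null_class" "class_sum (add_mset A P) = osum (iso_class A) (class_sum P)"
proof -
  interpret comp_fun_commute osum by standard (auto simp: fun_eq_iff plus_left_commute)
  show "class_sum {#} = null_class" "class_sum (add_mset A P) = osum (iso_class A) (class_sum P)"
    by (simp_all add: class_sum_def)
qed

lemma class_sum_closed: "set_mset P \<subseteq> Obj C \<Longrightarrow> class_sum P \<in> iso_class ` Obj C"
  by (induction P) (simp_all del: image_iff)

lemma class_sum_union:
  assumes "set_mset Q \<subseteq> Obj C"
  shows "class_sum (P + Q) = osum (class_sum P) (class_sum Q)"
proof (induction P)
  case empty
  then show ?case using plus_zero[OF class_sum_closed[OF assms]] plus_commute by simp
next
  case (add A P)
  then show ?case by (simp add: plus_assoc)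
qed

text \<open>Refines \<open>eqv\<close>: the complemented objects of \<open>S\<close> must also have
  equal classes modulo \<open>R\<close>. For \<open>R = UNIV\<close> this is the quotient by
  \<open>S\<close>; for the relators of the subcategory it records an equality in its Grothendieck
  group. One induction serves both purposes.\<close>

definition equiv_mod :: "('o \<Rightarrow>\<^sub>0 int) set \<Rightarrow> 'o set \<Rightarrow> 'o set \<Rightarrow> bool" where
  "equiv_mod R a b \<longleftrightarrow> (\<exists>u \<in> iso_class ` Obj C. \<exists>E \<in> S. \<exists>E' \<in> S. E \<in> osum a u \<and> E' \<in> osum b u \<and>
     frag_of E - frag_of E' \<in> addspan R)"

lemma equiv_mod_UNIV: "equiv_mod UNIV a b \<longleftrightarrow> eqv a b"
proof -
  have "x \<in> addspan UNIV" for x :: "'o \<Rightarrow>\<^sub>0 int" by (simp add: addspan_base)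
  then show ?thesis by (auto simp: equiv_mod_def eqv_def meets_def)
qed

lemma equiv_mod_refl:
  assumes "a \<in> iso_class ` Obj C"
  shows "equiv_mod R a a"
proof -
  obtain u where u: "u \<in> iso_class ` Obj C" "meets (osum a u)" using cofinal[OF assms] by blast
  then obtain E where "E \<in> S" "E \<in> osum a u" by (auto simp: meets_def)
  then show ?thesis unfolding equiv_mod_def
    using u(1) addspan.zero[of R] by (intro bexI[of _ u] bexI[of _ E]) simp_all
qed

lemma equiv_mod_sym: "equiv_mod R a b \<Longrightarrow> equiv_mod R b a"
  unfolding equiv_mod_def by (metis addspan_uminus minus_diff_eq)

lemma osum_member:
  assumes "E \<in> osum a u" "E' \<in> osum b v" "direct_sum C E E' F"
  shows "F \<in> osum (osum a b) (osum u v)"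
proof -
  have "F \<in> osum (osum a u) (osum b v)" using assms unfolding osum_def[of "osum a u"] by blast
  then show ?thesis by (simp add: plus_ac)
qed

text \<open>Since \<open>R\<close> contains the relators of the subcategory, direct sums inside
  \<open>S\<close> are additive modulo \<open>R\<close>.\<close>

lemma equiv_mod_plus:
  assumes R: "ses_relators (full_subcategory C S) \<subseteq> R" and "equiv_mod R a b" "equiv_mod R c d"
  shows "equiv_mod R (osum a c) (osum b d)"
proof -
  obtain u E1 E2 where u: "u \<in> iso_class ` Obj C" "E1 \<in> S" "E2 \<in> S" "E1 \<in> osum a u" "E2 \<in> osum b u"
    "frag_of E1 - frag_of E2 \<in> addspan R" using assms(2) unfolding equiv_mod_def by blast
  obtain v E3 E4 where v: "v \<in> iso_class ` Obj C" "E3 \<in> S" "E4 \<in> S" "E3 \<in> osum c v" "E4 \<in> osum d v"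
    "frag_of E3 - frag_of E4 \<in> addspan R" using assms(3) unfolding equiv_mod_def by blast
  obtain E where E: "E \<in> S" "direct_sum C E1 E3 E" using S_sum u v by blast
  obtain E' where E': "E' \<in> S" "direct_sum C E2 E4 E'" using S_sum u v by blast
  have e: "frag_of E1 + frag_of E3 - frag_of E \<in> addspan R" "frag_of E2 + frag_of E4 - frag_of E' \<in> addspan R"
    using direct_sum_relM E E' u v addspan_mono[OF R] by blast+
  have "frag_of E - frag_of E' \<in> addspan R"
    using addspan_diff[OF addspan_add[OF addspan_add[OF u(6) v(6)] e(2)] e(1)] by simp
  moreover have "E \<in> osum (osum a c) (osum u v)" "E' \<in> osum (osum b d) (osum u v)"
    using osum_member u v E E' by blast+
  ultimately show ?thesis unfolding equiv_mod_def using plus_closed[OF u(1) v(1)] E E' by blast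
qed

lemma equiv_mod_cancel:
  assumes R: "ses_relators (full_subcategory C S) \<subseteq> R" and "equiv_mod R (osum a c) (osum b d)" "equiv_mod R d c"
    and cd: "c \<in> iso_class ` Obj C" "d \<in> iso_class ` Obj C"
  shows "equiv_mod R a b"
proof -
  have "equiv_mod R (osum (osum a c) d) (osum (osum b d) c)" by (rule equiv_mod_plus[OF R assms(2,3)])
  then obtain u E1 E2 where u: "u \<in> iso_class ` Obj C" "E1 \<in> S" "E2 \<in> S"
    "E1 \<in> osum (osum (osum a c) d) u" "E2 \<in> osum (osum (osum b d) c) u" "frag_of E1 - frag_of E2 \<in> addspan R"
    unfolding equiv_mod_def by blast
  moreover have "osum (osum (osum a c) d) u = osum a (osum (osum c d) u)"
    "osum (osum (osum b d) c) u = osum b (osum (osum c d) u)" by (simp_all add: plus_ac)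
  ultimately show ?thesis unfolding equiv_mod_def using plus_closed[OF plus_closed[OF cd] u(1)]
    by (intro bexI[of _ "osum (osum c d) u"] bexI[of _ E1] bexI[of _ E2]) simp_all
qed

text \<open>Adding a split sequence on suitable \<open>U\<close>, \<open>V\<close> moves all three
  terms into \<open>S\<close>, and the result is a relator of the subcategory. The difficulty is to
  complement the outer terms and the middle term at once.\<close>

lemma equiv_mod_Ses:
  assumes R: "ses_relators (full_subcategory C S) \<subseteq> R" and s: "(i, p) \<in> Ses C"
  shows "equiv_mod R (osum (iso_class (Dom C i)) (iso_class (Cod C p))) (iso_class (Cod C i))"
proof -
  have O: "Dom C i \<in> Obj C" "Cod C i \<in> Obj C" "Cod C p \<in> Obj C" using Ses_arr[OF s] by simp_all
  let ?a = "iso_class (Dom C i)" and ?b = "iso_class (Cod C p)" and ?e = "iso_class (Cod C i)"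
  have c: "?a \<in> iso_class ` Obj C" "?b \<in> iso_class ` Obj C" "?e \<in> iso_class ` Obj C" using O by blast+
  obtain u' v where u': "u' \<in> iso_class ` Obj C" "meets (osum ?a u')" and v: "v \<in> iso_class ` Obj C" "meets (osum ?b v)"
    using cofinal c by meson
  have "eqv (osum ?e (osum u' v)) (osum (osum ?a ?b) (osum u' v))"
    by (rule eqv_plus[OF Ses_eqv[OF s O] eqv_refl]) (simp add: u' v del: image_iff)
  moreover have "osum (osum ?a ?b) (osum u' v) = osum (osum ?a u') (osum ?b v)" by (simp add: plus_ac)
  moreover have "eqv (osum (osum ?a u') (osum ?b v)) null_class"
    by (rule T_eqv_zero[OF T_plus[OF u'(2) v(2)]]) (intro plus_closed u' v c)
  ultimately have "eqv (osum ?e (osum u' v)) null_class"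
    using eqv_trans u' v c plus_closed by metis
  \<comment> \<open>The last condition says that \<open>x\<close> itself meets \<open>S\<close>;
    enlarging \<open>u'\<close> by \<open>x\<close> therefore repairs the middle term without
    spoiling the left one.\<close>
  then obtain x where x: "x \<in> iso_class ` Obj C" "meets (osum (osum ?e (osum u' v)) x)" "meets (osum null_class x)"
    unfolding eqv_def by blast
  have xm: "meets x" using x(3) plus_zero[OF x(1)] plus_commute[of x] by simp
  define u where "u = osum u' x"
  have u: "u \<in> iso_class ` Obj C" "meets (osum ?a u)"
    using u'(1) x(1) T_plus[OF u'(2) xm] by (auto simp: u_def plus_ac simp del: image_iff)
  obtain U V where UV: "U \<in> Obj C" "u = iso_class U" "V \<in> Obj C" "v = iso_class V" using u(1) v(1) by blast
  obtain E1 where E1: "E1 \<in> S" "direct_sum C (Dom C i) U E1" using u UV O meets_osum_iff by auto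
  obtain E2 where E2: "E2 \<in> S" "direct_sum C (Cod C p) V E2" using v UV O meets_osum_iff by auto
  obtain W where W: "direct_sum C U V W" using direct_sum_exists UV by blast
  have "osum (osum ?e (osum u' v)) x = osum ?e (osum u v)" by (simp add: u_def plus_ac)
  also have "osum u v = iso_class W" using iso_class_direct_sum[OF W] UV by simp
  finally have "osum (osum ?e (osum u' v)) x = osum ?e (iso_class W)" .
  then obtain E3 where E3: "E3 \<in> S" "direct_sum C (Cod C i) W E3"
    using x(2) meets_osum_iff O direct_sum_Obj(3)[OF W] by auto
  obtain i' j' p' q' where bW: "biproduct C U V W i' j' p' q'" using W by (auto simp: direct_sum_def)
  note [simp] = biproductD[OF bW]
  obtain i1 j1 p1 q1 where b1: "biproduct C (Dom C i) (Dom C i') E1 i1 j1 p1 q1"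
    using E1(2) by (auto simp: direct_sum_def)
  obtain i2 j2 p2 q2 where b2: "biproduct C (Cod C i) (Cod C i') E3 i2 j2 p2 q2"
    using E3(2) by (auto simp: direct_sum_def)
  obtain i3 j3 p3 q3 where b3: "biproduct C (Cod C p) (Cod C q') E2 i3 j3 p3 q3"
    using E2(2) by (auto simp: direct_sum_def)
  have ip: "i \<in> Arr C" "p \<in> Arr C" "Cod C i = Dom C p" using Ses_arr[OF s] by simp_all
  have "frag_of E1 + frag_of E2 - frag_of E3 \<in> ses_relators (full_subcategory C S)"
    by (rule ses_relatorI[of "block C i2 j2 i i' p1 q1" "block C i3 j3 p q' p2 q2"])
      (use Ses_sum[OF s Ses_biproduct[OF bW] b1 b2 b3] block_simps[OF b1 b2, of i i'] block_simps[OF b2 b3, of p q']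
        E1(1) E2(1) E3(1) ip in simp_all)
  then have 1: "frag_of E1 + frag_of E2 - frag_of E3 \<in> addspan R" using R by (auto intro: addspan_base)
  \<comment> \<open>The split counterpart of \<open>E3\<close>: modulo \<open>R\<close>, both have
    the class of \<open>E1\<close> plus \<open>E2\<close>.\<close>
  obtain E where E: "E \<in> S" "direct_sum C E1 E2 E" using S_sum E1 E2 by blast
  have 2: "frag_of E1 + frag_of E2 - frag_of E \<in> addspan R"
    using direct_sum_relM[OF E(2)] E(1) E1(1) E2(1) addspan_mono[OF R] by blast
  have "frag_of E - frag_of E3 \<in> addspan R" using addspan_diff[OF 1 2] by simp
  moreover have "E \<in> osum (osum ?a ?b) (osum u v)"
    by (rule osum_member[OF _ _ E(2)]) (use E1(2) E2(2) UV O in \<open>simp_all add: iso_class_osum_iff\<close>)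
  moreover have "E3 \<in> osum ?e (osum u v)"
    using E3(2) iso_class_osum_iff[OF O(2) direct_sum_Obj(3)[OF W]] iso_class_direct_sum[OF W] UV by simp
  ultimately show ?thesis unfolding equiv_mod_def using plus_closed[OF u(1) v(1)] E(1) E3(1) by blast
qed

text \<open>The induction yields some presentation of the element as a difference of multisets, not
  the given one; the two are matched by cancellation.\<close>

lemma equiv_mod_addspan:
  assumes R: "ses_relators (full_subcategory C S) \<subseteq> R"
    and G: "\<And>g. g \<in> G \<Longrightarrow> \<exists>P Q. set_mset P \<subseteq> Obj C \<and> set_mset Q \<subseteq> Obj C \<and> g = frag_sum P - frag_sum Q \<and>
      equiv_mod R (class_sum P) (class_sum Q)"
    and x: "frag_sum P - frag_sum Q \<in> addspan G" and P: "set_mset P \<subseteq> Obj C" and Q: "set_mset Q \<subseteq> Obj C"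
  shows "equiv_mod R (class_sum P) (class_sum Q)"
proof -
  have "\<exists>P Q. set_mset P \<subseteq> Obj C \<and> set_mset Q \<subseteq> Obj C \<and> x = frag_sum P - frag_sum Q \<and>
      equiv_mod R (class_sum P) (class_sum Q)" if "x \<in> addspan G" for x
    using that
  proof induction
    case zero
    then show ?case using equiv_mod_refl zero_closed by (intro exI[of _ "{#}"]) simp
  next
    case (plus x r)
    obtain P Q where P: "set_mset P \<subseteq> Obj C" "set_mset Q \<subseteq> Obj C" "x = frag_sum P - frag_sum Q"
      "equiv_mod R (class_sum P) (class_sum Q)" using plus by blast
    obtain P' Q' where P': "set_mset P' \<subseteq> Obj C" "set_mset Q' \<subseteq> Obj C" "r = frag_sum P' - frag_sum Q'"
      "equiv_mod R (class_sum P') (class_sum Q')" using G plus by blast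
    have "equiv_mod R (class_sum (P + P')) (class_sum (Q + Q'))"
      using equiv_mod_plus[OF R P(4) P'(4)] P P' by (simp add: class_sum_union)
    then show ?case using P P' by (intro exI[of _ "P + P'"] exI[of _ "Q + Q'"]) simp
  next
    case (minus x r)
    obtain P Q where P: "set_mset P \<subseteq> Obj C" "set_mset Q \<subseteq> Obj C" "x = frag_sum P - frag_sum Q"
      "equiv_mod R (class_sum P) (class_sum Q)" using minus by blast
    obtain P' Q' where P': "set_mset P' \<subseteq> Obj C" "set_mset Q' \<subseteq> Obj C" "r = frag_sum P' - frag_sum Q'"
      "equiv_mod R (class_sum P') (class_sum Q')" using G minus by blast
    have "equiv_mod R (class_sum (P + Q')) (class_sum (Q + P'))"
      using equiv_mod_plus[OF R P(4) equiv_mod_sym[OF P'(4)]] P P' by (simp add: class_sum_union)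
    then show ?case using P P' by (intro exI[of _ "P + Q'"] exI[of _ "Q + P'"]) simp
  qed
  from this[OF x] obtain P' Q' where P': "set_mset P' \<subseteq> Obj C" "set_mset Q' \<subseteq> Obj C"
    "frag_sum P - frag_sum Q = frag_sum P' - frag_sum Q'" "equiv_mod R (class_sum P') (class_sum Q')" by blast
  \<comment> \<open>Two presentations of the same element have equal crosswise sums. Reflexivity
    applies to these, and \<open>P'\<close>, \<open>Q'\<close> are then cancelled.\<close>
  have "frag_sum (P + Q') = frag_sum (Q + P')" using P'(3) by (simp add: algebra_simps)
  then have eq: "P + Q' = Q + P'" by (rule frag_sum_inject)
  have PQ': "set_mset (P + Q') \<subseteq> Obj C" using P P' by simp
  have "equiv_mod R (osum (class_sum P) (class_sum Q')) (osum (class_sum Q) (class_sum P'))"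
    using equiv_mod_refl[OF class_sum_closed[OF PQ']] class_sum_union[OF P'(2), of P] class_sum_union[OF P'(1), of Q] eq by simp
  then show ?thesis
    by (rule equiv_mod_cancel[OF R _ P'(4)]) (intro class_sum_closed P')+
qed

text \<open>The case \<open>R = UNIV\<close>: only the quotient by \<open>S\<close> is recorded, in
  which the additional generators from \<open>S\<close> vanish.\<close>

lemma eqv_if_relN:
  assumes "frag_of X - frag_of Y \<in> addspan (ses_relators C \<union> frag_of ` S)" "X \<in> Obj C" "Y \<in> Obj C"
  shows "sim X Y"
proof -
  have "equiv_mod UNIV (class_sum {#X#}) (class_sum {#Y#})"
  proof (rule equiv_mod_addspan[of _ "ses_relators C \<union> frag_of ` S"])
    fix g assume "g \<in> ses_relators C \<union> frag_of ` S"
    then show "\<exists>P Q. set_mset P \<subseteq> Obj C \<and> set_mset Q \<subseteq> Obj C \<and> g = frag_sum P - frag_sum Q \<and>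
      equiv_mod UNIV (class_sum P) (class_sum Q)"
    proof
      assume "g \<in> ses_relators C"
      then obtain i p where s: "(i, p) \<in> Ses C" "g = frag_of (Dom C i) + frag_of (Cod C p) - frag_of (Cod C i)"
        by (auto simp: ses_relators_def)
      then show ?thesis using equiv_mod_Ses[OF subset_UNIV s(1)] Ses_arr[OF s(1)]
        by (intro exI[of _ "{#Dom C i, Cod C p#}"] exI[of _ "{#Cod C i#}"]) (simp add: iso_class_osum_zero)
    next
      assume "g \<in> frag_of ` S"
      then obtain E where E: "E \<in> S" "g = frag_of E" by blast
      then have "E \<in> Obj C" using S_Obj by blast
      moreover have "meets (iso_class E)" using E(1) isomorphic_refl[OF \<open>E \<in> Obj C\<close>] by (auto simp: meets_def iso_class_def)
      ultimately show ?thesis using E T_eqv_zero[of "iso_class E"]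
        by (intro exI[of _ "{#E#}"] exI[of _ "{#}"]) (simp add: iso_class_osum_zero equiv_mod_UNIV)
    qed
  qed (use assms in simp_all)
  then show ?thesis by (simp add: equiv_mod_UNIV iso_class_osum_zero)
qed

lemma zero_relM:
  assumes "zero_object C Z" "Z \<in> S"
  shows "frag_of Z \<in> relM"
  using direct_sum_relM[OF direct_sum_zero[OF _ assms(1)] assms(2,2,2)] assms S_Obj by auto

lemma class_sum_meets:
  assumes "set_mset P \<subseteq> S"
  shows "\<exists>E \<in> S. class_sum P = iso_class E \<and> frag_of E - frag_sum P \<in> relM"
  using assms
proof (induction P)
  case empty
  obtain Z where "Z \<in> S" "zero_object C Z" using S_zero by blast
  then show ?case using zero_relM by (auto simp: iso_class_zero intro!: bexI[of _ Z])
next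
  case (add A P)
  then obtain E where E: "E \<in> S" "class_sum P = iso_class E" "frag_of E - frag_sum P \<in> relM" by auto
  obtain F where F: "F \<in> S" "direct_sum C A E F" using S_sum[of A E] add E by auto
  have "frag_of A + frag_of E - frag_of F \<in> relM" using direct_sum_relM[OF F(2)] F E add by simp
  from addspan_diff[OF E(3) this] have "frag_of F - frag_sum (add_mset A P) \<in> relM" by (simp add: algebra_simps)
  then show ?case using F E(2) iso_class_direct_sum[OF F(2)] by (intro bexI[of _ F]) simp_all
qed

text \<open>Injectivity for Grothendieck groups. The relators of \<open>C\<close> are compared
  modulo those of the subcategory, after which the accumulated complement has to be removed
  again.\<close>

lemma relN_relM:
  assumes "x \<in> relN" "Poly_Mapping.keys x \<subseteq> S"
  shows "x \<in> relM"
proof -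
  obtain P Q where PQ: "set_mset P \<subseteq> S" "set_mset Q \<subseteq> S" "x = frag_sum P - frag_sum Q"
    using frag_sum_exists[OF assms(2)] by blast
  let ?R = "ses_relators (full_subcategory C S)"
  have "equiv_mod ?R (class_sum P) (class_sum Q)"
  proof (rule equiv_mod_addspan[of _ "ses_relators C"])
    fix g assume "g \<in> ses_relators C"
    then obtain i p where s: "(i, p) \<in> Ses C" "g = frag_of (Dom C i) + frag_of (Cod C p) - frag_of (Cod C i)"
      by (auto simp: ses_relators_def)
    then show "\<exists>P Q. set_mset P \<subseteq> Obj C \<and> set_mset Q \<subseteq> Obj C \<and> g = frag_sum P - frag_sum Q \<and>
        equiv_mod ?R (class_sum P) (class_sum Q)" using equiv_mod_Ses[OF subset_refl s(1)] Ses_arr[OF s(1)]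
      by (intro exI[of _ "{#Dom C i, Cod C p#}"] exI[of _ "{#Cod C i#}"]) (simp add: iso_class_osum_zero)
  qed (use assms PQ S_Obj in auto)
  moreover obtain E where E: "E \<in> S" "class_sum P = iso_class E" "frag_of E - frag_sum P \<in> relM"
    using class_sum_meets[OF PQ(1)] by blast
  moreover obtain F where F: "F \<in> S" "class_sum Q = iso_class F" "frag_of F - frag_sum Q \<in> relM"
    using class_sum_meets[OF PQ(2)] by blast
  ultimately obtain u E1 F1 where u: "u \<in> iso_class ` Obj C" "E1 \<in> S" "F1 \<in> S" "E1 \<in> osum (iso_class E) u"
    "F1 \<in> osum (iso_class F) u" "frag_of E1 - frag_of F1 \<in> relM"
    unfolding equiv_mod_def by auto
  obtain U where U: "U \<in> Obj C" "u = iso_class U" using u(1) by blast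
  have O: "E \<in> Obj C" "F \<in> Obj C" "E1 \<in> Obj C" "F1 \<in> Obj C" using E F u S_Obj by blast+
  have d: "direct_sum C E U E1" "direct_sum C F U F1" using u O U by (simp_all add: iso_class_osum_iff)
  obtain G where G: "G \<in> S" "direct_sum C E F1 G" using S_sum E u by blast
  \<comment> \<open>Both sides are the class of \<open>E\<close>, \<open>F\<close> and
    \<open>U\<close> together. The complement \<open>U\<close> itself need not be in
    \<open>S\<close>, but \<open>E\<close>, \<open>F\<close>, \<open>E1\<close>, \<open>F1\<close>
    are, so the comparison takes place inside the subcategory.\<close>
  have "osum (iso_class E) (iso_class F1) = osum (iso_class F) (iso_class E1)"
    using iso_class_direct_sum[OF d(1)] iso_class_direct_sum[OF d(2)] by (metis plus_left_commute)
  then have G2: "direct_sum C F E1 G" using G(2) O iso_class_osum_iff by metis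
  have "frag_of E + frag_of F1 - frag_of G \<in> relM" "frag_of F + frag_of E1 - frag_of G \<in> relM"
    using direct_sum_relM[OF G(2)] direct_sum_relM[OF G2] E F u G by simp_all
  from addspan_add[OF addspan_diff[OF addspan_add[OF addspan_diff[OF this] u(6)] E(3)] F(3)]
  show ?thesis unfolding PQ(3) by (simp add: algebra_simps)
qed

end

text \<open>All representatives of a coset contribute the same coset to the union, because
  \<open>addspan R\<close> lies in \<open>addspan R'\<close>. Everything else is then a statement
  about differences of representatives.\<close>

lemma free_Abelian_group_quotient_map:
  assumes AB: "A \<subseteq> B" and R: "R \<subseteq> carrier (free_Abelian_group A)" and R': "R' \<subseteq> carrier (free_Abelian_group B)"
    and RR': "addspan R \<subseteq> addspan R'"
    and \<phi>: "\<And>c. \<phi> c = (\<Union>x \<in> c. addspan R' #>\<^bsub>free_Abelian_group B\<^esub> x)"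
  shows "\<phi> \<in> hom (free_Abelian_group A Mod addspan R) (free_Abelian_group B Mod addspan R')" (is ?hom)
    and "(\<And>x. x \<in> addspan R' \<Longrightarrow> Poly_Mapping.keys x \<subseteq> A \<Longrightarrow> x \<in> addspan R) \<Longrightarrow>
      inj_on \<phi> (carrier (free_Abelian_group A Mod addspan R))" (is "PROP ?a \<Longrightarrow> ?inj")
    and "(\<And>y. Poly_Mapping.keys y \<subseteq> B \<Longrightarrow> \<exists>x. Poly_Mapping.keys x \<subseteq> A \<and> y - x \<in> addspan R') \<Longrightarrow>
      \<phi> ` carrier (free_Abelian_group A Mod addspan R) = carrier (free_Abelian_group B Mod addspan R')" (is "PROP ?b \<Longrightarrow> ?surj")
proof -
  let ?G = "free_Abelian_group A" and ?G' = "free_Abelian_group B" and ?H = "addspan R" and ?L = "addspan R'"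
  have nG: "normal ?H ?G"
    using comm_group.subgroup_imp_normal[OF abelian_free_Abelian_group
        group.generate_is_subgroup[OF group_free_Abelian_group R]]
    by (simp add: generate_free_Abelian_group[OF R])
  have nG': "normal ?L ?G'"
    using comm_group.subgroup_imp_normal[OF abelian_free_Abelian_group
        group.generate_is_subgroup[OF group_free_Abelian_group R']]
    by (simp add: generate_free_Abelian_group[OF R'])
  have coset: "addspan X #>\<^bsub>free_Abelian_group Y\<^esub> x = {y. y - x \<in> addspan X}" for X :: "('b \<Rightarrow>\<^sub>0 int) set" and Y x
  proof -
    have "addspan X #>\<^bsub>free_Abelian_group Y\<^esub> x = (\<lambda>h. h + x) ` addspan X" by (auto simp: r_coset_def)
    also have "\<dots> = {y. y - x \<in> addspan X}" by (auto simp: image_iff intro!: bexI[of _ "_ - x"])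
    finally show ?thesis .
  qed
  have carr: "carrier (free_Abelian_group Y Mod addspan X) =
      (\<lambda>x. addspan X #>\<^bsub>free_Abelian_group Y\<^esub> x) ` {x. Poly_Mapping.keys x \<subseteq> Y}" for X :: "('b \<Rightarrow>\<^sub>0 int) set" and Y
    by (auto simp: FactGroup_def RCOSETS_def)
  have \<phi>': "\<phi> (?H #>\<^bsub>?G\<^esub> x) = ?L #>\<^bsub>?G'\<^esub> x" for x
  proof -
    have "y - x \<in> ?L" if "z - x \<in> ?H" "y - z \<in> ?L" for y z
      using addspan_add[OF that(2), of "z - x"] that(1) RR' by auto
    moreover have "x - x \<in> ?H" using addspan.zero by simp
    ultimately show ?thesis unfolding \<phi> coset by blast
  qed
  show ?hom
  proof (rule homI)
    fix c assume "c \<in> carrier (?G Mod ?H)"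
    then show "\<phi> c \<in> carrier (?G' Mod ?L)" unfolding carr using \<phi>' AB by auto
  next
    fix c d assume "c \<in> carrier (?G Mod ?H)" "d \<in> carrier (?G Mod ?H)"
    then obtain x y where x: "Poly_Mapping.keys x \<subseteq> A" "c = ?H #>\<^bsub>?G\<^esub> x" and y: "Poly_Mapping.keys y \<subseteq> A" "d = ?H #>\<^bsub>?G\<^esub> y"
      unfolding carr by blast
    have "c \<otimes>\<^bsub>?G Mod ?H\<^esub> d = ?H #>\<^bsub>?G\<^esub> (x + y)"
      using normal.rcos_sum[OF nG, of x y] x y by simp
    moreover have "\<phi> c \<otimes>\<^bsub>?G' Mod ?L\<^esub> \<phi> d = ?L #>\<^bsub>?G'\<^esub> (x + y)"
      using normal.rcos_sum[OF nG', of x y] x y AB by (simp add: \<phi>')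
    ultimately show "\<phi> (c \<otimes>\<^bsub>?G Mod ?H\<^esub> d) = \<phi> c \<otimes>\<^bsub>?G' Mod ?L\<^esub> \<phi> d" by (simp add: \<phi>')
  qed
  show ?inj if a: "PROP ?a"
  proof (rule inj_onI)
    fix c d assume "c \<in> carrier (?G Mod ?H)" "d \<in> carrier (?G Mod ?H)" and eq: "\<phi> c = \<phi> d"
    then obtain x y where x: "Poly_Mapping.keys x \<subseteq> A" "c = ?H #>\<^bsub>?G\<^esub> x" and y: "Poly_Mapping.keys y \<subseteq> A" "d = ?H #>\<^bsub>?G\<^esub> y"
      unfolding carr by blast
    have "x \<in> ?L #>\<^bsub>?G'\<^esub> x" unfolding coset using addspan.zero by simp
    also have "?L #>\<^bsub>?G'\<^esub> x = ?L #>\<^bsub>?G'\<^esub> y" using eq by (simp only: x y \<phi>')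
    finally have "x - y \<in> ?L" by (simp add: coset)
    moreover have "Poly_Mapping.keys (x - y) \<subseteq> A" using keys_diff[of x y] x y by blast
    ultimately have xy: "x - y \<in> ?H" using a by blast
    have "z - x \<in> ?H \<longleftrightarrow> z - y \<in> ?H" for z
      using addspan_add[OF _ xy, of "z - x"] addspan_diff[OF _ xy, of "z - y"] by auto
    then show "c = d" unfolding x y coset by blast
  qed
  show ?surj if b: "PROP ?b"
  proof (intro equalityI subsetI)
    fix c assume "c \<in> \<phi> ` carrier (?G Mod ?H)"
    then show "c \<in> carrier (?G' Mod ?L)" using hom_in_carrier[OF \<open>?hom\<close>] by blast
  next
    fix c assume "c \<in> carrier (?G' Mod ?L)"
    then obtain y where y: "Poly_Mapping.keys y \<subseteq> B" "c = ?L #>\<^bsub>?G'\<^esub> y" unfolding carr by blast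
    obtain x where x: "Poly_Mapping.keys x \<subseteq> A" "y - x \<in> ?L" using b y by blast
    have "z - y \<in> ?L \<longleftrightarrow> z - x \<in> ?L" for z
      using addspan_add[OF _ x(2), of "z - y"] addspan_diff[OF _ x(2), of "z - x"] by auto
    then have "c = \<phi> (?H #>\<^bsub>?G\<^esub> x)" by (simp only: y(2) \<phi>') (simp add: coset)
    then show "c \<in> \<phi> ` carrier (?G Mod ?H)" unfolding carr using x by blast
  qed
qed

lemma K_relators_eq:
  "K_relators n N = ses_relators (Bq_iter n N) \<union> frag_of ` {T \<in> Obj (Bq_iter n N). diagonal n T}"
  unfolding K_relators_def ses_relators_def by auto

lemma ses_relators_carrier:
  assumes "additive_category C" "\<And>i p. (i, p) \<in> Ses C \<Longrightarrow> i \<in> Arr C \<and> p \<in> Arr C"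
  shows "ses_relators C \<subseteq> carrier (free_Abelian_group (Obj C))"
proof
  interpret additive_category C by fact
  fix x assume "x \<in> ses_relators C"
  then obtain i p where s: "(i, p) \<in> Ses C" "x = frag_of (Dom C i) + frag_of (Cod C p) - frag_of (Cod C i)"
    by (auto simp: ses_relators_def)
  then have "{Dom C i, Cod C p, Cod C i} \<subseteq> Obj C" using assms(2) by auto
  moreover have "Poly_Mapping.keys x \<subseteq> {Dom C i, Cod C p, Cod C i}"
    unfolding s(2) by (rule order_trans[OF keys_diff]) (use keys_add[of "frag_of (Dom C i)" "frag_of (Cod C p)"] in \<open>auto simp: keys_frag_of\<close>)
  ultimately show "x \<in> carrier (free_Abelian_group (Obj C))" by auto
qed

section \<open>The inclusion on K-groups\<close>

context
  fixes M N :: "('o, 'm) excat"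
  assumes N: "exact_category N" and M: "exact_subcategory M N" and cof: "cofinal_subcategory M N"
begin

lemma cofinal_category_Bq_iter: "cofinal_category (Bq_iter n N) (Obj (Bq_iter n M))"
  using cofinal_Bq_iter[OF N M cof, of n] by (simp add: cofinal_category_def cofinal_multicomplexes_def)

lemma Bq_iter_full: "Bq_iter n M = full_subcategory (Bq_iter n N) (Obj (Bq_iter n M))"
  using cofinal_Bq_iter[OF N M cof, of n] by simp

lemma inclusion_K_basics:
  shows "inclusion_K n N \<in> hom (K n M) (K n N)"
    and "(\<And>x. x \<in> addspan (K_relators n N) \<Longrightarrow> Poly_Mapping.keys x \<subseteq> Obj (Bq_iter n M) \<Longrightarrow> x \<in> addspan (K_relators n M))
      \<Longrightarrow> inj_on (inclusion_K n N) (carrier (K n M))"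
    and "(\<And>y. Poly_Mapping.keys y \<subseteq> Obj (Bq_iter n N) \<Longrightarrow>
        \<exists>x. Poly_Mapping.keys x \<subseteq> Obj (Bq_iter n M) \<and> y - x \<in> addspan (K_relators n N))
      \<Longrightarrow> inclusion_K n N ` carrier (K n M) = carrier (K n N)"
proof -
  interpret cofinal_category "Bq_iter n N" "Obj (Bq_iter n M)" by (rule cofinal_category_Bq_iter)
  let ?C = "Bq_iter n N" and ?S = "Obj (Bq_iter n M)"
  have sM: "ses_relators (Bq_iter n M) \<subseteq> ses_relators ?C"
    by (subst Bq_iter_full) (auto simp: ses_relators_def)
  have "ses_relators ?C \<subseteq> carrier (free_Abelian_group (Obj ?C))"
    by (rule ses_relators_carrier[OF additive_category_axioms]) (use Ses_arr in blast)
  then have RN: "K_relators n N \<subseteq> carrier (free_Abelian_group (Obj ?C))"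
    by (auto simp: K_relators_eq keys_frag_of)
  have "Poly_Mapping.keys x \<subseteq> ?S" if "x \<in> ses_relators (Bq_iter n M)" for x
  proof -
    obtain i p where s: "(i, p) \<in> Ses (Bq_iter n M)"
      "x = frag_of (Dom (Bq_iter n M) i) + frag_of (Cod (Bq_iter n M) p) - frag_of (Cod (Bq_iter n M) i)"
      using \<open>x \<in> ses_relators (Bq_iter n M)\<close> by (auto simp: ses_relators_def)
    have "{Dom ?C i, Cod ?C p, Cod ?C i} \<subseteq> ?S" using s(1) by (subst (asm) Bq_iter_full) simp
    moreover have "x = frag_of (Dom ?C i) + frag_of (Cod ?C p) - frag_of (Cod ?C i)"
      using s(2) by (subst (asm) (1 2 3) Bq_iter_full) simp
    moreover have "Poly_Mapping.keys (frag_of a + frag_of b - frag_of c) \<subseteq> {a, b, c}" for a b c :: "('o, 'm) mobj"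
      by (rule order_trans[OF keys_diff]) (use keys_add[of "frag_of a" "frag_of b"] in \<open>auto simp: keys_frag_of\<close>)
    ultimately show ?thesis by blast
  qed
  then have RM: "K_relators n M \<subseteq> carrier (free_Abelian_group ?S)"
    by (auto simp: K_relators_eq keys_frag_of)
  have "K_relators n M \<subseteq> K_relators n N" using sM S_Obj by (auto simp: K_relators_eq)
  then have sub: "addspan (K_relators n M) \<subseteq> addspan (K_relators n N)" by (rule addspan_mono)
  have KM: "K n M = free_Abelian_group ?S Mod addspan (K_relators n M)"
    using generate_free_Abelian_group[OF RM] by (simp add: K_def K_relations_def K_free_def)
  have KN: "K n N = free_Abelian_group (Obj ?C) Mod addspan (K_relators n N)"
    using generate_free_Abelian_group[OF RN] by (simp add: K_def K_relations_def K_free_def)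
  have incl: "inclusion_K n N c = (\<Union>x \<in> c. addspan (K_relators n N) #>\<^bsub>free_Abelian_group (Obj ?C)\<^esub> x)" for c
    using generate_free_Abelian_group[OF RN]
    by (simp add: K_map_def K_relations_def K_free_def mobj.map_ident frag_expansion[symmetric])
  note quot = free_Abelian_group_quotient_map[OF S_Obj RM RN sub incl, folded KM KN]
  show "inclusion_K n N \<in> hom (K n M) (K n N)" by (rule quot(1))
  show "(\<And>x. x \<in> addspan (K_relators n N) \<Longrightarrow> Poly_Mapping.keys x \<subseteq> ?S \<Longrightarrow> x \<in> addspan (K_relators n M))
      \<Longrightarrow> inj_on (inclusion_K n N) (carrier (K n M))" by (rule quot(2))
  show "(\<And>y. Poly_Mapping.keys y \<subseteq> Obj ?C \<Longrightarrow> \<exists>x. Poly_Mapping.keys x \<subseteq> ?S \<and> y - x \<in> addspan (K_relators n N))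
      \<Longrightarrow> inclusion_K n N ` carrier (K n M) = carrier (K n N)" by (rule quot(3))
qed

lemma inclusion_K_0: "inclusion_K 0 N \<in> mon (K 0 M) (K 0 N)"
proof -
  interpret cofinal_category "Bq_iter 0 N" "Obj (Bq_iter 0 M)" by (rule cofinal_category_Bq_iter)
  have "K_relators 0 N = ses_relators (Bq_iter 0 N)" by (simp add: K_relators_eq diagonal_def)
  moreover have "K_relators 0 M = ses_relators (full_subcategory (Bq_iter 0 N) (Obj (Bq_iter 0 M)))"
    unfolding Bq_iter_full[symmetric] by (simp add: K_relators_eq diagonal_def)
  ultimately show ?thesis
    using inclusion_K_basics(1,2)[of 0] relN_relM by (auto simp: mon_def)
qed

text \<open>For \<open>E\<close> to inherit diagonality in direction \<open>i\<close> from
  \<open>T\<close>, the complement must have it, too. In direction 0 this is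
  \<open>diff1 U = diff2 U\<close>; in an inner direction it comes from choosing \<open>Q\<close> as
  the entries diagonal in direction \<open>j\<close>.\<close>

lemma diagonal_summand:
  assumes T: "T \<in> Obj (Bq_iter (Suc m) N)" "diagonal_in i T" "i < Suc m"
  obtains U E where "U \<in> Obj (Bq_iter (Suc m) N)" "diff1 U = diff2 U" "E \<in> Obj (Bq_iter (Suc m) M)" "diagonal_in i E"
    "direct_sum (Bq_iter (Suc m) N) T U E"
proof -
  let ?C = "Bq_iter m N"
  have O: "Obj (Bq_iter (Suc m) M) = Bq_obj (full_subcategory ?C (Obj (Bq_iter m M)))"
    using Bq_iter_full[of m] by (metis Bq_iter_simps(2) Bq_simps(1))
  have TO: "T \<in> Bq_obj ?C" using T by (simp add: Bq_iter_simps)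
  show thesis
  proof (cases i)
    case 0
    interpret cofinal_multicomplexes ?C "Obj ?C" "Obj (Bq_iter m M)" using cofinal_Bq_iter[OF N M cof, of m] by simp
    have gT: "graded T k \<in> Obj ?C" for k using TO by (rule Bq_objD)
    show thesis
    proof (rule diagonal_complement[OF TO gT TO gT])
      show "sim (graded T k) (graded T k)" for k using gT by (intro eqv_refl imageI)
      fix U E E' assume "U \<in> Bq_obj ?C" "diff1 U = diff2 U"
        "E \<in> Bq_obj (full_subcategory ?C (Obj (Bq_iter m M)))" "direct_sum (Bq ?C) T U E"
      then show thesis using diagonal_direct_sum[of T U E] T(2) 0
        by (intro that[of U E]) (simp_all add: O Bq_iter_simps(2)[of m N])
    qed
  next
    case (Suc j)
    let ?Q = "{X \<in> Obj ?C. diagonal_in j X}"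
    interpret cofinal_multicomplexes ?C ?Q "Obj (Bq_iter m M)"
      using cofinal_Bq_iter[OF N M cof, of m] T(3) Suc by simp
    have gT: "graded T k \<in> ?Q" for k using Bq_objD(1)[OF TO] T(2) Suc by simp
    show thesis
    proof (rule diagonal_complement[OF TO gT TO gT])
      show "sim (graded T k) (graded T k)" for k using gT by (intro eqv_refl imageI)
      fix U E E' assume U: "U \<in> Bq_obj ?C" "diff1 U = diff2 U" "\<And>k. graded U k \<in> ?Q"
        "E \<in> Bq_obj (full_subcategory ?C (Obj (Bq_iter m M)))" "direct_sum (Bq ?C) T U E"
      have "direct_sum ?C (graded T k) (graded U k) (graded E k)" for k
        using U(5) biproduct_component unfolding direct_sum_def by blast
      then have "graded E k \<in> ?Q" for k using Q_sum gT U(3) by blast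
      then show thesis using U Suc by (intro that[of U E]) (simp_all add: O Bq_iter_simps(2)[of m N])
    qed
  qed
qed

text \<open>Inner directions enter only through \<open>diagonal_summand\<close>. The errors it
  leaves are diagonal in the outermost direction, where common diagonal complements of equivalent
  pairs are available.\<close>

lemma inclusion_K_Suc: "inclusion_K (Suc m) N \<in> iso (K (Suc m) M) (K (Suc m) N)"
proof -
  let ?C = "Bq_iter (Suc m) N" and ?S = "Obj (Bq_iter (Suc m) M)" and ?D = "Bq_iter m N" and ?SD = "Obj (Bq_iter m M)"
  interpret L0: cofinal_multicomplexes ?D "Obj ?D" ?SD using cofinal_Bq_iter[OF N M cof, of m] by simp
  interpret cofinal_category ?C ?S by (rule cofinal_category_Bq_iter)
  have C: "?C = Bq ?D" by (rule Bq_iter_simps(2))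
  have O: "?S = Bq_obj (full_subcategory ?D ?SD)"
    using Bq_iter_full[of m] by (metis Bq_iter_simps(2) Bq_simps(1))
  have gr: "X \<in> Obj ?C \<Longrightarrow> graded X k \<in> Obj ?D" for X k by (simp add: C Bq_objD)
  define DN where "DN = {T \<in> Obj ?C. diagonal (Suc m) T}"
  define DM where "DM = {T \<in> ?S. diagonal (Suc m) T}"
  define OD where "OD = {T \<in> Obj ?C. diff1 T = diff2 T}"
  have KN: "K_relators (Suc m) N = ses_relators ?C \<union> frag_of ` DN" by (simp add: K_relators_eq DN_def)
  have KM: "K_relators (Suc m) M = ses_relators (full_subcategory ?C ?S) \<union> frag_of ` DM"
    unfolding Bq_iter_full[symmetric] by (simp add: K_relators_eq DM_def)
  have OD_DN: "OD \<subseteq> DN" unfolding OD_def DN_def diagonal_def by (auto intro!: exI[of _ 0])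
  \<comment> \<open>Closure under sums lets the errors of many diagonal relators collect in a single
    difference.\<close>
  have OD_sum: "\<exists>E \<in> OD. frag_of A + frag_of B - frag_of E \<in> relN" if AB: "A \<in> OD" "B \<in> OD" for A B
  proof -
    obtain E where E: "direct_sum ?C A B E" using direct_sum_exists AB unfolding OD_def by blast
    then have "E \<in> OD"
      using L0.diagonal_direct_sum[of A B E] AB direct_sum_Obj(3)[OF E] unfolding OD_def C by blast
    then show ?thesis using direct_sum_relN[OF E] by blast
  qed
  have complement: "\<exists>U \<in> OD. \<exists>E \<in> ?S. \<exists>E' \<in> ?S. direct_sum ?C X U E \<and> direct_sum ?C Y U E'"
    if XY: "X \<in> Obj ?C" "Y \<in> Obj ?C" "\<And>k. L0.sim (graded X k) (graded Y k)" for X Y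
    using XY(1,2) unfolding C Bq_simps
    by (rule L0.diagonal_complement[OF _ gr[OF XY(1)] _ gr[OF XY(2)] XY(3)]) (auto simp: OD_def O C)
  obtain X0 where X0: "X0 \<in> OD"
  proof -
    obtain Z where "Z \<in> Obj ?C" using zero_object_exists by (auto simp: zero_object_def)
    then show thesis using complement[of Z Z] L0.eqv_refl gr that by blast
  qed
  have summand: "\<exists>U \<in> OD. \<exists>E \<in> DM. frag_of T + frag_of U - frag_of E \<in> relN" if "T \<in> DN" for T
  proof -
    obtain i where i: "i < Suc m" "diagonal_in i T" using \<open>T \<in> DN\<close> by (auto simp: DN_def diagonal_def)
    obtain U E where "U \<in> Obj ?C" "diff1 U = diff2 U" "E \<in> ?S" "diagonal_in i E" "direct_sum ?C T U E"
      using diagonal_summand[of T m i] i \<open>T \<in> DN\<close> by (auto simp: DN_def)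
    then show ?thesis using direct_sum_relN i(1) unfolding OD_def DM_def diagonal_def by blast
  qed
  \<comment> \<open>\<open>e\<close> collects diagonal objects that already belong to
    \<open>M\<close>, and \<open>frag_of X - frag_of Y\<close> is the total error.\<close>
  have decomp: "\<exists>e \<in> addspan (frag_of ` DM). \<exists>X \<in> OD. \<exists>Y \<in> OD. x - e - (frag_of X - frag_of Y) \<in> relN"
    if "x \<in> addspan (K_relators (Suc m) N)" for x
    using that
  proof induction
    case zero
    show ?case using X0 addspan.zero[of "ses_relators ?C"]
      by (intro bexI[of _ 0] bexI[of _ X0] addspan.zero) simp_all
  next
    case (plus x r)
    then obtain e X Y where e: "e \<in> addspan (frag_of ` DM)" and XY: "X \<in> OD" "Y \<in> OD"
      and x: "x - e - (frag_of X - frag_of Y) \<in> relN" by blast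
    consider "r \<in> ses_relators ?C" | T where "T \<in> DN" "r = frag_of T" using plus(2) KN by blast
    then show ?case
    proof cases
      case 1
      then have "x + r - e - (frag_of X - frag_of Y) \<in> relN" using addspan.plus[OF x 1] by (simp add: algebra_simps)
      then show ?thesis using e XY by blast
    next
      case 2
      obtain U E where U: "U \<in> OD" "E \<in> DM" "frag_of T + frag_of U - frag_of E \<in> relN" using summand 2 by blast
      \<comment> \<open>Modulo \<open>relN\<close> the generator \<open>T\<close> is
        \<open>E\<close> minus \<open>U\<close>, so \<open>U\<close> joins the negative part
        \<open>Y\<close>; for a subtracted relator it joins \<open>X\<close>.\<close>
      obtain Y' where Y': "Y' \<in> OD" "frag_of U + frag_of Y - frag_of Y' \<in> relN" using OD_sum U(1) XY(2) by blast
      have "x + r - (e + frag_of E) - (frag_of X - frag_of Y') \<in> relN"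
        using addspan_diff[OF addspan_add[OF x U(3)] Y'(2)] unfolding 2 by (simp add: algebra_simps)
      then show ?thesis using addspan.plus[OF e] U(2) Y'(1) XY(1) by blast
    qed
  next
    case (minus x r)
    then obtain e X Y where e: "e \<in> addspan (frag_of ` DM)" and XY: "X \<in> OD" "Y \<in> OD"
      and x: "x - e - (frag_of X - frag_of Y) \<in> relN" by blast
    consider "r \<in> ses_relators ?C" | T where "T \<in> DN" "r = frag_of T" using minus(2) KN by blast
    then show ?case
    proof cases
      case 1
      then have "x - r - e - (frag_of X - frag_of Y) \<in> relN" using addspan.minus[OF x 1] by (simp add: algebra_simps)
      then show ?thesis using e XY by blast
    next
      case 2
      obtain U E where U: "U \<in> OD" "E \<in> DM" "frag_of T + frag_of U - frag_of E \<in> relN" using summand 2 by blast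
      obtain X' where X': "X' \<in> OD" "frag_of U + frag_of X - frag_of X' \<in> relN" using OD_sum U(1) XY(1) by blast
      have "x - r - (e - frag_of E) - (frag_of X' - frag_of Y) \<in> relN"
        using addspan_add[OF addspan_diff[OF x U(3)] X'(2)] unfolding 2 by (simp add: algebra_simps)
      then show ?thesis using addspan.minus[OF e] U(2) X'(1) XY(2) by blast
    qed
  qed
  have relN_sub: "relN \<subseteq> addspan (K_relators (Suc m) N)" unfolding KN by (rule addspan_mono) simp
  have inj: "x \<in> addspan (K_relators (Suc m) M)"
    if x: "x \<in> addspan (K_relators (Suc m) N)" "Poly_Mapping.keys x \<subseteq> ?S" for x
  proof -
    obtain e X Y where e: "e \<in> addspan (frag_of ` DM)" and XY: "X \<in> OD" "Y \<in> OD"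
      and d: "x - e - (frag_of X - frag_of Y) \<in> relN" using decomp[OF x(1)] by blast
    have XYO: "X \<in> Obj ?C" "Y \<in> Obj ?C" using XY by (simp_all add: OD_def)
    have DMS: "addspan (frag_of ` DM) \<subseteq> addspan (frag_of ` ?S)" by (rule addspan_mono) (auto simp: DM_def)
    have xe: "x - e \<in> addspan (frag_of ` ?S)"
      by (rule addspan_diff) (use x(2) e DMS in \<open>auto simp: addspan_frag_of\<close>)
    \<comment> \<open>The difference is \<open>frag_of X - frag_of Y\<close>, which thus vanishes
      modulo short exact sequences and generators from \<open>S\<close>.\<close>
    have "(x - e) - (x - e - (frag_of X - frag_of Y)) \<in> addspan (ses_relators ?C \<union> frag_of ` ?S)"
      by (rule addspan_diff) (use xe d addspan_mono[of _ "ses_relators ?C \<union> frag_of ` ?S"] in blast)+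
    then have "sim X Y" by (intro eqv_if_relN XYO) simp
    then obtain V F F' where V: "F \<in> ?S" "F' \<in> ?S" "direct_sum ?C X V F" "direct_sum ?C Y V F'"
      using sim_iff[OF XYO] by blast
    \<comment> \<open>The complement \<open>V\<close> need not be diagonal. It is used only to
      obtain equivalence in each degree, from which \<open>complement\<close> builds a diagonal
      one.\<close>
    have "L0.sim (graded X k) (graded Y k)" for k
    proof -
      have "direct_sum ?D (graded X k) (graded V k) (graded F k)" "direct_sum ?D (graded Y k) (graded V k) (graded F' k)"
        using V(3,4) L0.biproduct_component unfolding C direct_sum_def by blast+
      moreover have "graded F k \<in> ?SD" "graded F' k \<in> ?SD"
        using V(1,2) L0.Bq_obj_full_graded[OF L0.S_Obj] unfolding O by blast+
      moreover have "graded V k \<in> Obj ?D" using gr direct_sum_Obj(2)[OF V(3)] by blast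
      ultimately show ?thesis using L0.sim_iff[OF gr[OF XYO(1)] gr[OF XYO(2)]] by blast
    qed
    from complement[OF XYO this] obtain U E E' where U: "U \<in> OD" "E \<in> ?S" "E' \<in> ?S"
      "direct_sum ?C X U E" "direct_sum ?C Y U E'" by blast
    have "diff1 E = diff2 E" "diff1 E' = diff2 E'"
      using L0.diagonal_direct_sum[of X U E] L0.diagonal_direct_sum[of Y U E'] U XY unfolding OD_def C by blast+
    then have E: "E \<in> DM" "E' \<in> DM" using U(2,3) unfolding DM_def diagonal_def by (auto intro!: exI[of _ 0])
    \<comment> \<open>Replacing \<open>X\<close> and \<open>Y\<close> by \<open>E\<close> and
      \<open>E'\<close> cancels the class of \<open>U\<close>; what remains is a relation of
      \<open>N\<close> supported on objects of \<open>M\<close>.\<close>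
    define y where "y = x - e - (frag_of E - frag_of E')"
    have "y \<in> relN"
      using addspan_add[OF d addspan_diff[OF direct_sum_relN[OF U(4)] direct_sum_relN[OF U(5)]]]
      by (simp add: y_def algebra_simps)
    moreover have "Poly_Mapping.keys y \<subseteq> ?S"
    proof -
      have "y \<in> addspan (frag_of ` ?S)"
        unfolding y_def by (intro addspan_diff[OF xe] addspan_diff addspan_base imageI U)
      then show ?thesis by (simp add: addspan_frag_of)
    qed
    ultimately have y: "y \<in> relM" by (rule relN_relM)
    have "frag_of E \<in> addspan (frag_of ` DM)" "frag_of E' \<in> addspan (frag_of ` DM)"
      using E by (simp_all add: addspan_base)
    from addspan_add[OF e addspan_diff[OF this]]
    have z: "e + (frag_of E - frag_of E') \<in> addspan (frag_of ` DM)" .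
    have "relM \<subseteq> addspan (K_relators (Suc m) M)" "addspan (frag_of ` DM) \<subseteq> addspan (K_relators (Suc m) M)"
      unfolding KM by (simp_all add: addspan_mono)
    from addspan_add[OF subsetD[OF this(1) y] subsetD[OF this(2) z]] show ?thesis by (simp add: y_def)
  qed
  have surj: "\<exists>x. Poly_Mapping.keys x \<subseteq> ?S \<and> y - x \<in> addspan (K_relators (Suc m) N)"
    if "Poly_Mapping.keys y \<subseteq> Obj ?C" for y
    using that
  proof (induction rule: frag_induction)
    case zero
    then show ?case by (intro exI[of _ 0]) (simp add: addspan.zero)
  next
    case (one X)
    then obtain U E where U: "U \<in> OD" "E \<in> ?S" "direct_sum ?C X U E"
      using complement[of X X] L0.eqv_refl gr by blast
    \<comment> \<open>The complement is diagonal, so its class is zero and \<open>X\<close> has the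
      class of \<open>E\<close>.\<close>
    have "frag_of U \<in> addspan (K_relators (Suc m) N)" unfolding KN using OD_DN U(1) by (intro addspan_base) blast
    then have "frag_of X - frag_of E \<in> addspan (K_relators (Suc m) N)"
      using addspan_diff[OF subsetD[OF relN_sub direct_sum_relN[OF U(3)]]] by fastforce
    then show ?case using U(2) by (intro exI[of _ "frag_of E"]) (simp add: keys_frag_of)
  next
    case (diff a b)
    then obtain x x' where x: "Poly_Mapping.keys x \<subseteq> ?S" "a - x \<in> addspan (K_relators (Suc m) N)"
      "Poly_Mapping.keys x' \<subseteq> ?S" "b - x' \<in> addspan (K_relators (Suc m) N)" by blast
    then show ?case
      using keys_diff[of x x'] addspan_diff[OF x(2,4)] by (intro exI[of _ "x - x'"]) (auto simp: algebra_simps)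
  qed
  show ?thesis
    using inclusion_K_basics(1) inclusion_K_basics(2)[OF inj] inclusion_K_basics(3)[OF surj]
    by (simp add: iso_def bij_betw_def)
qed

end

theorem theorem3p6:
  fixes M N :: "('o, 'm) excat"
  assumes "exact_category N"
    and "exact_subcategory M N"
    and "cofinal_subcategory M N"
  shows "inclusion_K 0 N \<in> mon (K 0 M) (K 0 N) \<and>
    (\<forall>n > 0. inclusion_K n N \<in> iso (K n M) (K n N))"
  using inclusion_K_0[OF assms] inclusion_K_Suc[OF assms] by (metis gr0_implies_Suc)

end
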